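(* Let $\mathcal{H}_1,\mathcal{H}_2$ be complex separable Hilbert spaces, let $A:\operatorname{dom}(A)\subseteq\mathcal{H}_1\to\mathcal{H}_2$ be a densely defined, closed, linear operator with $\ker(A)=\{0\}$ and $\inf(\sigma(A^*A))=0$, and let $R$ be a densely defined, closable operator in $\mathcal{H}_1$ with $\operatorname{dom}(R)\cap\operatorname{dom}(R^* )\supseteq\operatorname{dom}(A)$. Then $Q_{|A|,R}$ is injective and closed, and $$(Q_{|A|,R}-zI_{\mathcal{H}_1\oplus\mathcal{H}_1})^{-1}=\begin{pmatrix}zM(z)^{-1}&\overline{M(z)^{-1}|A|}\\|A|M(z)^{-1}&z^{-1}\,\overline{|A|M(z)^{-1}|A|}-z^{-1}I_{\mathcal{H}_1}\end{pmatrix}$$ for all $z\in\rho(Q_{|A|,R})\setminus\{0\}=\{\zeta\in\mathbb{C}\,|\,M(\zeta)^{-1}\in\mathcal{B}(\mathcal{H}_1)\}=\rho(M(\cdot))$, and $$\sigma(Q_{|A|,R})\cup\{0\}=\sigma(M(\cdot)).$$ Suppose in addition that $R$ is accretive. Then $i\lambda\in\rho(M(\cdot))$ for all $\lambda>0$ and also $i\,Q_{|A|,R}$ is accretive. Moreover, $-i\,Q_{|A|,R}$ then generates a (strongly continuous) contraction semigroup $\exp(-i\,Q_{|A|,R}\,t)$, $t\geq0$, in $\mathcal{H}_1\oplus\mathcal{H}_1$.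
   Context: $|A|=(A^*A)^{1/2}$, with $\operatorname{dom}(|A|)=\operatorname{dom}(A)$. $\mathcal{B}(\mathcal{H})$ denotes the bounded everywhere defined linear operators on $\mathcal{H}$; a bar over an operator denotes its closure. $$Q_{|A|,R}=\begin{pmatrix}-iR&|A|\\|A|&0\end{pmatrix},\quad\operatorname{dom}(Q_{|A|,R})=\operatorname{dom}(|A|)\oplus\operatorname{dom}(|A|)\subseteq\mathcal{H}_1\oplus\mathcal{H}_1.$$ The quadratic operator pencil $M(\cdot)$ in $\mathcal{H}_1$ is $M(z)=|A|^2-izR-z^2I_{\mathcal{H}_1}$, $\operatorname{dom}(M(z))=\operatorname{dom}(|A|^2)$, $z\in\mathbb{C}$. Its spectrum and resolvent set are $\sigma(M(\cdot))=\{\lambda\in\mathbb{C}\,|\,0\in\sigma(M(\lambda))\}$ and $\rho(M(\cdot))=\{z\in\mathbb{C}\,|\,0\in\rho(M(z))\}=\mathbb{C}\setminus\sigma(M(\cdot))$. An operator $T$ in $\mathcal{H}$ is accretive if $\operatorname{Re}((f,Tf)_{\mathcal{H}})\geq0$ for all $f\in\operatorname{dom}(T)$. *)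

theory Defs
  imports "HOL-Analysis.Analysis"
begin

section \<open>Complex Hilbert spaces\<close>

text \<open>
  The inner product \<open>cinner\<close> is linear in its second argument. Positive definiteness, the norm and
  the topology are those of the underlying real inner product space, whose inner product is the real
  part of \<open>cinner\<close>; so \<open>cinner x x\<close> equals \<open>(norm x)\<^sup>2\<close>.
\<close>

class scaleC =
  fixes scaleC :: "complex \<Rightarrow> 'a \<Rightarrow> 'a"  (infixr "*\<^sub>C" 75)

class complex_inner = real_inner + scaleC +
  fixes cinner :: "'a \<Rightarrow> 'a \<Rightarrow> complex"
  assumes scaleC_add_right: "a *\<^sub>C (x + y) = a *\<^sub>C x + a *\<^sub>C y"
    and scaleC_add_left: "(a + b) *\<^sub>C x = a *\<^sub>C x + b *\<^sub>C x"
    and scaleC_scaleC: "a *\<^sub>C b *\<^sub>C x = (a * b) *\<^sub>C x"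
    and scaleR_scaleC: "r *\<^sub>R x = complex_of_real r *\<^sub>C x"
    and cinner_commute: "cinner x y = cnj (cinner y x)"
    and cinner_add_right: "cinner x (y + z) = cinner x y + cinner x z"
    and cinner_scaleC_right: "cinner x (a *\<^sub>C y) = a * cinner x y"
    and inner_eq_Re_cinner: "x \<bullet> y = Re (cinner x y)"

class chilbert_space = complex_inner + complete_space
begin

subclass banach ..

end

instantiation prod :: (complex_inner, complex_inner) complex_inner
begin

definition scaleC_prod :: "complex \<Rightarrow> 'a \<times> 'b \<Rightarrow> 'a \<times> 'b"
  where "scaleC_prod a x = (a *\<^sub>C fst x, a *\<^sub>C snd x)"

definition cinner_prod :: "'a \<times> 'b \<Rightarrow> 'a \<times> 'b \<Rightarrow> complex"
  where "cinner_prod x y = cinner (fst x) (fst y) + cinner (snd x) (snd y)"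

instance
proof
  fix a b :: complex and r :: real and x y z :: "'a \<times> 'b"
  show "a *\<^sub>C (x + y) = a *\<^sub>C x + a *\<^sub>C y"
    by (simp add: scaleC_prod_def scaleC_add_right)
  show "(a + b) *\<^sub>C x = a *\<^sub>C x + b *\<^sub>C x"
    by (simp add: scaleC_prod_def scaleC_add_left)
  show "a *\<^sub>C b *\<^sub>C x = (a * b) *\<^sub>C x"
    by (simp add: scaleC_prod_def scaleC_scaleC)
  show "r *\<^sub>R x = complex_of_real r *\<^sub>C x"
    by (simp add: scaleC_prod_def scaleR_prod_def scaleR_scaleC)
  show "cinner x y = cnj (cinner y x)"
    unfolding cinner_prod_def complex_cnj_add by (metis cinner_commute)
  show "cinner x (y + z) = cinner x y + cinner x z"
    by (simp add: cinner_prod_def cinner_add_right)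
  show "cinner x (a *\<^sub>C y) = a * cinner x y"
    by (simp add: cinner_prod_def scaleC_prod_def cinner_scaleC_right algebra_simps)
  show "x \<bullet> y = Re (cinner x y)"
    by (simp add: cinner_prod_def inner_prod_def inner_eq_Re_cinner)
qed

end

instance prod :: (chilbert_space, chilbert_space) chilbert_space ..


section \<open>Unbounded operators\<close>

text \<open>
  A (not necessarily everywhere defined) operator is identified with its graph. Its domain is then
  \<^const>\<open>Domain\<close>, its inverse is \<^const>\<open>converse\<close>, and its closure is the topological
  \<^const>\<open>closure\<close> of the graph. Sums, multiples and products below carry their natural domains.
\<close>

type_synonym ('a, 'b) graph = "('a \<times> 'b) set"

definition linear_operator :: "('a::complex_inner, 'b::complex_inner) graph \<Rightarrow> bool"
  where "linear_operator T \<longleftrightarrow>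
    0 \<in> T \<and> (\<forall>u\<in>T. \<forall>v\<in>T. u + v \<in> T) \<and> (\<forall>a. \<forall>u\<in>T. a *\<^sub>C u \<in> T) \<and> single_valued T"

definition densely_defined :: "('a::topological_space, 'b) graph \<Rightarrow> bool"
  where "densely_defined T \<longleftrightarrow> closure (Domain T) = UNIV"

definition closed_operator :: "('a::complex_inner, 'b::complex_inner) graph \<Rightarrow> bool"
  where "closed_operator T \<longleftrightarrow> linear_operator T \<and> closed T"

definition closable_operator :: "('a::complex_inner, 'b::complex_inner) graph \<Rightarrow> bool"
  where "closable_operator T \<longleftrightarrow> linear_operator T \<and> single_valued (closure T)"

definition ker_op :: "('a, 'b::zero) graph \<Rightarrow> 'a set"
  where "ker_op T = {x. (x, 0) \<in> T}"

definition injective_operator :: "('a, 'b) graph \<Rightarrow> bool"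
  where "injective_operator T \<longleftrightarrow> (\<forall>x x' y. (x, y) \<in> T \<longrightarrow> (x', y) \<in> T \<longrightarrow> x = x')"

definition bounded_operators :: "('a::complex_inner, 'b::complex_inner) graph set"
  where "bounded_operators = {T. linear_operator T \<and> Domain T = UNIV \<and>
    (\<exists>K. \<forall>(x, y)\<in>T. norm y \<le> K * norm x)}"

definition zero_op :: "('a, 'b::zero) graph"
  where "zero_op = UNIV \<times> {0}"

definition scale_op :: "complex \<Rightarrow> ('a, 'b::scaleC) graph \<Rightarrow> ('a, 'b) graph"  (infixr "\<cdot>\<^sub>o" 75)
  where "c \<cdot>\<^sub>o T = {(x, c *\<^sub>C y) | x y. (x, y) \<in> T}"

definition add_op :: "('a, 'b::plus) graph \<Rightarrow> ('a, 'b) graph \<Rightarrow> ('a, 'b) graph"  (infixl "+\<^sub>o" 65)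
  where "S +\<^sub>o T = {(x, y + z) | x y z. (x, y) \<in> S \<and> (x, z) \<in> T}"

definition diff_op :: "('a, 'b::minus) graph \<Rightarrow> ('a, 'b) graph \<Rightarrow> ('a, 'b) graph"  (infixl "-\<^sub>o" 65)
  where "S -\<^sub>o T = {(x, y - z) | x y z. (x, y) \<in> S \<and> (x, z) \<in> T}"

text \<open>The operator product \<open>S T\<close> applies \<open>T\<close> first, so the arguments of \<^const>\<open>relcomp\<close> are swapped.\<close>

definition comp_op :: "('b, 'c) graph \<Rightarrow> ('a, 'b) graph \<Rightarrow> ('a, 'c) graph"  (infixr "\<circ>\<^sub>o" 70)
  where "S \<circ>\<^sub>o T = T O S"

definition adj :: "('a::complex_inner, 'b::complex_inner) graph \<Rightarrow> ('b, 'a) graph"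
  where "adj T = {(y, z). \<forall>(x, w)\<in>T. cinner y w = cinner z x}"

definition selfadjoint :: "('a::complex_inner, 'a) graph \<Rightarrow> bool"
  where "selfadjoint T \<longleftrightarrow> densely_defined T \<and> adj T = T"

definition nonnegative :: "('a::complex_inner, 'a) graph \<Rightarrow> bool"
  where "nonnegative T \<longleftrightarrow> (\<forall>(f, g)\<in>T. cinner f g \<in> \<real> \<and> 0 \<le> Re (cinner f g))"

text \<open>
  A nonnegative self-adjoint operator has exactly one nonnegative self-adjoint square root, so for
  such operators the choice made here is the usual \<open>T\<^bsup>1/2\<^esup>\<close>.
\<close>

definition sqrt_op :: "('a::complex_inner, 'a) graph \<Rightarrow> ('a, 'a) graph"
  where "sqrt_op T = (SOME B. selfadjoint B \<and> nonnegative B \<and> B \<circ>\<^sub>o B = T)"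

definition abs_op :: "('a::complex_inner, 'b::complex_inner) graph \<Rightarrow> ('a, 'a) graph"
  where "abs_op A = sqrt_op (adj A \<circ>\<^sub>o A)"

definition accretive :: "('a::complex_inner, 'a) graph \<Rightarrow> bool"
  where "accretive T \<longleftrightarrow> (\<forall>(f, g)\<in>T. 0 \<le> Re (cinner f g))"

definition resolvent_set :: "('a::complex_inner, 'a) graph \<Rightarrow> complex set"
  where "resolvent_set T = {z. (T -\<^sub>o z \<cdot>\<^sub>o Id)\<inverse> \<in> bounded_operators}"

definition spectrum :: "('a::complex_inner, 'a) graph \<Rightarrow> complex set"
  where "spectrum T = - resolvent_set T"


section \<open>Block operator matrices and operator pencils\<close>

text \<open>The domain is \<open>(dom T11 \<inter> dom T21) \<times> (dom T12 \<inter> dom T22)\<close>.\<close>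

definition block_op ::
  "('a, 'c::plus) graph \<Rightarrow> ('b, 'c) graph \<Rightarrow> ('a, 'd::plus) graph \<Rightarrow> ('b, 'd) graph \<Rightarrow> ('a \<times> 'b, 'c \<times> 'd) graph"
  where "block_op T11 T12 T21 T22 =
    {((x1, x2), (a + b, c + d)) | x1 x2 a b c d.
      (x1, a) \<in> T11 \<and> (x2, b) \<in> T12 \<and> (x1, c) \<in> T21 \<and> (x2, d) \<in> T22}"

text \<open>
  When \<open>dom |A| \<subseteq> dom R\<close>, the natural domains of the next two operators are
  \<open>dom |A| \<times> dom |A|\<close> and \<open>dom (|A|\<^sup>2)\<close>.
\<close>

definition Q_op ::
  "('a::complex_inner, 'b::complex_inner) graph \<Rightarrow> ('a, 'a) graph \<Rightarrow> ('a \<times> 'a, 'a \<times> 'a) graph"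
  where "Q_op A R = block_op ((- \<i>) \<cdot>\<^sub>o R) (abs_op A) (abs_op A) zero_op"

definition pencil ::
  "('a::complex_inner, 'b::complex_inner) graph \<Rightarrow> ('a, 'a) graph \<Rightarrow> complex \<Rightarrow> ('a, 'a) graph"
  where "pencil A R z = (abs_op A \<circ>\<^sub>o abs_op A) -\<^sub>o (\<i> * z) \<cdot>\<^sub>o R -\<^sub>o z\<^sup>2 \<cdot>\<^sub>o Id"

definition pencil_resolvent_set :: "(complex \<Rightarrow> ('a::complex_inner, 'a) graph) \<Rightarrow> complex set"
  where "pencil_resolvent_set M = {z. 0 \<in> resolvent_set (M z)}"

definition pencil_spectrum :: "(complex \<Rightarrow> ('a::complex_inner, 'a) graph) \<Rightarrow> complex set"
  where "pencil_spectrum M = {z. 0 \<in> spectrum (M z)}"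

lemma Domain_Q_op:
  assumes "Domain (abs_op A) \<subseteq> Domain R"
  shows "Domain (Q_op A R) = Domain (abs_op A) \<times> Domain (abs_op A)"
proof (intro equalityI subsetI)
  fix x assume "x \<in> Domain (Q_op A R)"
  then show "x \<in> Domain (abs_op A) \<times> Domain (abs_op A)"
    unfolding Q_op_def block_op_def by blast
next
  fix x assume "x \<in> Domain (abs_op A) \<times> Domain (abs_op A)"
  then obtain x1 x2 a b where x: "x = (x1, x2)" "(x1, a) \<in> abs_op A" "(x2, b) \<in> abs_op A"
    by blast
  moreover obtain r where "(x1, r) \<in> R"
    using assms x by blast
  ultimately have "(x, (- \<i>) *\<^sub>C r + b, a + 0) \<in> Q_op A R"
    unfolding Q_op_def block_op_def scale_op_def zero_op_def by blast
  then show "x \<in> Domain (Q_op A R)"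
    by blast
qed

lemma Domain_pencil:
  assumes "Domain (abs_op A) \<subseteq> Domain R"
  shows "Domain (pencil A R z) = Domain (abs_op A \<circ>\<^sub>o abs_op A)"
  using assms unfolding pencil_def diff_op_def scale_op_def comp_op_def
  by (fastforce simp: Domain_iff)


section \<open>Contraction semigroups\<close>

definition contraction_semigroup :: "(real \<Rightarrow> 'a::complex_inner \<Rightarrow> 'a) \<Rightarrow> bool"
  where "contraction_semigroup S \<longleftrightarrow>
    (\<forall>t\<ge>0. (\<forall>x y. S t (x + y) = S t x + S t y) \<and> (\<forall>c x. S t (c *\<^sub>C x) = c *\<^sub>C S t x) \<and>
      (\<forall>x. norm (S t x) \<le> norm x)) \<and>
    (\<forall>x. S 0 x = x) \<and>
    (\<forall>s\<ge>0. \<forall>t\<ge>0. \<forall>x. S (s + t) x = S s (S t x)) \<and>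
    (\<forall>x. continuous_on {0..} (\<lambda>t. S t x))"

definition generator :: "(real \<Rightarrow> 'a::complex_inner \<Rightarrow> 'a) \<Rightarrow> ('a, 'a) graph"
  where "generator S = {(x, y). ((\<lambda>t. (S t x - x) /\<^sub>R t) \<longlongrightarrow> y) (at_right 0)}"

text \<open>A contraction semigroup is determined by its generator \<open>G\<close>; it is the one written \<open>exp (G t)\<close>.\<close>

definition generates_contraction_semigroup :: "('a::complex_inner, 'a) graph \<Rightarrow> bool"
  where "generates_contraction_semigroup G \<longleftrightarrow> (\<exists>S. contraction_semigroup S \<and> generator S = G)"

end

theory Submission
  imports Defs
begin

text \<open>
  Write \<open>B = |A|\<close>. For \<open>z \<noteq> 0\<close>, eliminating \<open>g = (B f - k) / z\<close> from \<open>(Q - z) (f, g) = (h, k)\<close> gives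
  formally \<open>M(z) f = z h + B k\<close>, so that the resolvent of \<open>Q\<close> and \<open>M(z)\<^sup>-\<^sup>1\<close> determine each other. The point
  is to make sense of this for \<open>k\<close> outside the domain of \<open>B\<close>: the form of the shifted pencil
  \<open>M(z) + t\<close> is coercive for large \<open>t\<close>, because \<open>R\<close> is bounded relative to \<open>B\<close>, and the shift is removed
  by applying \<open>M(z)\<^sup>-\<^sup>1\<close> to an element of the space. Since \<open>inf \<sigma>(A\<^sup>*A) = 0\<close>, the operator \<open>M(0) = A\<^sup>*A\<close> has
  no bounded inverse. If \<open>R\<close> is accretive, the form of \<open>M(i \<lambda>)\<close> is coercive without a shift, hence
  \<open>- i Q\<close> is maximal dissipative and the Lumer-Phillips theorem applies.
\<close>

section \<open>Closed subspaces and square roots in real Hilbert spaces\<close>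

text \<open>The absolute value is given by a choice among square roots, so a root has to be
  constructed before anything can be said about it; the bounded operator
  \<open>(1 + adj A A)^-1\<close> is the starting point. The hypotheses on \<open>R\<close> speak of
  the domain of \<open>A\<close>, the block operator of that of \<open>|A|\<close>, so the two
  domains have to be identified. The inclusion into the domain of \<open>adj R\<close> is what makes
  \<open>R\<close> relatively bounded: \<open>adj R\<close> is then densely defined, and
  \<open>R (1 + |A|)^-1\<close> is weakly continuous against a dense set. Most estimates use the
  real inner product, because norms and sign conditions see only the real part. The shift is forced
  because bounded invertibility of \<open>M(z)\<close> gives no lower bound for its form, so by
  itself it says nothing about right-hand sides \<open>B k\<close> outside the space; the solution
  \<open>f0\<close> of the shifted problem lies in the space, and so does the error
  \<open>t f0\<close> that it leaves.\<close>

lemma orthogonal_decomposition: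
  fixes V :: "'a::{real_inner,banach} set"
  assumes "closed V" and "subspace V"
  obtains p where "p \<in> V" and "\<And>v. v \<in> V \<Longrightarrow> (x - p) \<bullet> v = 0"
proof -
  define d where "d = (INF v\<in>V. (norm (x - v))\<^sup>2)"
  have V0: "0 \<in> V"
    using \<open>subspace V\<close> by (rule subspace_0)
  have bdd: "bdd_below ((\<lambda>v. (norm (x - v))\<^sup>2) ` V)"
    by (rule bdd_belowI2[of _ 0]) simp
  have d_le: "d \<le> (norm (x - v))\<^sup>2" if "v \<in> V" for v
    unfolding d_def using bdd that by (rule cINF_lower)
  have "\<exists>v\<in>V. (norm (x - v))\<^sup>2 < d + inverse (real (Suc n))" for n
  proof -
    have "Inf ((\<lambda>v. (norm (x - v))\<^sup>2) ` V) < d + inverse (real (Suc n))"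
      by (simp add: d_def)
    then show ?thesis
      using cInf_less_iff[OF _ bdd] V0 by auto
  qed
  then obtain v where vV: "\<And>n. v n \<in> V"
    and v_less: "\<And>n. (norm (x - v n))\<^sup>2 < d + inverse (real (Suc n))"
    by metis
  \<comment> \<open>The midpoint of two near-minimisers lies in \<open>V\<close>, so the
    parallelogram law bounds their distance by the excess over \<open>d\<close>.\<close>
  have para: "(norm (v m - v n))\<^sup>2 \<le> 2 * inverse (real (Suc m)) + 2 * inverse (real (Suc n))" for m n
  proof -
    have "(1/2) *\<^sub>R (v m + v n) \<in> V"
      using \<open>subspace V\<close> vV by (simp add: subspace_add subspace_scale)
    from d_le[OF this] have "4 * d \<le> (norm (2 *\<^sub>R (x - (1/2) *\<^sub>R (v m + v n))))\<^sup>2"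
      by (simp add: power_mult_distrib)
    also have "2 *\<^sub>R (x - (1/2) *\<^sub>R (v m + v n)) = (x - v m) + (x - v n)"
      by (simp add: algebra_simps scaleR_2)
    finally have "4 * d \<le> (norm ((x - v m) + (x - v n)))\<^sup>2" .
    moreover have "(norm ((x - v m) + (x - v n)))\<^sup>2 + (norm (v m - v n))\<^sup>2
        = 2 * (norm (x - v m))\<^sup>2 + 2 * (norm (x - v n))\<^sup>2"
      by (simp add: power2_norm_eq_inner inner_commute algebra_simps)
    ultimately show ?thesis
      using v_less[of m] v_less[of n] by linarith
  qed
  have "Cauchy v"
  proof (rule metric_CauchyI)
    fix e :: real assume "0 < e"
    then obtain N where N: "inverse (real (Suc N)) < e\<^sup>2 / 4"
      using reals_Archimedean[of "e\<^sup>2 / 4"] by auto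
    have "dist (v m) (v n) < e" if "N \<le> m" "N \<le> n" for m n
    proof -
      have "inverse (real (Suc m)) \<le> inverse (real (Suc N))" "inverse (real (Suc n)) \<le> inverse (real (Suc N))"
        using that by (simp_all add: field_simps)
      then have "(norm (v m - v n))\<^sup>2 < e\<^sup>2"
        using para[of m n] N by linarith
      then show ?thesis
        using \<open>0 < e\<close> by (simp add: dist_norm power_less_imp_less_base)
    qed
    then show "\<exists>M. \<forall>m\<ge>M. \<forall>n\<ge>M. dist (v m) (v n) < e"
      by blast
  qed
  then obtain p where p: "v \<longlonglongrightarrow> p"
    using Cauchy_convergent convergent_def by blast
  have "p \<in> V"
    using \<open>closed V\<close> vV p by (meson closed_sequentially)
  have "(norm (x - p))\<^sup>2 \<le> d"
  proof (rule LIMSEQ_le)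
    show "(\<lambda>n. (norm (x - v n))\<^sup>2) \<longlonglongrightarrow> (norm (x - p))\<^sup>2"
      by (intro tendsto_intros p)
    show "(\<lambda>n. d + inverse (real (Suc n))) \<longlonglongrightarrow> d"
      using LIMSEQ_inverse_real_of_nat_add by simp
    show "\<exists>N. \<forall>n\<ge>N. (norm (x - v n))\<^sup>2 \<le> d + inverse (real (Suc n))"
      using v_less less_imp_le by blast
  qed
  have "(x - p) \<bullet> w = 0" if "w \<in> V" for w
  proof (cases "w = 0")
    case False
    \<comment> \<open>This \<open>t\<close> minimises the squared norm of
      \<open>x - p - t w\<close>; a nonzero inner product would push it below
      \<open>d\<close>.\<close>
    define t where "t = ((x - p) \<bullet> w) / (w \<bullet> w)"
    have "p + t *\<^sub>R w \<in> V"
      using \<open>subspace V\<close> \<open>p \<in> V\<close> that by (simp add: subspace_add subspace_scale)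
    from d_le[OF this] have "(norm (x - p))\<^sup>2 \<le> (norm (x - p - t *\<^sub>R w))\<^sup>2"
      using \<open>(norm (x - p))\<^sup>2 \<le> d\<close> by (simp only: diff_diff_eq)
    also have "\<dots> = (norm (x - p))\<^sup>2 - 2 * t * ((x - p) \<bullet> w) + t\<^sup>2 * (w \<bullet> w)"
      unfolding power2_norm_eq_inner
      by (simp add: inner_diff_left inner_diff_right inner_commute power2_eq_square algebra_simps)
    also have "\<dots> = (norm (x - p))\<^sup>2 - ((x - p) \<bullet> w)\<^sup>2 / (w \<bullet> w)"
      using False by (simp add: t_def power2_eq_square field_simps)
    finally have "((x - p) \<bullet> w)\<^sup>2 / (w \<bullet> w) \<le> 0"
      by simp
    moreover have "0 < w \<bullet> w"
      using False by simp
    ultimately show ?thesis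
      by (simp add: divide_le_0_iff)
  qed simp
  with \<open>p \<in> V\<close> show thesis
    by (rule that)
qed

text \<open>Projecting a point of \<open>W\<close> onto \<open>V\<close> leaves a remainder in
  \<open>W\<close> orthogonal to \<open>V\<close>, hence zero. Density, surjectivity and the core
  property of graphs below are instances.\<close>

lemma closed_subspace_eqI:
  fixes V W :: "'a::{real_inner,banach} set"
  assumes "closed V" "subspace V" "subspace W" "V \<subseteq> W"
    and orth: "\<And>y. y \<in> W \<Longrightarrow> (\<And>v. v \<in> V \<Longrightarrow> y \<bullet> v = 0) \<Longrightarrow> y = 0"
  shows "V = W"
proof
  show "W \<subseteq> V"
  proof
    fix x assume "x \<in> W"
    obtain p where p: "p \<in> V" "\<And>v. v \<in> V \<Longrightarrow> (x - p) \<bullet> v = 0"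
      using orthogonal_decomposition[OF assms(1,2)] by metis
    then have "x - p = 0"
      using orth \<open>x \<in> W\<close> assms(3,4) by (meson subsetD subspace_diff)
    with p show "x \<in> V"
      by simp
  qed
qed fact

lemma subspace_closure:
  fixes V :: "'a::real_normed_vector set"
  assumes "subspace V"
  shows "subspace (closure V)"
proof (rule subspaceI)
  show "0 \<in> closure V"
    using assms closure_subset subspace_0 by blast
next
  fix x y assume "x \<in> closure V" "y \<in> closure V"
  then obtain f g where "\<And>n::nat. f n \<in> V" "f \<longlonglongrightarrow> x" "\<And>n::nat. g n \<in> V" "g \<longlonglongrightarrow> y"
    unfolding closure_sequential by metis
  then have "(\<lambda>n. f n + g n) \<longlonglongrightarrow> x + y" "\<And>n. f n + g n \<in> V"
    by (auto intro: tendsto_add subspace_add[OF assms])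
  then show "x + y \<in> closure V"
    unfolding closure_sequential by metis
next
  fix c x assume "x \<in> closure V"
  then obtain f where "\<And>n::nat. f n \<in> V" "f \<longlonglongrightarrow> x"
    unfolding closure_sequential by metis
  then have "(\<lambda>n. c *\<^sub>R f n) \<longlonglongrightarrow> c *\<^sub>R x" "\<And>n. c *\<^sub>R f n \<in> V"
    by (auto intro: tendsto_intros subspace_scale[OF assms])
  then show "c *\<^sub>R x \<in> closure V"
    unfolding closure_sequential by metis
qed

lemma dense_subspaceI:
  fixes V :: "'a::{real_inner,banach} set"
  assumes "subspace V" and "\<And>y. (\<And>v. v \<in> V \<Longrightarrow> y \<bullet> v = 0) \<Longrightarrow> y = 0"
  shows "closure V = UNIV"
proof (rule closed_subspace_eqI)
  show "subspace (closure V)"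
    by (rule subspace_closure) fact
  fix y assume "\<And>v. v \<in> closure V \<Longrightarrow> y \<bullet> v = 0"
  then show "y = 0"
    using assms(2) closure_subset by blast
qed auto

lemma orthogonal_dense_eq_0:
  fixes V :: "'a::real_inner set"
  assumes "closure V = UNIV" and "\<And>v. v \<in> V \<Longrightarrow> y \<bullet> v = 0"
  shows "y = 0"
proof -
  obtain f where f: "\<And>n::nat. f n \<in> V" "f \<longlonglongrightarrow> y"
    using assms(1) unfolding closure_sequential by (metis UNIV_I closure_sequential)
  have "(\<lambda>n. y \<bullet> f n) \<longlonglongrightarrow> y \<bullet> y"
    by (intro tendsto_intros f)
  moreover have "(\<lambda>n. y \<bullet> f n) = (\<lambda>n. 0)"
    using f assms(2) by simp
  ultimately show ?thesis
    by (simp add: LIMSEQ_const_iff)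
qed

text \<open>The lower bound turns convergent images into Cauchy arguments, and the closed graph
  identifies the limit, so the range is closed. A closed range with trivial orthogonal complement is
  everything.\<close>

lemma closed_operator_onto:
  fixes N :: "'c::{real_inner,banach} \<Rightarrow> 'd::{real_inner,banach}"
  assumes D: "subspace D"
    and add: "\<And>x y. x \<in> D \<Longrightarrow> y \<in> D \<Longrightarrow> N (x + y) = N x + N y"
    and scale: "\<And>c x. x \<in> D \<Longrightarrow> N (c *\<^sub>R x) = c *\<^sub>R N x"
    and closed: "closed ((\<lambda>x. (x, N x)) ` D)"
    and bound: "\<And>x. x \<in> D \<Longrightarrow> norm x \<le> C * norm (N x)"
    and orth: "\<And>y. (\<And>x. x \<in> D \<Longrightarrow> y \<bullet> N x = 0) \<Longrightarrow> y = 0"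
  shows "N ` D = UNIV"
proof (rule closed_subspace_eqI)
  have diff: "N (x - y) = N x - N y" if "x \<in> D" "y \<in> D" for x y
    using add[of x "(-1) *\<^sub>R y"] scale[of y "-1"] that subspace_scale[OF D, of y "-1"] by simp
  show "subspace (N ` D)"
    unfolding subspace_def using D add scale
    by (auto simp: image_iff subspace_def) (metis scaleR_zero_left)+
  show "closed (N ` D)"
    unfolding closed_sequential_limits
  proof (intro allI impI)
    fix f l assume "(\<forall>n. f n \<in> N ` D) \<and> f \<longlonglongrightarrow> l"
    then have "\<forall>n. \<exists>x. x \<in> D \<and> f n = N x" and fl: "f \<longlonglongrightarrow> l"
      by auto
    then obtain x where x: "\<And>n. x n \<in> D" "\<And>n. f n = N (x n)"
      by metis
    have "Cauchy f"
      using fl LIMSEQ_imp_Cauchy by blast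
    have bd: "norm (x m - x n) \<le> (\<bar>C\<bar> + 1) * norm (f m - f n)" for m n
    proof -
      have "norm (x m - x n) \<le> C * norm (N (x m - x n))"
        using bound x subspace_diff[OF D] by blast
      also have "\<dots> = C * norm (f m - f n)"
        using x diff by simp
      also have "\<dots> \<le> (\<bar>C\<bar> + 1) * norm (f m - f n)"
        by (intro mult_right_mono) auto
      finally show ?thesis .
    qed
    have "Cauchy x"
    proof (rule metric_CauchyI)
      fix e :: real assume "0 < e"
      then obtain M where "\<forall>m\<ge>M. \<forall>n\<ge>M. dist (f m) (f n) < e / (\<bar>C\<bar> + 1)"
        using \<open>Cauchy f\<close> metric_CauchyD[of f "e / (\<bar>C\<bar> + 1)"] by (auto simp: add_nonneg_pos)
      then have "dist (x m) (x n) < e" if "M \<le> m" "M \<le> n" for m n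
      proof -
        have "norm (f m - f n) < e / (\<bar>C\<bar> + 1)"
          using \<open>\<forall>m\<ge>M. _\<close> that by (simp add: dist_norm)
        then have "(\<bar>C\<bar> + 1) * norm (f m - f n) < e"
          by (simp add: field_simps add_nonneg_pos)
        then show ?thesis
          using bd[of m n] by (simp add: dist_norm)
      qed
      then show "\<exists>M. \<forall>m\<ge>M. \<forall>n\<ge>M. dist (x m) (x n) < e"
        by blast
    qed
    then obtain p where "x \<longlonglongrightarrow> p"
      using Cauchy_convergent convergent_def by blast
    then have "(\<lambda>n. (x n, N (x n))) \<longlonglongrightarrow> (p, l)"
      using fl unfolding x(2)[symmetric] by (rule tendsto_Pair)
    moreover have "(x n, N (x n)) \<in> (\<lambda>x. (x, N x)) ` D" for n
      using x by blast
    ultimately have "(p, l) \<in> (\<lambda>x. (x, N x)) ` D"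
      using closed closed_sequentially by (metis (no_types, lifting))
    then show "l \<in> N ` D"
      by auto
  qed
  show "y = 0" if "\<And>v. v \<in> N ` D \<Longrightarrow> y \<bullet> v = 0" for y
    using that orth by blast
qed auto

text \<open>
  The iteration \<open>Y\<^sub>n\<^sub>+\<^sub>1 = (K + Y\<^sub>n\<^sup>2) / 2\<close> is dominated termwise, together with its increments, by
  the scalar iteration for \<open>K = 1\<close>, which increases to 1.
\<close>

lemma sqrt_contraction:
  fixes K :: "'a::{real_inner,banach} \<Rightarrow>\<^sub>L 'a"
  assumes K: "norm K \<le> 1" and sym: "\<And>x y. K x \<bullet> y = x \<bullet> K y"
  obtains Y :: "'a \<Rightarrow>\<^sub>L 'a" where "norm Y \<le> 1" and "\<And>x y. Y x \<bullet> y = x \<bullet> Y y"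
    and "\<And>x. Y (Y x) = 2 *\<^sub>R Y x - K x"
    and "\<And>Z. Z o\<^sub>L K = K o\<^sub>L Z \<Longrightarrow> Z o\<^sub>L Y = Y o\<^sub>L Z"
proof -
  \<comment> \<open>A fixed point \<open>Y = (K + Y^2) / 2\<close> satisfies
    \<open>(1 - Y)^2 = 1 - K\<close>, so the lemma delivers the square root \<open>1 - Y\<close> of
    \<open>1 - K\<close>.\<close>
  define F where "F = rec_nat 0 (\<lambda>_ Y. (1/2) *\<^sub>R (K + (Y o\<^sub>L Y)))"
  have F0: "F 0 = 0" and FS: "F (Suc n) = (1/2) *\<^sub>R (K + (F n o\<^sub>L F n))" for n
    by (simp_all add: F_def)
  define c :: "nat \<Rightarrow> real" where "c = rec_nat 0 (\<lambda>_ y. (1 + y\<^sup>2) / 2)"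
  have c0: "c 0 = 0" and cS: "c (Suc n) = (1 + (c n)\<^sup>2) / 2" for n
    by (simp_all add: c_def)
  interpret comp: bounded_bilinear "(o\<^sub>L) :: ('a \<Rightarrow>\<^sub>L 'a) \<Rightarrow> ('a \<Rightarrow>\<^sub>L 'a) \<Rightarrow> ('a \<Rightarrow>\<^sub>L 'a)"
    by (rule bounded_bilinear_blinfun_compose)
  \<comment> \<open>Each iterate is a polynomial in \<open>K\<close> and inherits every commutation
    relation of \<open>K\<close>; so does the limit.\<close>
  have comm: "Z o\<^sub>L F n = F n o\<^sub>L Z" if "Z o\<^sub>L K = K o\<^sub>L Z" for Z n
  proof (induction n)
    case (Suc n)
    have "Z o\<^sub>L (F n o\<^sub>L F n) = (F n o\<^sub>L F n) o\<^sub>L Z"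
      using arg_cong[OF Suc, of blinfun_apply] unfolding fun_eq_iff by (intro blinfun_eqI) simp
    then show ?case
      using that by (simp add: FS comp.scaleR_left comp.scaleR_right comp.add_left comp.add_right)
  qed (simp add: F0)
  have symF: "F n x \<bullet> y = x \<bullet> F n y" for n x y
    by (induction n arbitrary: x y)
      (simp_all add: F0 FS blinfun.add_left blinfun.scaleR_left inner_add_left inner_add_right sym)
  have c01: "0 \<le> c n \<and> c n \<le> 1" for n
  proof (induction n)
    case (Suc n)
    then have "(c n)\<^sup>2 \<le> 1"
      by (simp add: power_le_one)
    then show ?case
      by (simp add: cS)
  qed (simp add: c0)
  have normF: "norm (F n) \<le> c n" for n
  proof (induction n)
    case (Suc n)
    have "norm (F n o\<^sub>L F n) \<le> norm (F n) * norm (F n)"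
      by (rule norm_blinfun_compose)
    also have "\<dots> \<le> (c n)\<^sup>2"
      unfolding power2_eq_square using Suc c01[of n] by (intro mult_mono) auto
    finally have "norm (K + (F n o\<^sub>L F n)) \<le> 1 + (c n)\<^sup>2"
      using K norm_triangle_ineq[of K "F n o\<^sub>L F n"] by linarith
    then show ?case
      by (simp add: FS cS)
  qed (simp add: F0 c0)
  have FF: "F m o\<^sub>L F n = F n o\<^sub>L F m" for m n
  proof -
    have "F n o\<^sub>L K = K o\<^sub>L F n"
      using comm[of K n] by simp
    then show ?thesis
      using comm[of "F n" m] by simp
  qed
  have stepF: "norm (F (Suc n) - F n) \<le> c (Suc n) - c n" for n
  proof (induction n)
    case 0
    have "norm (F 1) \<le> c 1"
      by (rule normF)
    then show ?case
      by (simp add: F0 c0)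
  next
    case (Suc n)
    \<comment> \<open>Iterates commute, so the difference of their squares factors as for scalars,
      which makes the increments comparable with those of \<open>c\<close>.\<close>
    have "F (Suc (Suc n)) - F (Suc n) = (1/2) *\<^sub>R ((F (Suc n) + F n) o\<^sub>L (F (Suc n) - F n))"
    proof -
      have "(F (Suc n) + F n) o\<^sub>L (F (Suc n) - F n) = (F (Suc n) o\<^sub>L F (Suc n)) - (F n o\<^sub>L F n)"
        by (simp add: comp.add_left comp.diff_right FF[of n "Suc n"])
      moreover have "(1/2) *\<^sub>R (K + P) - (1/2) *\<^sub>R (K + Q) = (1/2) *\<^sub>R (P - Q)" for P Q
        by (simp add: algebra_simps)
      ultimately show ?thesis
        by (metis FS)
    qed
    moreover have "norm ((F (Suc n) + F n) o\<^sub>L (F (Suc n) - F n)) \<le> (c (Suc n) + c n) * (c (Suc n) - c n)"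
    proof -
      have "norm (F (Suc n) + F n) \<le> c (Suc n) + c n"
        using normF[of n] normF[of "Suc n"] norm_triangle_ineq[of "F (Suc n)" "F n"] by linarith
      then have "norm (F (Suc n) + F n) * norm (F (Suc n) - F n) \<le> (c (Suc n) + c n) * (c (Suc n) - c n)"
        using Suc c01[of n] c01[of "Suc n"] by (intro mult_mono) auto
      with norm_blinfun_compose show ?thesis
        using order_trans by blast
    qed
    moreover have "c (Suc (Suc n)) - c (Suc n) = (c (Suc n) + c n) * (c (Suc n) - c n) / 2"
      unfolding cS[of "Suc n"] cS[of n]
      by (simp add: power2_eq_square algebra_simps flip: cS) (simp add: cS power2_eq_square field_simps)
    ultimately show ?case
      by simp
  qed
  have "incseq c"
    using stepF by (intro incseq_SucI) (meson diff_ge_0_iff_ge norm_ge_zero order_trans)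
  have diffF: "norm (F (n + k) - F n) \<le> c (n + k) - c n" for n k
  proof (induction k)
    case (Suc k)
    then show ?case
      using stepF[of "n + k"] norm_triangle_ineq[of "F (Suc (n + k)) - F (n + k)" "F (n + k) - F n"]
      by simp
  qed simp
  have "convergent c"
    using \<open>incseq c\<close> c01 by (intro Bseq_mono_convergent BseqI'[of _ 1]) (auto simp: incseq_def)
  then have "Cauchy c"
    by (rule convergent_Cauchy)
  have "Cauchy F"
  proof (rule metric_CauchyI)
    fix e :: real assume "0 < e"
    then obtain M where M: "\<forall>m\<ge>M. \<forall>n\<ge>M. dist (c m) (c n) < e"
      using \<open>Cauchy c\<close> metric_CauchyD by blast
    have *: "dist (F m) (F n) < e" if "M \<le> n" "n \<le> m" for m n
    proof -
      have "norm (F m - F n) \<le> c m - c n"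
        using diffF[of n "m - n"] that by simp
      also have "\<dots> < e"
        using M that by (simp add: dist_real_def) (meson abs_less_iff le_trans)
      finally show ?thesis
        by (simp add: dist_norm)
    qed
    then have "dist (F m) (F n) < e" if "M \<le> n" "M \<le> m" for m n
      using that by (metis dist_commute linear)
    then show "\<exists>M. \<forall>m\<ge>M. \<forall>n\<ge>M. dist (F m) (F n) < e"
      by blast
  qed
  then obtain Y where Y: "F \<longlonglongrightarrow> Y"
    using Cauchy_convergent convergent_def by blast
  have appl: "(\<lambda>n. F n x) \<longlonglongrightarrow> Y x" for x
    by (intro tendsto_intros Y)
  show thesis
  proof
    show "norm Y \<le> 1"
      using tendsto_norm[OF Y] normF c01 order_trans by (intro Lim_bounded) blast+
    show "Y x \<bullet> y = x \<bullet> Y y" for x y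
    proof (rule LIMSEQ_unique)
      show "(\<lambda>n. F n x \<bullet> y) \<longlonglongrightarrow> Y x \<bullet> y"
        by (intro tendsto_intros appl)
      show "(\<lambda>n. F n x \<bullet> y) \<longlonglongrightarrow> x \<bullet> Y y"
        unfolding symF by (intro tendsto_intros appl)
    qed
    have "(\<lambda>n. F (Suc n)) \<longlonglongrightarrow> (1/2) *\<^sub>R (K + (Y o\<^sub>L Y))"
      unfolding FS by (intro tendsto_intros comp.tendsto Y)
    then have "Y = (1/2) *\<^sub>R (K + (Y o\<^sub>L Y))"
      using LIMSEQ_unique LIMSEQ_Suc[OF Y] by blast
    then have "2 *\<^sub>R Y = K + (Y o\<^sub>L Y)"
      by (metis divide_self_if mult_2_right numeral_One one_add_one scaleR_half_double scaleR_one scaleR_scaleR scaleR_2 times_divide_eq_right zero_neq_numeral mult.right_neutral)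
    then have "2 *\<^sub>R Y x = K x + Y (Y x)" for x
      by (metis blinfun.add_left blinfun.scaleR_left blinfun_apply_blinfun_compose)
    then show "Y (Y x) = 2 *\<^sub>R Y x - K x" for x
      by simp
    show "Z o\<^sub>L Y = Y o\<^sub>L Z" if "Z o\<^sub>L K = K o\<^sub>L Z" for Z
    proof (rule LIMSEQ_unique)
      show "(\<lambda>n. Z o\<^sub>L F n) \<longlonglongrightarrow> (Z o\<^sub>L Y)"
        by (intro comp.tendsto Y tendsto_const)
      show "(\<lambda>n. Z o\<^sub>L F n) \<longlonglongrightarrow> (Y o\<^sub>L Z)"
        unfolding comm[OF that] by (intro comp.tendsto Y tendsto_const)
    qed
  qed
qed


section \<open>The absolute value of a closed operator\<close>

lemma scaleC_one [simp]: "1 *\<^sub>C (x::'a::complex_inner) = x"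
  using scaleR_scaleC[of 1 x] by simp

lemma scaleC_zero_left [simp]: "0 *\<^sub>C (x::'a::complex_inner) = 0"
  using scaleR_scaleC[of 0 x] by simp

lemma scaleC_zero_right [simp]: "a *\<^sub>C (0::'a::complex_inner) = 0"
  using scaleC_add_right[of a "0::'a" 0] by simp

lemma scaleC_minus_left [simp]: "(- a) *\<^sub>C (x::'a::complex_inner) = - (a *\<^sub>C x)"
  using scaleC_add_left[of a "- a" x] by (simp add: add_eq_0_iff)

lemma scaleC_minus_right [simp]: "a *\<^sub>C (- x::'a::complex_inner) = - (a *\<^sub>C x)"
  using scaleC_add_right[of a x "- x"] by (simp add: add_eq_0_iff)

lemma scaleC_diff_right: "a *\<^sub>C (x - y::'a::complex_inner) = a *\<^sub>C x - a *\<^sub>C y"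
  using scaleC_add_right[of a x "- y"] by simp

lemma scaleC_scaleR_commute: "a *\<^sub>C r *\<^sub>R (x::'a::complex_inner) = r *\<^sub>R a *\<^sub>C x"
  by (simp add: scaleR_scaleC scaleC_scaleC mult.commute)

lemma cinner_add_left: "cinner (x + y) (z::'a::complex_inner) = cinner x z + cinner y z"
  by (metis cinner_add_right cinner_commute complex_cnj_add)

lemma cinner_scaleC_left: "cinner (a *\<^sub>C x) (y::'a::complex_inner) = cnj a * cinner x y"
  by (metis cinner_commute cinner_scaleC_right complex_cnj_mult)

lemma cinner_zero_left [simp]: "cinner 0 (y::'a::complex_inner) = 0"
  using cinner_scaleC_left[of 0 0 y] by simp

lemma inner_scaleC_left: "(a *\<^sub>C x) \<bullet> (y::'a::complex_inner) = x \<bullet> (cnj a *\<^sub>C y)"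
  by (simp add: inner_eq_Re_cinner cinner_scaleC_left cinner_scaleC_right)

lemma cinner_eq_inner: "cinner x (y::'a::complex_inner) = Complex (x \<bullet> y) (x \<bullet> ((- \<i>) *\<^sub>C y))"
  by (simp add: inner_eq_Re_cinner cinner_scaleC_right complex_eq_iff del: scaleC_minus_left)

lemma norm_scaleC: "norm (a *\<^sub>C x) = cmod a * norm (x::'a::complex_inner)"
proof (rule power2_eq_imp_eq)
  have "(norm (a *\<^sub>C x))\<^sup>2 = Re (cnj a * a * cinner x x)"
    unfolding power2_norm_eq_inner inner_eq_Re_cinner cinner_scaleC_left cinner_scaleC_right
    by (simp only: mult.left_commute mult.assoc)
  also have "cnj a * a = complex_of_real ((cmod a)\<^sup>2)"
    by (simp only: complex_norm_square mult.commute)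
  also have "Re (complex_of_real ((cmod a)\<^sup>2) * cinner x x) = (cmod a * norm x)\<^sup>2"
    by (simp add: power_mult_distrib power2_norm_eq_inner inner_eq_Re_cinner)
  finally show "(norm (a *\<^sub>C x))\<^sup>2 = (cmod a * norm x)\<^sup>2" .
qed auto

lemma bounded_linear_scaleC: "bounded_linear (\<lambda>x::'a::complex_inner. a *\<^sub>C x)"
  by (rule bounded_linear_intro[of _ "cmod a"])
    (simp_all add: scaleC_add_right scaleC_scaleR_commute norm_scaleC mult.commute)

section \<open>Operators as graphs and their adjoints\<close>

lemma linear_operator_add:
  "linear_operator T \<Longrightarrow> (x, y) \<in> T \<Longrightarrow> (x', y') \<in> T \<Longrightarrow> (x + x', y + y') \<in> T"
  unfolding linear_operator_def by (metis add_Pair)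

lemma linear_operator_scaleC:
  "linear_operator T \<Longrightarrow> (x, y) \<in> T \<Longrightarrow> (a *\<^sub>C x, a *\<^sub>C y) \<in> T"
  unfolding linear_operator_def scaleC_prod_def by (metis fst_conv snd_conv)

lemma linear_operator_zero: "linear_operator T \<Longrightarrow> (0, 0) \<in> T"
  unfolding linear_operator_def by (simp add: zero_prod_def)

lemma linear_operator_unique: "linear_operator T \<Longrightarrow> (x, y) \<in> T \<Longrightarrow> (x, y') \<in> T \<Longrightarrow> y = y'"
  unfolding linear_operator_def by (metis single_valuedD)

lemma linear_operator_diff:
  "linear_operator T \<Longrightarrow> (x, y) \<in> T \<Longrightarrow> (x', y') \<in> T \<Longrightarrow> (x - x', y - y') \<in> T"
  using linear_operator_add[of T x y "- x'" "- y'"] linear_operator_scaleC[of T x' y' "- 1"] by simp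

lemma linear_operator_subspace: "linear_operator T \<Longrightarrow> subspace T"
  unfolding subspace_def linear_operator_def scaleR_scaleC by blast

lemma linear_operatorI:
  assumes "(0, 0) \<in> T"
    and "\<And>x y x' y'. (x, y) \<in> T \<Longrightarrow> (x', y') \<in> T \<Longrightarrow> (x + x', y + y') \<in> T"
    and "\<And>a x y. (x, y) \<in> T \<Longrightarrow> (a *\<^sub>C x, a *\<^sub>C y) \<in> T"
    and "\<And>x y y'. (x, y) \<in> T \<Longrightarrow> (x, y') \<in> T \<Longrightarrow> y = y'"
  shows "linear_operator T"
  unfolding linear_operator_def using assms
  by (auto simp: zero_prod_def scaleC_prod_def intro: single_valuedI)

lemma adj_iff: "(y, z) \<in> adj T \<longleftrightarrow> (\<forall>x w. (x, w) \<in> T \<longrightarrow> cinner y w = cinner z x)"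
  unfolding adj_def by blast

lemma inner_adj:
  "(x, w) \<in> T \<Longrightarrow> (y, z) \<in> adj T \<Longrightarrow> y \<bullet> w = z \<bullet> x"
  unfolding adj_iff inner_eq_Re_cinner by simp

text \<open>A linear \<open>T\<close> contains \<open>- \<i>\<close> times each of its pairs, which
  supplies the imaginary part of the adjoint relation from the real one.\<close>

lemma adj_iff_inner:
  assumes "linear_operator T"
  shows "(y, z) \<in> adj T \<longleftrightarrow> (\<forall>x w. (x, w) \<in> T \<longrightarrow> y \<bullet> w = z \<bullet> x)"
proof (intro iffI allI impI)
  fix x w assume "(y, z) \<in> adj T" "(x, w) \<in> T"
  then show "y \<bullet> w = z \<bullet> x"
    using inner_adj by blast
next
  assume R: "\<forall>x w. (x, w) \<in> T \<longrightarrow> y \<bullet> w = z \<bullet> x"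
  have "cinner y w = cinner z x" if "(x, w) \<in> T" for x w
  proof -
    have "y \<bullet> w = z \<bullet> x" "y \<bullet> ((- \<i>) *\<^sub>C w) = z \<bullet> ((- \<i>) *\<^sub>C x)"
      using R that linear_operator_scaleC[OF assms that, of "- \<i>"] by blast+
    then show ?thesis
      by (simp only: cinner_eq_inner)
  qed
  then show "(y, z) \<in> adj T"
    unfolding adj_iff by blast
qed

lemma linear_operator_adj:
  assumes "densely_defined T"
  shows "linear_operator (adj T)"
proof (rule linear_operatorI)
  fix y z z' assume "(y, z) \<in> adj T" "(y, z') \<in> adj T"
  then have "z \<bullet> x = z' \<bullet> x" if "x \<in> Domain T" for x
    using that unfolding adj_iff inner_eq_Re_cinner by (metis DomainE)
  then have "(z - z') \<bullet> x = 0" if "x \<in> Domain T" for x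
    using that by (simp add: inner_diff_left)
  then have "z - z' = 0"
    using assms unfolding densely_defined_def by (rule orthogonal_dense_eq_0[rotated])
  then show "z = z'"
    by simp
next
  show "(0, 0) \<in> adj T"
    by (simp add: adj_iff)
  show "(y + y', z + z') \<in> adj T" if "(y, z) \<in> adj T" "(y', z') \<in> adj T" for y z y' z'
    using that unfolding adj_iff cinner_add_left by metis
  show "(a *\<^sub>C y, a *\<^sub>C z) \<in> adj T" if "(y, z) \<in> adj T" for a y z
    using that unfolding adj_iff cinner_scaleC_left by metis
qed

lemma closed_adj:
  assumes "linear_operator T"
  shows "closed (adj T)"
proof -
  have "adj T = (\<Inter>p\<in>T. {q. fst q \<bullet> snd p = snd q \<bullet> fst p})"
    by (rule set_eqI) (auto simp: split_paired_all adj_iff_inner[OF assms])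
  also have "closed \<dots>"
    by (intro closed_INT ballI closed_Collect_eq continuous_intros)
  finally show ?thesis .
qed

lemma selfadjoint_closed_operator:
  assumes "selfadjoint B"
  shows "closed_operator B"
  using assms closed_adj[of B] linear_operator_adj[of B]
  unfolding selfadjoint_def closed_operator_def by metis

text \<open>Project \<open>(x, 0)\<close> orthogonally onto the graph of \<open>A\<close>.\<close>

lemma one_plus_adj_comp_onto:
  fixes A :: "('a::chilbert_space, 'b::chilbert_space) graph"
  assumes "closed_operator A"
  obtains w y v where "(w, y) \<in> A" "(y, v) \<in> adj A" "x = w + v"
proof -
  have lin: "linear_operator A" and "closed A"
    using assms by (auto simp: closed_operator_def)
  obtain p where p: "p \<in> A" "\<And>q. q \<in> A \<Longrightarrow> ((x, 0) - p) \<bullet> q = 0"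
    using orthogonal_decomposition[OF \<open>closed A\<close> linear_operator_subspace[OF lin], of "(x, 0)"] by metis
  have "(snd p, x - fst p) \<in> adj A"
    unfolding adj_iff_inner[OF lin]
  proof clarify
    fix a c assume "(a, c) \<in> A"
    from p(2)[OF this] show "snd p \<bullet> c = (x - fst p) \<bullet> a"
      by (simp add: inner_prod_def)
  qed
  with p(1) show thesis
    by (intro that[of "fst p" "snd p" "x - fst p"]) auto
qed

text \<open>The cross term \<open>w \<bullet> v\<close> equals \<open>y \<bullet> y\<close>. So
  \<open>(1 + adj A A)^-1\<close> and its difference from the identity are contractions, as the
  square root iteration requires.\<close>

lemma norm_le_of_one_plus_adj_comp:
  assumes "(w, y) \<in> A" "(y, v) \<in> adj A"
  shows "norm w \<le> norm (w + v)" "norm v \<le> norm (w + v)"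
proof -
  have "y \<bullet> y = v \<bullet> w"
    using inner_adj[OF assms] .
  then have "0 \<le> w \<bullet> v"
    using inner_ge_zero[of y] by (simp add: inner_commute)
  then have "(norm w)\<^sup>2 \<le> (norm (w + v))\<^sup>2" "(norm v)\<^sup>2 \<le> (norm (w + v))\<^sup>2"
    unfolding power2_norm_eq_inner
    using inner_ge_zero[of w] inner_ge_zero[of v]
    by (simp_all add: inner_add_left inner_add_right inner_commute[of v w])
  then show "norm w \<le> norm (w + v)" "norm v \<le> norm (w + v)"
    by (auto intro: power2_le_imp_le)
qed

text \<open>
  With \<open>C = (1 + A\<^sup>*A)\<^sup>-\<^sup>1\<close>, \<open>S = C\<^bsup>1/2\<^esup>\<close> and \<open>U = (1 - C)\<^bsup>1/2\<^esup>\<close>, the square root is \<open>U S\<^sup>-\<^sup>1\<close>. Since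
  \<open>S\<^sup>2 + U\<^sup>2 = 1\<close>, the equation \<open>U y = S z\<close> is solved by exactly the pairs \<open>(y, z) = (S x, U x)\<close>,
  where \<open>x = S y + U z\<close>. Positivity of \<open>S U\<close> needs in addition a root of \<open>S\<close> commuting with \<open>U\<close>.
\<close>

lemma sqrt_adj_comp_exists:
  fixes A :: "('a::chilbert_space, 'b::chilbert_space) graph"
  assumes closedA: "closed_operator A" and denseA: "densely_defined A"
  shows "\<exists>B. selfadjoint B \<and> nonnegative B \<and> B \<circ>\<^sub>o B = adj A \<circ>\<^sub>o A"
proof -
  have linA: "linear_operator A"
    using closedA by (simp add: closed_operator_def)
  have linA': "linear_operator (adj A)"
    using denseA by (rule linear_operator_adj)
  define T where "T = adj A \<circ>\<^sub>o A"
  have T_iff: "(w, v) \<in> T \<longleftrightarrow> (\<exists>y. (w, y) \<in> A \<and> (y, v) \<in> adj A)" for w v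
    by (auto simp: T_def comp_op_def)
  have T_add: "(w + w', v + v') \<in> T" if "(w, v) \<in> T" "(w', v') \<in> T" for w v w' v'
    using that linear_operator_add[OF linA] linear_operator_add[OF linA'] unfolding T_iff by blast
  have T_scale: "(a *\<^sub>C w, a *\<^sub>C v) \<in> T" if "(w, v) \<in> T" for a w v
    using that linear_operator_scaleC[OF linA] linear_operator_scaleC[OF linA'] unfolding T_iff by blast
  have T_norm: "norm w \<le> norm (w + v)" "norm v \<le> norm (w + v)" if "(w, v) \<in> T" for w v
    using that norm_le_of_one_plus_adj_comp unfolding T_iff by blast+
  have T_sym: "w \<bullet> v' = v \<bullet> w'" if "(w, v) \<in> T" "(w', v') \<in> T" for w v w' v'
    using that inner_adj[of _ _ A] unfolding T_iff by (metis inner_commute)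
  \<comment> \<open>The pair in \<open>T\<close> says that \<open>adj A A\<close> sends
    \<open>w\<close> to \<open>x - w\<close>; the function \<open>C\<close> chosen from this is
    \<open>(1 + adj A A)^-1\<close>.\<close>
  have "\<exists>w. (w, x - w) \<in> T" for x
    using one_plus_adj_comp_onto[OF closedA, of x] unfolding T_iff by (metis add_diff_cancel_left')
  then obtain C where C: "\<And>x. (C x, x - C x) \<in> T"
    by metis
  have C_eqI: "C x = w" if "(w, x - w) \<in> T" for x w
  proof -
    have "(C x + - 1 *\<^sub>C w, (x - C x) + - 1 *\<^sub>C (x - w)) \<in> T"
      using T_add[OF C T_scale[OF that]] .
    from T_norm(1)[OF this] show ?thesis
      by simp
  qed
  have C_add: "C (x + y) = C x + C y" for x y
    using T_add[OF C[of x] C[of y]] by (intro C_eqI) (simp add: algebra_simps)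
  have C_scale: "C (a *\<^sub>C x) = a *\<^sub>C C x" for a x
    using T_scale[OF C[of x], of a] by (intro C_eqI) (simp add: scaleC_diff_right)
  have C_norm: "norm (C x) \<le> norm x" "norm (x - C x) \<le> norm x" for x
    using T_norm[OF C[of x]] by simp_all
  have blC: "bounded_linear C"
    by (rule bounded_linear_intro[of _ 1]) (simp_all add: C_add C_scale C_norm scaleR_scaleC)
  have C_sym: "C x \<bullet> y = x \<bullet> C y" for x y
    using T_sym[OF C[of x] C[of y]] by (simp add: inner_diff_left inner_diff_right inner_commute)
  have C_inj: "x = 0" if "C x = 0" for x
  proof -
    have "(0, x) \<in> T"
      using C[of x] that by simp
    then have "(0, x) \<in> adj A"
      unfolding T_iff using linear_operator_unique[OF linA linear_operator_zero[OF linA]] by blast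
    then show ?thesis
      using linear_operator_unique[OF linA' linear_operator_zero[OF linA']] by blast
  qed
  define cC where "cC = Blinfun C"
  have cC: "blinfun_apply cC = C"
    unfolding cC_def by (rule bounded_linear_Blinfun_apply) fact
  have cC_norm: "norm cC \<le> 1" "norm (id_blinfun - cC) \<le> 1"
    by (rule norm_blinfun_bound; simp add: cC C_norm blinfun.diff_left)+
  have sym1: "(id_blinfun - cC) x \<bullet> y = x \<bullet> (id_blinfun - cC) y" "cC x \<bullet> y = x \<bullet> cC y" for x y
    by (simp_all add: blinfun.diff_left cC inner_diff_left inner_diff_right C_sym)
  \<comment> \<open>The choices \<open>K = 1 - C\<close>, \<open>K = C\<close> and
    \<open>K = Y1\<close> make \<open>1 - Y1\<close>, \<open>1 - Y2\<close>, \<open>1 - Y3\<close>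
    square roots of \<open>C\<close>, of \<open>1 - C\<close> and of \<open>1 - Y1\<close>.\<close>
  obtain Y1 :: "'a \<Rightarrow>\<^sub>L 'a" where Y1: "norm Y1 \<le> 1" "\<And>x y. Y1 x \<bullet> y = x \<bullet> Y1 y"
    "\<And>x. Y1 (Y1 x) = 2 *\<^sub>R Y1 x - (id_blinfun - cC) x"
    "\<And>Z. Z o\<^sub>L (id_blinfun - cC) = (id_blinfun - cC) o\<^sub>L Z \<Longrightarrow> Z o\<^sub>L Y1 = Y1 o\<^sub>L Z"
    using sqrt_contraction[OF cC_norm(2) sym1(1)] by metis
  obtain Y2 :: "'a \<Rightarrow>\<^sub>L 'a" where Y2: "\<And>x y. Y2 x \<bullet> y = x \<bullet> Y2 y"
    "\<And>x. Y2 (Y2 x) = 2 *\<^sub>R Y2 x - cC x"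
    "\<And>Z. Z o\<^sub>L cC = cC o\<^sub>L Z \<Longrightarrow> Z o\<^sub>L Y2 = Y2 o\<^sub>L Z" "norm Y2 \<le> 1"
    using sqrt_contraction[OF cC_norm(1) sym1(2)] by metis
  obtain Y3 :: "'a \<Rightarrow>\<^sub>L 'a" where Y3: "\<And>x y. Y3 x \<bullet> y = x \<bullet> Y3 y"
    "\<And>x. Y3 (Y3 x) = 2 *\<^sub>R Y3 x - Y1 x"
    "\<And>Z. Z o\<^sub>L Y1 = Y1 o\<^sub>L Z \<Longrightarrow> Z o\<^sub>L Y3 = Y3 o\<^sub>L Z"
    using sqrt_contraction[OF Y1(1,2)] by metis
  have commI: "Z o\<^sub>L W = W o\<^sub>L Z \<longleftrightarrow> (\<forall>x. Z (W x) = W (Z x))" for Z W :: "'a \<Rightarrow>\<^sub>L 'a"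
    by (metis blinfun_apply_blinfun_compose blinfun_eqI)
  \<comment> \<open>Commutation passes along a chain: \<open>Y1\<close> commutes with
    \<open>C\<close>, therefore with \<open>Y2\<close>, and \<open>Y2\<close> therefore with
    \<open>Y3\<close>.\<close>
  have Y1C: "cC (Y1 x) = Y1 (cC x)" for x
    using Y1(4)[of cC] unfolding commI by (simp add: blinfun.diff_left blinfun.diff_right)
  have Y12: "Y1 (Y2 x) = Y2 (Y1 x)" for x
    using Y2(3)[of Y1] Y1C unfolding commI by simp
  have Y23: "Y2 (Y3 x) = Y3 (Y2 x)" for x
    using Y3(3)[of Y2] Y12 unfolding commI by simp
  \<comment> \<open>Multiplication by a complex scalar is a bounded real-linear operator commuting
    with \<open>C\<close>, hence with the limits; this is where their complex linearity comes
    from.\<close>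
  have blI: "blinfun_apply (Blinfun (\<lambda>x::'a. a *\<^sub>C x)) = (\<lambda>x. a *\<^sub>C x)" for a
    by (rule bounded_linear_Blinfun_apply) (rule bounded_linear_scaleC)
  have Y1_scale: "Y1 (a *\<^sub>C x) = a *\<^sub>C Y1 x" for a x
    using Y1(4)[of "Blinfun (\<lambda>x. a *\<^sub>C x)"] unfolding commI
    by (simp add: blI blinfun.diff_left cC C_scale scaleC_diff_right)
  have Y2_scale: "Y2 (a *\<^sub>C x) = a *\<^sub>C Y2 x" for a x
    using Y2(3)[of "Blinfun (\<lambda>x. a *\<^sub>C x)"] unfolding commI by (simp add: blI cC C_scale)
  define S where "S x = x - Y1 x" for x
  define U where "U x = x - Y2 x" for x
  define W where "W x = x - Y3 x" for x
  have S_lin: "S (x + y) = S x + S y" "S (a *\<^sub>C x) = a *\<^sub>C S x" "S 0 = 0" "S (x - y) = S x - S y" for x y a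
    by (simp_all add: S_def blinfun.add_right blinfun.diff_right Y1_scale scaleC_diff_right)
  have U_lin: "U (x + y) = U x + U y" "U (a *\<^sub>C x) = a *\<^sub>C U x" "U 0 = 0" "U (x - y) = U x - U y" for x y a
    by (simp_all add: U_def blinfun.add_right blinfun.diff_right Y2_scale scaleC_diff_right)
  have S_sym: "S x \<bullet> y = x \<bullet> S y" and U_sym: "U x \<bullet> y = x \<bullet> U y" and W_sym: "W x \<bullet> y = x \<bullet> W y" for x y
    by (simp_all add: S_def U_def W_def inner_diff_left inner_diff_right Y1(2) Y2(1) Y3(1))
  have SS: "S (S x) = C x" for x
    by (simp add: S_def blinfun.diff_right blinfun.diff_left Y1(3) cC scaleR_2)
  have UU: "U (U x) = x - C x" for x
    by (simp add: U_def blinfun.diff_right Y2(2) cC scaleR_2)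
  have WW: "W (W x) = S x" for x
    by (simp add: W_def S_def blinfun.diff_right Y3(2) scaleR_2)
  have SU: "S (U x) = U (S x)" for x
    by (simp add: S_def U_def blinfun.diff_right Y12)
  have UW: "U (W x) = W (U x)" for x
    by (simp add: W_def U_def blinfun.diff_right Y23)
  have S_inj: "x = 0" if "S x = 0" for x
    using SS[of x] that C_inj S_lin(3) by metis
  have U_pos: "0 \<le> U x \<bullet> x" for x
  proof -
    have "norm (Y2 x) \<le> norm x"
      using norm_blinfun[of Y2 x] Y2(4) mult_right_mono[OF Y2(4), of "norm x"] by simp
    then have "Y2 x \<bullet> x \<le> norm x * norm x"
      using norm_cauchy_schwarz[of "Y2 x" x] mult_right_mono[of "norm (Y2 x)" "norm x" "norm x"] by simp
    then show ?thesis
      by (simp add: U_def inner_diff_left flip: power2_norm_eq_inner power2_eq_square)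
  qed
  define B where "B = range (\<lambda>x. (S x, U x))"
  have solve: "S (S y + U z) = y \<and> U (S y + U z) = z" if "U y = S z" for y z
  proof -
    have "S (S y + U z) = C y + U (S z)"
      by (simp add: S_lin SS SU)
    moreover have "U (S y + U z) = S (U y) + (z - C z)"
      by (simp add: U_lin UU SU)
    moreover have "U (S z) = y - C y" "S (U y) = C z"
      using UU[of y] SS[of z] that by simp_all
    ultimately show ?thesis
      by simp
  qed
  have B_iff: "(y, z) \<in> B \<longleftrightarrow> U y = S z" for y z
  proof
    assume "(y, z) \<in> B"
    then show "U y = S z"
      by (auto simp: B_def SU)
  next
    assume "U y = S z"
    from solve[OF this] show "(y, z) \<in> B"
      unfolding B_def by (intro image_eqI[of _ _ "S y + U z"]) simp_all
  qed
  have linB: "linear_operator B"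
  proof (rule linear_operatorI)
    fix x y y' assume "(x, y) \<in> B" "(x, y') \<in> B"
    then have "S (y - y') = 0"
      unfolding B_iff S_lin by simp
    then show "y = y'"
      using S_inj[of "y - y'"] by simp
  qed (simp_all add: B_iff S_lin U_lin)
  \<comment> \<open>Moving \<open>U\<close> and \<open>S\<close> to the other side shows that the
    adjoint is cut out by the same equation as \<open>B\<close>.\<close>
  have "(y, z) \<in> adj B \<longleftrightarrow> U y = S z" for y z
  proof -
    have "(y, z) \<in> adj B \<longleftrightarrow> (\<forall>x. y \<bullet> U x = z \<bullet> S x)"
      unfolding adj_iff_inner[OF linB] by (auto simp: B_def)
    also have "\<dots> \<longleftrightarrow> (\<forall>x. (U y - S z) \<bullet> x = 0)"
      by (simp add: U_sym S_sym inner_diff_left)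
    also have "\<dots> \<longleftrightarrow> U y = S z"
      by (metis eq_iff_diff_eq_0 inner_eq_zero_iff inner_zero_left)
    finally show ?thesis .
  qed
  then have adjB: "adj B = B"
    using B_iff by auto
  have "subspace (Domain B)"
    unfolding subspace_def
  proof (intro conjI allI ballI)
    show "0 \<in> Domain B"
      using linear_operator_zero[OF linB] by blast
    show "x + y \<in> Domain B" if "x \<in> Domain B" "y \<in> Domain B" for x y
      using that linear_operator_add[OF linB] by blast
    show "c *\<^sub>R x \<in> Domain B" if "x \<in> Domain B" for c x
      using that linear_operator_scaleC[OF linB] unfolding scaleR_scaleC by blast
  qed
  moreover have "Domain B = range S"
    by (auto simp: B_def)
  ultimately have "closure (Domain B) = UNIV"
  proof (intro dense_subspaceI)
    fix y assume "\<And>v. v \<in> Domain B \<Longrightarrow> y \<bullet> v = 0"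
    with \<open>Domain B = range S\<close> have "y \<bullet> S (S y) = 0"
      by simp
    then have "S y = 0"
      using S_sym[of y "S y"] by simp
    then show "y = 0"
      by (rule S_inj)
  qed simp
  then have "selfadjoint B"
    unfolding selfadjoint_def densely_defined_def using adjB by simp
  moreover have "nonnegative B"
    unfolding nonnegative_def
  proof clarify
    fix f g assume fg: "(f, g) \<in> B"
    then have "cinner f g = cinner g f"
      using adjB unfolding adj_def by blast
    then have "cinner f g \<in> \<real>"
      by (metis Reals_cnj_iff cinner_commute)
    \<comment> \<open>With \<open>S = W^2\<close> and \<open>W\<close> commuting with
      \<open>U\<close>, the product \<open>S x \<bullet> U x\<close> becomes
      \<open>U (W x) \<bullet> W x\<close>.\<close>
    moreover obtain x where "f = S x" "g = U x"
      using fg by (auto simp: B_def)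
    then have "f \<bullet> g = U (W x) \<bullet> W x"
      using W_sym[of "W x" "U x"] UW[of x] WW[of x] by (simp add: inner_commute)
    then have "0 \<le> Re (cinner f g)"
      using U_pos by (simp add: inner_eq_Re_cinner)
    ultimately show "cinner f g \<in> \<real> \<and> 0 \<le> Re (cinner f g)" ..
  qed
  moreover have "B \<circ>\<^sub>o B = T"
  proof (intro set_eqI, clarify)
    fix x z
    show "(x, z) \<in> B \<circ>\<^sub>o B \<longleftrightarrow> (x, z) \<in> T"
    proof
      assume "(x, z) \<in> B \<circ>\<^sub>o B"
      then obtain u v where uv: "x = S u" "(U u, z) \<in> B" "z = U v" "U u = S v"
        unfolding comp_op_def B_def by auto
      \<comment> \<open>This \<open>w\<close> has \<open>S w = u\<close> and \<open>U w = v\<close>,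
        so \<open>x = S (S w) = C w\<close> and \<open>z = U (U w) = w - C w\<close>.\<close>
      define w where "w = S u + U v"
      have "S w = u" "U w = v"
        using solve[OF uv(4)] by (auto simp: w_def)
      then have "x = C w" "z = w - C w"
        using uv SS[of w] UU[of w] by simp_all
      then show "(x, z) \<in> T"
        using C by simp
    next
      assume "(x, z) \<in> T"
      then have "C (x + z) = x"
        by (intro C_eqI) simp
      then obtain q where "x = S (S q)" "z = U (U q)"
        using SS[of "x + z"] UU[of "x + z"] by (metis add_diff_cancel_left')
      then have "(x, U (S q)) \<in> B" "(U (S q), z) \<in> B"
        unfolding B_iff by (simp_all add: SU)
      then show "(x, z) \<in> B \<circ>\<^sub>o B"
        unfolding comp_op_def by blast
    qed
  qed
  ultimately show ?thesis
    unfolding T_def by blast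
qed

text \<open>Once a root exists, whichever one the choice operator selects has these
  properties.\<close>

lemma abs_op_props:
  fixes A :: "('a::chilbert_space, 'b::chilbert_space) graph"
  assumes "closed_operator A" "densely_defined A"
  shows "selfadjoint (abs_op A)" "nonnegative (abs_op A)" "abs_op A \<circ>\<^sub>o abs_op A = adj A \<circ>\<^sub>o A"
  using someI_ex[OF sqrt_adj_comp_exists[OF assms]] unfolding abs_op_def sqrt_op_def by blast+

text \<open>
  The graph of \<open>A\<close> is the closure of its restriction to the domain of \<open>A\<^sup>*A\<close>, on which
  \<open>\<parallel>A w\<parallel>\<^sup>2 = \<langle>A\<^sup>*A w, w\<rangle> = \<parallel>B w\<parallel>\<^sup>2\<close>.
\<close>

lemma Domain_subset_of_adj_comp_eq:
  fixes A :: "('a::chilbert_space, 'b::chilbert_space) graph"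
    and B :: "('a, 'c::chilbert_space) graph"
  assumes A: "closed_operator A" "densely_defined A"
    and B: "closed_operator B"
    and eq: "adj A \<circ>\<^sub>o A = adj B \<circ>\<^sub>o B"
  shows "Domain A \<subseteq> Domain B"
proof
  have linA: "linear_operator A" and "closed A" and linB: "linear_operator B" and "closed B"
    using A B by (auto simp: closed_operator_def)
  have linA': "linear_operator (adj A)"
    using A(2) by (rule linear_operator_adj)
  define G where "G = {(w, y). (w, y) \<in> A \<and> y \<in> Domain (adj A)}"
  have "subspace (Domain (adj A))"
    unfolding subspace_def
    using linear_operator_zero[OF linA'] linear_operator_add[OF linA']
      linear_operator_scaleC[OF linA'] unfolding scaleR_scaleC by blast
  moreover have G_eq: "G = A \<inter> UNIV \<times> Domain (adj A)"
    by (auto simp: G_def)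
  ultimately have subG: "subspace G"
    using linear_operator_subspace[OF linA]
    by (simp add: G_eq subspace_inter subspace_Times subspace_UNIV)
  have "closure G = A"
  proof (rule closed_subspace_eqI)
    show "subspace (closure G)"
      by (rule subspace_closure) (rule subG)
    show "closure G \<subseteq> A"
      using \<open>closed A\<close> by (intro closure_minimal) (auto simp: G_def)
    fix p assume "p \<in> A" and orth: "\<And>q. q \<in> closure G \<Longrightarrow> p \<bullet> q = 0"
    \<comment> \<open>With \<open>fst p = (1 + adj A A) w\<close>, orthogonality of \<open>p\<close>
      to the graph element \<open>(w, A w)\<close> reads \<open>fst p \<bullet> (w + v) = 0\<close>,
      that is \<open>fst p \<bullet> fst p = 0\<close>.\<close>
    obtain w y v where wyv: "(w, y) \<in> A" "(y, v) \<in> adj A" "fst p = w + v"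
      using one_plus_adj_comp_onto[OF A(1), of "fst p"] by metis
    then have "(w, y) \<in> closure G"
      using closure_subset by (fastforce simp: G_def)
    then have "fst p \<bullet> w + snd p \<bullet> y = 0"
      using orth by (fastforce simp: inner_prod_def)
    moreover have "y \<bullet> snd p = v \<bullet> fst p"
      using inner_adj[OF _ wyv(2)] \<open>p \<in> A\<close> by (metis prod.collapse)
    ultimately have "fst p \<bullet> fst p = 0"
      using wyv(3) by (simp add: inner_add_right inner_commute)
    then have "fst p = 0"
      by simp
    with \<open>p \<in> A\<close> have "snd p = 0"
      using linear_operator_unique[OF linA _ linear_operator_zero[OF linA]] by (metis prod.collapse)
    with \<open>fst p = 0\<close> show "p = 0"
      by (simp add: prod_eq_iff)
  qed (use linear_operator_subspace[OF linA] in auto)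
  fix x assume "x \<in> Domain A"
  then obtain a where "(x, a) \<in> closure G"
    using \<open>closure G = A\<close> by blast
  then obtain f where fG: "\<And>n::nat. f n \<in> G" and f: "f \<longlonglongrightarrow> (x, a)"
    unfolding closure_sequential by metis
  have "\<exists>b. (w, b) \<in> B \<and> (b, v) \<in> adj B" if "(w, y) \<in> A" "(y, v) \<in> adj A" for w y v
    using that eq unfolding comp_op_def by blast
  then have "\<exists>v b. (snd (f n), v) \<in> adj A \<and> (fst (f n), b) \<in> B \<and> (b, v) \<in> adj B" for n
    using fG[of n] by (fastforce simp: G_def)
  then obtain v b where v: "\<And>n. (snd (f n), v n) \<in> adj A"
    and b: "\<And>n. (fst (f n), b n) \<in> B" "\<And>n. (b n, v n) \<in> adj B"
    by metis
  have fA: "(fst (f n), snd (f n)) \<in> A" for n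
    using fG[of n] by (auto simp: G_def)
  \<comment> \<open>Both squared norms equal the pairing of \<open>v m - v n\<close> with the
    difference of the arguments. So convergence of the \<open>A\<close>-images makes the
    \<open>B\<close>-images Cauchy, and closedness of \<open>B\<close> captures the limit.\<close>
  have "norm (b m - b n) = norm (snd (f m) - snd (f n))" for m n
  proof -
    have "(b m - b n) \<bullet> (b m - b n) = (v m - v n) \<bullet> (fst (f m) - fst (f n))"
      using inner_adj[OF b(1)[of m] b(2)[of m]] inner_adj[OF b(1)[of m] b(2)[of n]]
        inner_adj[OF b(1)[of n] b(2)[of m]] inner_adj[OF b(1)[of n] b(2)[of n]]
      by (simp add: inner_diff_left inner_diff_right)
    also have "\<dots> = (snd (f m) - snd (f n)) \<bullet> (snd (f m) - snd (f n))"
      using inner_adj[OF fA[of m] v[of m]] inner_adj[OF fA[of m] v[of n]]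
        inner_adj[OF fA[of n] v[of m]] inner_adj[OF fA[of n] v[of n]]
      by (simp add: inner_diff_left inner_diff_right)
    finally show ?thesis
      by (simp add: norm_eq_sqrt_inner)
  qed
  moreover have "Cauchy (\<lambda>n. snd (f n))"
    using tendsto_snd[OF f] by (auto intro: LIMSEQ_imp_Cauchy)
  ultimately have "Cauchy b"
    unfolding Cauchy_def dist_norm by simp
  then obtain c where "b \<longlonglongrightarrow> c"
    using Cauchy_convergent convergent_def by blast
  then have "(\<lambda>n. (fst (f n), b n)) \<longlonglongrightarrow> (x, c)"
    using tendsto_fst[OF f] by (auto intro: tendsto_Pair)
  then have "(x, c) \<in> B"
    by (intro closed_sequentially[OF \<open>closed B\<close> b(1)])
  then show "x \<in> Domain B"
    by blast
qed

text \<open>The composite \<open>adj A A\<close> determines the domain of \<open>A\<close>, and for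
  the self-adjoint \<open>|A|\<close> the corresponding composite is \<open>|A|^2\<close>; so the
  inclusion lemma applies in both directions.\<close>

lemma Domain_abs_op:
  fixes A :: "('a::chilbert_space, 'b::chilbert_space) graph"
  assumes "closed_operator A" "densely_defined A"
  shows "Domain (abs_op A) = Domain A"
proof -
  have "adj (abs_op A) \<circ>\<^sub>o abs_op A = adj A \<circ>\<^sub>o A" "closed_operator (abs_op A)" "densely_defined (abs_op A)"
    using abs_op_props[OF assms] selfadjoint_closed_operator by (auto simp: selfadjoint_def)
  then show ?thesis
    using Domain_subset_of_adj_comp_eq[of "abs_op A" A] Domain_subset_of_adj_comp_eq[of A "abs_op A"] assms
    by auto
qed

section \<open>The Lumer-Phillips theorem\<close>

text \<open>
  The semigroup is the limit of the implicit Euler scheme with step sizes \<open>2\<^sup>-\<^sup>n\<close>. Halving the step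
  changes one step by \<open>O(h\<^sup>2)\<close> on the domain of \<open>G\<^sup>2\<close>, so no operator exponentials are needed.
\<close>

locale maximal_dissipative =
  fixes G :: "('a::chilbert_space, 'a) graph"
  assumes lin: "linear_operator G"
    and dense: "densely_defined G"
    and dissipative: "(x, y) \<in> G \<Longrightarrow> x \<bullet> y \<le> 0"
    and onto: "0 < h \<Longrightarrow> \<exists>w y. (w, y) \<in> G \<and> w - h *\<^sub>R y = x"
begin

lemma G_scaleR: "(x, y) \<in> G \<Longrightarrow> (r *\<^sub>R x, r *\<^sub>R y) \<in> G"
  unfolding scaleR_scaleC by (rule linear_operator_scaleC[OF lin])

text \<open>The resolvent \<open>(1 - h G)^-1\<close>, one implicit Euler step of length
  \<open>h\<close>.\<close>

definition J :: "real \<Rightarrow> 'a \<Rightarrow> 'a"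
  where "J h x = (SOME w. \<exists>y. (w, y) \<in> G \<and> w - h *\<^sub>R y = x)"

text \<open>Dissipativity makes the cross term \<open>- 2 h (w \<bullet> y)\<close> nonnegative.
  Both uniqueness and contractivity of the Euler step rest on this.\<close>

lemma norm_le_resolvent:
  assumes "0 < h" "(w, y) \<in> G"
  shows "norm w \<le> norm (w - h *\<^sub>R y)"
proof (rule power2_le_imp_le)
  have "(norm (w - h *\<^sub>R y))\<^sup>2 = (norm w)\<^sup>2 - 2 * h * (w \<bullet> y) + h\<^sup>2 * (norm y)\<^sup>2"
    unfolding power2_norm_eq_inner
    by (simp add: inner_diff_left inner_diff_right inner_commute power2_eq_square algebra_simps)
  moreover have "h * (w \<bullet> y) \<le> 0"
    using assms dissipative by (simp add: mult_le_0_iff)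
  moreover have "0 \<le> h\<^sup>2 * (norm y)\<^sup>2"
    by simp
  ultimately show "(norm w)\<^sup>2 \<le> (norm (w - h *\<^sub>R y))\<^sup>2"
    unfolding mult.assoc by linarith
qed simp

lemma J_in:
  assumes "0 < h"
  shows "(J h x, (1 / h) *\<^sub>R (J h x - x)) \<in> G"
proof -
  from someI_ex[OF onto[OF assms, of x]] obtain y where y: "(J h x, y) \<in> G" "J h x - h *\<^sub>R y = x"
    unfolding J_def by blast
  have "J h x - x = h *\<^sub>R y"
    using y(2) by (simp add: algebra_simps)
  with y(1) assms show ?thesis
    by simp
qed

lemma J_eqI:
  assumes "0 < h" "(w, y) \<in> G" "w - h *\<^sub>R y = x"
  shows "J h x = w"
proof -
  have "norm (J h x - w) \<le> norm ((J h x - w) - h *\<^sub>R ((1 / h) *\<^sub>R (J h x - x) - y))"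
    using norm_le_resolvent[OF assms(1) linear_operator_diff[OF lin J_in[OF assms(1)] assms(2)]] .
  also have "(J h x - w) - h *\<^sub>R ((1 / h) *\<^sub>R (J h x - x) - y) = 0"
    using assms(1,3) by (auto simp: algebra_simps)
  finally show ?thesis
    by simp
qed

lemma J_add: "0 < h \<Longrightarrow> J h (x + y) = J h x + J h y"
  by (rule J_eqI[OF _ linear_operator_add[OF lin J_in J_in]]) (auto simp: algebra_simps)

lemma J_diff: "0 < h \<Longrightarrow> J h (x - y) = J h x - J h y"
  by (rule J_eqI[OF _ linear_operator_diff[OF lin J_in J_in]]) (auto simp: algebra_simps)

lemma J_scaleC: "0 < h \<Longrightarrow> J h (a *\<^sub>C x) = a *\<^sub>C J h x"
  by (rule J_eqI[OF _ linear_operator_scaleC[OF lin J_in]])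
    (auto simp: scaleC_scaleR_commute scaleC_diff_right)

lemma J_scaleR: "0 < h \<Longrightarrow> J h (r *\<^sub>R x) = r *\<^sub>R J h x"
  unfolding scaleR_scaleC by (rule J_scaleC)

lemma norm_J: "0 < h \<Longrightarrow> norm (J h x) \<le> norm x"
  using norm_le_resolvent[OF _ J_in, of h h x] by simp

text \<open>The resolvent commutes with \<open>G\<close>: the quotient
  \<open>q = (J h x - x) / h\<close> satisfies \<open>q - h G q = y\<close>, so it is
  \<open>J h y\<close>.\<close>

lemma J_step:
  assumes "0 < h" "(x, y) \<in> G"
  shows "J h x - x = h *\<^sub>R J h y" and "(J h x, J h y) \<in> G"
proof -
  let ?q = "(1 / h) *\<^sub>R (J h x - x)"
  have "(?q, (1 / h) *\<^sub>R (?q - y)) \<in> G"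
    using G_scaleR[OF linear_operator_diff[OF lin J_in[OF assms(1)] assms(2)], of "1 / h"] .
  then have "J h y = ?q"
    using assms(1) by (intro J_eqI[OF assms(1)]) auto
  then show "J h x - x = h *\<^sub>R J h y" "(J h x, J h y) \<in> G"
    using assms(1) J_in[OF assms(1)] by simp_all
qed

lemma J_commute:
  assumes "0 < h" "0 < k"
  shows "J h (J k x) = J k (J h x)"
proof -
  have "(J h (J k x), J h ((1 / k) *\<^sub>R (J k x - x))) \<in> G"
    by (rule J_step(2)[OF assms(1) J_in[OF assms(2)]])
  then have "(J h (J k x), (1 / k) *\<^sub>R (J h (J k x) - J h x)) \<in> G"
    by (simp add: J_scaleR J_diff assms)
  then show ?thesis
    using assms(2) by (auto intro: J_eqI[OF assms(2), symmetric])
qed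

text \<open>With \<open>k = h / 2\<close> one has \<open>(1 - k G)^2 - (1 - h G) = k^2 G^2\<close>,
  so the difference of the two resolvents is \<open>J h (k^2 J k (J k z))\<close>, and contractivity
  leaves \<open>k^2 = h^2 / 4\<close>.\<close>

lemma J_halving:
  assumes "0 < h" "(x, y) \<in> G" "(y, z) \<in> G"
  shows "norm (J h x - J (h/2) (J (h/2) x)) \<le> h\<^sup>2 / 4 * norm z"
proof -
  define k where "k = h / 2"
  have k: "0 < k" "h = 2 * k"
    using assms(1) by (simp_all add: k_def)
  have wG: "(J k (J k x), J k (J k y)) \<in> G"
    by (intro J_step(2) k assms)
  have Jw: "J h (J k (J k x) - h *\<^sub>R J k (J k y)) = J k (J k x)"
    by (rule J_eqI[OF assms(1) wG]) simp
  have 1: "J k x = x + k *\<^sub>R J k y" "J k y = y + k *\<^sub>R J k z"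
    "J k (J k x) = J k x + k *\<^sub>R J k (J k y)" "J k (J k y) = J k y + k *\<^sub>R J k (J k z)"
    using J_step(1)[OF k(1) assms(2)] J_step(1)[OF k(1) assms(3)]
      J_step(1)[OF k(1) J_step(2)[OF k(1) assms(2)]] J_step(1)[OF k(1) J_step(2)[OF k(1) assms(3)]]
    by (metis add.commute diff_add_cancel)+
  have "x - (J k (J k x) - h *\<^sub>R J k (J k y)) = (k * k) *\<^sub>R J k (J k z)"
  proof -
    have "x - (J k (J k x) - h *\<^sub>R J k (J k y))
        = x - (x + k *\<^sub>R J k y + k *\<^sub>R J k (J k y) - (2 * k) *\<^sub>R J k (J k y))"
      using 1(1) 1(3) k(2) by simp
    also have "\<dots> = k *\<^sub>R (J k (J k y) - J k y)"
      by (simp add: algebra_simps flip: scaleR_add_left)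
    also have "\<dots> = (k * k) *\<^sub>R J k (J k z)"
      using 1(4) by (simp only: add_diff_cancel_left' scaleR_scaleR)
    finally show ?thesis .
  qed
  then have "J h x - J k (J k x) = J h ((k * k) *\<^sub>R J k (J k z))"
    using Jw J_diff[OF assms(1), of x "J k (J k x) - h *\<^sub>R J k (J k y)"] by simp
  then have "norm (J h x - J k (J k x)) \<le> norm ((k * k) *\<^sub>R J k (J k z))"
    using norm_J[OF assms(1)] by metis
  also have "\<dots> \<le> k * k * norm z"
    using norm_J[OF k(1), of "J k z"] norm_J[OF k(1), of z] k(1) by (simp add: mult_left_mono)
  also have "\<dots> = h\<^sup>2 / 4 * norm z"
    by (simp add: k power2_eq_square)
  finally show ?thesis
    by (simp add: k_def)
qed

section \<open>Repeated Euler steps\<close>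

lemma J_pow_diff: "0 < h \<Longrightarrow> (J h ^^ k) (x - y) = (J h ^^ k) x - (J h ^^ k) y"
  by (induction k) (simp_all add: J_diff)

lemma J_pow_add: "0 < h \<Longrightarrow> (J h ^^ k) (x + y) = (J h ^^ k) x + (J h ^^ k) y"
  by (induction k) (simp_all add: J_add)

lemma J_pow_scaleC: "0 < h \<Longrightarrow> (J h ^^ k) (a *\<^sub>C x) = a *\<^sub>C (J h ^^ k) x"
  by (induction k) (simp_all add: J_scaleC)

lemma norm_J_pow: "0 < h \<Longrightarrow> norm ((J h ^^ k) x) \<le> norm x"
  by (induction k) (auto intro: order_trans[OF norm_J])

lemma J_pow_lipschitz: "0 < h \<Longrightarrow> norm ((J h ^^ k) x - (J h ^^ k) y) \<le> norm (x - y)"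
  by (metis J_pow_diff norm_J_pow)

lemma J_pow_increment:
  assumes "0 < h" "(x, y) \<in> G"
  shows "norm ((J h ^^ k) x - x) \<le> real k * h * norm y"
proof (induction k)
  case (Suc k)
  have "(J h ^^ Suc k) x - (J h ^^ k) x = (J h ^^ k) (J h x - x)"
    using assms(1) by (simp only: J_pow_diff funpow_Suc_right comp_apply)
  then have "norm ((J h ^^ Suc k) x - (J h ^^ k) x) \<le> norm (J h x - x)"
    using norm_J_pow[OF assms(1)] by simp
  also have "\<dots> \<le> h * norm y"
    using J_step(1)[OF assms] norm_J[OF assms(1), of y] assms(1) by simp
  finally show ?case
    using Suc norm_triangle_ineq[of "(J h ^^ Suc k) x - (J h ^^ k) x" "(J h ^^ k) x - x"]
    by (simp add: algebra_simps)
qed simp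

text \<open>Two half steps commute with a full step and contract, so the one-step error bound
  \<open>e\<close> at \<open>x\<close> persists at all later points; \<open>k\<close> such errors
  accumulate.\<close>

lemma J_pow_halving:
  assumes h: "0 < h" and e: "norm (J h x - J (h/2) (J (h/2) x)) \<le> e"
  shows "norm ((J h ^^ k) x - (J (h/2) ^^ (2 * k)) x) \<le> real k * e"
  using e
proof (induction k arbitrary: x)
  case (Suc k)
  let ?Q = "\<lambda>x. J (h/2) (J (h/2) x)"
  have h2: "0 < h / 2"
    using h by simp
  have "J h (?Q x) - ?Q (?Q x) = ?Q (J h x - ?Q x)"
    by (simp add: J_diff[OF h2] J_commute[OF h h2])
  then have "norm (J h (?Q x) - ?Q (?Q x)) \<le> e"
    using norm_J[OF h2, of "J (h/2) (J h x - ?Q x)"] norm_J[OF h2, of "J h x - ?Q x"] Suc.prems by simp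
  then have "norm ((J h ^^ k) (?Q x) - (J (h/2) ^^ (2 * k)) (?Q x)) \<le> real k * e"
    by (rule Suc.IH)
  moreover have "norm ((J h ^^ k) (J h x) - (J h ^^ k) (?Q x)) \<le> e"
    using J_pow_lipschitz[OF h] Suc.prems order_trans by blast
  ultimately have "norm ((J h ^^ k) (J h x) - (J (h/2) ^^ (2 * k)) (?Q x)) \<le> e + real k * e"
    using norm_triangle_ineq[of "(J h ^^ k) (J h x) - (J h ^^ k) (?Q x)"
        "(J h ^^ k) (?Q x) - (J (h/2) ^^ (2 * k)) (?Q x)"]
    by simp
  moreover have "(J h ^^ Suc k) x = (J h ^^ k) (J h x)"
    "(J (h/2) ^^ (2 * Suc k)) x = (J (h/2) ^^ (2 * k)) (?Q x)"
    by (simp_all add: funpow_Suc_right del: funpow.simps)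
  ultimately show ?case
    by (simp add: algebra_simps)
qed simp

text \<open>The number of whole steps of length \<open>2^-n\<close> up to time \<open>t\<close>. The
  dropped remainder is shorter than one step; it causes the occasional extra step when the step is
  halved or times are added.\<close>

definition steps :: "nat \<Rightarrow> real \<Rightarrow> nat"
  where "steps n t = nat \<lfloor>t * 2 ^ n\<rfloor>"

lemma steps_bounds:
  assumes "0 \<le> t"
  shows "real (steps n t) * (1/2) ^ n \<le> t" "t < (real (steps n t) + 1) * (1/2) ^ n"
proof -
  have "real (steps n t) = of_int \<lfloor>t * 2 ^ n\<rfloor>"
    using assms by (simp add: steps_def)
  then have "real (steps n t) \<le> t * 2 ^ n" "t * 2 ^ n < real (steps n t) + 1"
    by linarith+
  then show "real (steps n t) * (1/2) ^ n \<le> t" "t < (real (steps n t) + 1) * (1/2) ^ n"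
    by (simp_all add: power_divide field_simps)
qed

lemma steps_eqI:
  assumes "0 \<le> t" "real m * (1/2) ^ n \<le> t" "t < (real m + 1) * (1/2) ^ n"
  shows "steps n t = m"
proof -
  have "real m \<le> t * 2 ^ n" "t * 2 ^ n < real m + 1"
    using assms(2,3) by (simp_all add: power_divide field_simps)
  then have "\<lfloor>t * 2 ^ n\<rfloor> = int m"
    by linarith
  then show ?thesis
    by (simp add: steps_def)
qed

lemma steps_Suc:
  assumes "0 \<le> t"
  shows "steps (Suc n) t = 2 * steps n t \<or> steps (Suc n) t = Suc (2 * steps n t)"
proof (cases "t < (2 * real (steps n t) + 1) * (1/2) ^ Suc n")
  case True
  then have "steps (Suc n) t = 2 * steps n t"
    using steps_bounds[OF assms, of n] assms by (intro steps_eqI) auto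
  then show ?thesis ..
next
  case False
  then have "steps (Suc n) t = Suc (2 * steps n t)"
    using steps_bounds[OF assms, of n] assms by (intro steps_eqI) (auto simp: field_simps)
  then show ?thesis ..
qed

lemma steps_add:
  assumes "0 \<le> s" "0 \<le> t"
  shows "steps n (s + t) = steps n s + steps n t \<or> steps n (s + t) = Suc (steps n s + steps n t)"
proof (cases "s + t < (real (steps n s + steps n t) + 1) * (1/2) ^ n")
  case True
  then have "steps n (s + t) = steps n s + steps n t"
    using steps_bounds[OF assms(1), of n] steps_bounds[OF assms(2), of n] assms
    by (intro steps_eqI) (auto simp: algebra_simps)
  then show ?thesis ..
next
  case False
  then have "steps n (s + t) = Suc (steps n s + steps n t)"
    using steps_bounds[OF assms(1), of n] steps_bounds[OF assms(2), of n] assms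
    by (intro steps_eqI) (auto simp: algebra_simps)
  then show ?thesis ..
qed

definition euler :: "nat \<Rightarrow> real \<Rightarrow> 'a \<Rightarrow> 'a"
  where "euler n t = J ((1/2) ^ n) ^^ steps n t"

lemma half_pos: "0 < (1/2::real) ^ n"
  by simp

lemma half_tendsto: "(\<lambda>n. (1/2::real) ^ n) \<longlonglongrightarrow> 0"
  by (rule LIMSEQ_realpow_zero) auto

text \<open>Halving the step \<open>h\<close> costs at most \<open>t / h\<close> local errors
  \<open>h^2 / 4 norm z\<close>, and possibly one additional half step moving \<open>x\<close> by at
  most \<open>h / 2 norm y\<close>. Giving away the fractions leaves a geometric majorant.\<close>

lemma euler_Suc:
  assumes "0 \<le> t" "(x, y) \<in> G" "(y, z) \<in> G"
  shows "norm (euler (Suc n) t x - euler n t x) \<le> (t * norm z + norm y) * (1/2) ^ n"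
proof -
  define h :: real where "h = (1/2) ^ n"
  have h: "0 < h" "0 < h / 2" "(1/2) ^ Suc n = h / 2"
    by (simp_all add: h_def)
  define k where "k = steps n t"
  have kh: "real k * h \<le> t"
    using steps_bounds(1)[OF assms(1)] by (simp add: k_def h_def)
  have "norm ((J h ^^ k) x - (J (h/2) ^^ (2 * k)) x) \<le> real k * (h\<^sup>2 / 4 * norm z)"
    using J_pow_halving[OF h(1) J_halving[OF h(1) assms(2,3)]] .
  also have "\<dots> = (real k * h) * (h / 4 * norm z)"
    by (simp add: power2_eq_square)
  also have "\<dots> \<le> t * (h / 4 * norm z)"
    using kh h by (intro mult_right_mono) auto
  also have "\<dots> \<le> t * norm z * h"
    using assms(1) h by (simp add: mult_left_mono)
  finally have 1: "norm ((J h ^^ k) x - (J (h/2) ^^ (2 * k)) x) \<le> t * norm z * h" .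
  have "norm ((J (h/2) ^^ (2 * k)) (J (h/2) x) - (J (h/2) ^^ (2 * k)) x) \<le> h / 2 * norm y"
    using J_pow_lipschitz[OF h(2), of "2 * k" "J (h/2) x" x] J_pow_increment[OF h(2) assms(2), of 1] by simp
  moreover have "h / 2 * norm y \<le> norm y * h"
    using h by (simp add: mult_right_mono)
  ultimately have 2: "norm ((J (h/2) ^^ Suc (2 * k)) x - (J (h/2) ^^ (2 * k)) x) \<le> norm y * h"
    by (simp only: funpow_Suc_right comp_apply)
  have "norm ((J (h/2) ^^ m) x - (J h ^^ k) x) \<le> t * norm z * h + norm y * h"
    if "m = 2 * k \<or> m = Suc (2 * k)" for m
    using that
  proof
    assume "m = 2 * k"
    with 1 h show ?thesis
      by (simp add: norm_minus_commute add_increasing2)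
  next
    assume m: "m = Suc (2 * k)"
    show ?thesis
      using 1 2 norm_triangle_ineq4[of "(J (h/2) ^^ Suc (2 * k)) x - (J (h/2) ^^ (2 * k)) x"
          "(J h ^^ k) x - (J (h/2) ^^ (2 * k)) x"] unfolding m by simp
  qed
  from this[of "steps (Suc n) t"] steps_Suc[OF assms(1), of n] show ?thesis
    unfolding euler_def h(3) h_def[symmetric] k_def[symmetric] by (simp add: algebra_simps)
qed

lemma norm_euler: "norm (euler n t x) \<le> norm x"
  unfolding euler_def by (rule norm_J_pow) simp

lemma euler_diff: "euler n t (x - y) = euler n t x - euler n t y"
  unfolding euler_def by (rule J_pow_diff) simp

lemma mult_less_half: "0 < c \<Longrightarrow> r < e / (2 * c) \<Longrightarrow> r * c < e / (2::real)"
  by (simp add: field_simps)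

text \<open>For \<open>x'\<close> in the domain of \<open>G\<close>, the point \<open>J h x'\<close>
  lies in the domain of \<open>G^2\<close> and within \<open>h norm y'\<close> of
  \<open>x'\<close>.\<close>

lemma dense_D2:
  assumes "0 < e"
  obtains y v w where "(y, v) \<in> G" "(v, w) \<in> G" "norm (x - y) < e"
proof -
  obtain x' where x': "x' \<in> Domain G" "norm (x' - x) < e / 2"
    using dense assms unfolding densely_defined_def
    by (metis UNIV_I closure_approachable dist_norm half_gt_zero)
  then obtain y' where y': "(x', y') \<in> G"
    by blast
  obtain n where n: "inverse (real (Suc n)) < e / (2 * (norm y' + 1))"
    using reals_Archimedean[of "e / (2 * (norm y' + 1))"] assms by (auto simp: add_nonneg_pos)
  let ?h = "inverse (real (Suc n))"
  have h: "0 < ?h"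
    by simp
  have "norm (J ?h x' - x') \<le> ?h * norm y'"
    using J_pow_increment[OF h y', of 1] by simp
  also have "\<dots> \<le> ?h * (norm y' + 1)"
    using h by (intro mult_left_mono) auto
  also have "\<dots> < e / 2"
    by (rule mult_less_half[OF _ n]) (simp add: add_nonneg_pos)
  finally have "norm (x - J ?h x') < e"
    using x'(2) norm_triangle_ineq[of "x' - J ?h x'" "x - x'"] by (simp add: norm_minus_commute)
  with J_step(2)[OF h y'] J_in[OF h, of y'] show thesis
    by (rule that)
qed

text \<open>On the domain of \<open>G^2\<close> the increments are dominated by a geometric series;
  uniform contractivity carries the Cauchy property over to the closure.\<close>

lemma euler_convergent:
  assumes "0 \<le> t"
  shows "convergent (\<lambda>n. euler n t x)"
proof -
  have D2: "Cauchy (\<lambda>n. euler n t y)" if "(y, v) \<in> G" "(v, w) \<in> G" for y v w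
  proof -
    have "summable (\<lambda>n. euler (Suc n) t y - euler n t y)"
    proof (rule summable_comparison_test')
      show "summable (\<lambda>n. (t * norm w + norm v) * (1/2) ^ n)"
        by (intro summable_mult summable_geometric) simp
    qed (rule euler_Suc[OF assms that])
    then have "convergent (\<lambda>n. \<Sum>i<n. euler (Suc i) t y - euler i t y)"
      by (simp add: summable_iff_convergent)
    then have "convergent (\<lambda>n. (euler n t y - euler 0 t y) + euler 0 t y)"
      unfolding sum_lessThan_telescope[of "\<lambda>n. euler n t y"] by (intro convergent_add convergent_const)
    then show ?thesis
      by (simp add: convergent_Cauchy)
  qed
  have "Cauchy (\<lambda>n. euler n t x)"
  proof (rule metric_CauchyI)
    fix e :: real assume "0 < e"
    then obtain y v w where y: "(y, v) \<in> G" "(v, w) \<in> G" "norm (x - y) < e / 3"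
      using dense_D2[of "e / 3" x] by (metis divide_pos_pos zero_less_numeral)
    obtain M where M: "\<And>m n. M \<le> m \<Longrightarrow> M \<le> n \<Longrightarrow> dist (euler m t y) (euler n t y) < e / 3"
      using metric_CauchyD[OF D2[OF y(1,2)], of "e / 3"] \<open>0 < e\<close> by auto
    have "dist (euler m t x) (euler n t x) < e" if "M \<le> m" "M \<le> n" for m n
    proof -
      have "dist (euler k t x) (euler k t y) < e / 3" for k
        using norm_euler[of k t "x - y"] y(3) by (simp add: dist_norm flip: euler_diff)
      from this[of m] this[of n] M[OF that] show ?thesis
        using dist_triangle[of "euler m t x" "euler n t x" "euler m t y"]
          dist_triangle[of "euler m t y" "euler n t x" "euler n t y"]
        by (simp add: dist_commute)
    qed
    then show "\<exists>M. \<forall>m\<ge>M. \<forall>n\<ge>M. dist (euler m t x) (euler n t x) < e"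
      by blast
  qed
  then show ?thesis
    by (rule Cauchy_convergent)
qed

definition flow :: "real \<Rightarrow> 'a \<Rightarrow> 'a"
  where "flow t x = lim (\<lambda>n. euler n t x)"

lemma euler_tendsto: "0 \<le> t \<Longrightarrow> (\<lambda>n. euler n t x) \<longlonglongrightarrow> flow t x"
  using euler_convergent[of t x] convergent_LIMSEQ_iff[of "\<lambda>n. euler n t x"] unfolding flow_def by blast

lemma flow_add:
  assumes "0 \<le> t"
  shows "flow t (x + y) = flow t x + flow t y"
proof (rule LIMSEQ_unique)
  have "(\<lambda>n. euler n t x + euler n t y) \<longlonglongrightarrow> flow t x + flow t y"
    by (intro tendsto_add euler_tendsto assms)
  then show "(\<lambda>n. euler n t (x + y)) \<longlonglongrightarrow> flow t x + flow t y"
    by (simp add: euler_def J_pow_add)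
qed (rule euler_tendsto[OF assms])

lemma flow_scaleC:
  assumes "0 \<le> t"
  shows "flow t (a *\<^sub>C x) = a *\<^sub>C flow t x"
proof (rule LIMSEQ_unique)
  have "(\<lambda>n. a *\<^sub>C euler n t x) \<longlonglongrightarrow> a *\<^sub>C flow t x"
    by (rule bounded_linear.tendsto[OF bounded_linear_scaleC euler_tendsto[OF assms]])
  then show "(\<lambda>n. euler n t (a *\<^sub>C x)) \<longlonglongrightarrow> a *\<^sub>C flow t x"
    by (simp add: euler_def J_pow_scaleC)
qed (rule euler_tendsto[OF assms])

lemma flow_diff: "0 \<le> t \<Longrightarrow> flow t (x - y) = flow t x - flow t y"
  using flow_add[of t x "- 1 *\<^sub>C y"] flow_scaleC[of t "- 1" y] by simp

lemma norm_flow: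
  assumes "0 \<le> t"
  shows "norm (flow t x) \<le> norm x"
proof (rule Lim_bounded)
  show "(\<lambda>n. norm (euler n t x)) \<longlonglongrightarrow> norm (flow t x)"
    by (rule tendsto_norm[OF euler_tendsto[OF assms]])
  show "\<forall>n\<ge>0. norm (euler n t x) \<le> norm x"
    by (simp add: norm_euler)
qed

lemma flow_lipschitz: "0 \<le> t \<Longrightarrow> norm (flow t x - flow t y) \<le> norm (x - y)"
  using norm_flow[of t "x - y"] by (simp add: flow_diff)

lemma flow_0: "flow 0 x = x"
  using euler_tendsto[of 0 x] by (simp add: euler_def steps_def LIMSEQ_const_iff)

text \<open>At level \<open>n\<close> the step counts of \<open>s\<close> and \<open>t\<close> add
  up to that of \<open>s + t\<close> or fall one short, and a missing step costs at most
  \<open>2^-n norm y\<close>. The inner limit may be taken because every \<open>euler n s\<close> is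
  a contraction.\<close>

lemma flow_compose_domain:
  assumes "0 \<le> s" "0 \<le> t" "(x, y) \<in> G"
  shows "flow (s + t) x = flow s (flow t x)"
proof -
  have "(\<lambda>n. euler n (s + t) x - euler n s (euler n t x)) \<longlonglongrightarrow> 0"
  proof (rule Lim_null_comparison)
    show "\<forall>\<^sub>F n in sequentially. norm (euler n (s + t) x - euler n s (euler n t x)) \<le> (1/2) ^ n * norm y"
    proof (rule always_eventually, rule allI)
      fix n
      let ?h = "(1/2::real) ^ n" and ?k = "steps n s + steps n t"
      have "norm ((J ?h ^^ ?k) (J ?h x) - (J ?h ^^ ?k) x) \<le> ?h * norm y"
        using J_pow_lipschitz[OF half_pos[of n], of ?k "J ?h x" x] J_pow_increment[OF half_pos[of n] assms(3), of 1]
        by simp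
      then have "norm ((J ?h ^^ Suc ?k) x - (J ?h ^^ ?k) x) \<le> ?h * norm y"
        by (simp only: funpow_Suc_right comp_apply)
      moreover have "norm ((J ?h ^^ ?k) x - (J ?h ^^ ?k) x) \<le> ?h * norm y"
        by simp
      ultimately have "norm ((J ?h ^^ steps n (s + t)) x - (J ?h ^^ ?k) x) \<le> ?h * norm y"
        using steps_add[OF assms(1,2), of n] by metis
      then show "norm (euler n (s + t) x - euler n s (euler n t x)) \<le> ?h * norm y"
        by (simp add: euler_def funpow_add)
    qed
    show "(\<lambda>n. (1/2::real) ^ n * norm y) \<longlonglongrightarrow> 0"
      by (rule tendsto_mult_left_zero[OF half_tendsto])
  qed
  moreover have "(\<lambda>n. euler n s (euler n t x) - euler n s (flow t x)) \<longlonglongrightarrow> 0"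
  proof (rule Lim_null_comparison)
    show "\<forall>\<^sub>F n in sequentially. norm (euler n s (euler n t x) - euler n s (flow t x))
        \<le> norm (euler n t x - flow t x)"
      by (rule always_eventually) (metis euler_diff norm_euler)
    show "(\<lambda>n. norm (euler n t x - flow t x)) \<longlonglongrightarrow> 0"
      using euler_tendsto[OF assms(2), of x] by (simp add: LIM_zero tendsto_norm_zero)
  qed
  ultimately have "(\<lambda>n. (euler n (s + t) x - euler n s (euler n t x))
      + (euler n s (euler n t x) - euler n s (flow t x)) + euler n s (flow t x))
      \<longlonglongrightarrow> 0 + 0 + flow s (flow t x)"
    by (intro tendsto_add euler_tendsto assms)
  then have "(\<lambda>n. euler n (s + t) x) \<longlonglongrightarrow> flow s (flow t x)"
    by simp
  then show ?thesis
    using LIMSEQ_unique euler_tendsto[of "s + t" x] assms(1,2) by (metis add_nonneg_nonneg)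
qed

lemma eq_0_by_approximation:
  assumes "\<And>e. 0 < e \<Longrightarrow> norm (a::'a) \<le> c * e" "0 < c"
  shows "a = 0"
proof (rule ccontr)
  assume "a \<noteq> 0"
  then have "norm a \<le> c * (norm a / (2 * c))"
    using assms by (intro assms(1)) simp
  with \<open>a \<noteq> 0\<close> \<open>0 < c\<close> show False
    by simp
qed

lemma flow_compose:
  assumes "0 \<le> s" "0 \<le> t"
  shows "flow (s + t) x = flow s (flow t x)"
proof -
  have "flow (s + t) x - flow s (flow t x) = 0"
  proof (rule eq_0_by_approximation[of _ 2])
    fix e :: real assume "0 < e"
    then obtain y v w where y: "(y, v) \<in> G" "(v, w) \<in> G" "norm (x - y) < e"
      using dense_D2[of e x] by metis
    have "norm (flow (s + t) x - flow (s + t) y) \<le> norm (x - y)"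
      "norm (flow s (flow t x) - flow s (flow t y)) \<le> norm (x - y)"
      using flow_lipschitz assms by (auto intro: order_trans)
    then show "norm (flow (s + t) x - flow s (flow t x)) \<le> 2 * e"
      using y(3) norm_triangle_ineq4[of "flow (s + t) x - flow (s + t) y"
          "flow s (flow t x) - flow s (flow t y)"]
        flow_compose_domain[OF assms y(1)] by simp
  qed simp
  then show ?thesis
    by simp
qed

lemma flow_increment:
  assumes "0 \<le> t" "(x, y) \<in> G"
  shows "norm (flow t x - x) \<le> t * norm y"
proof (rule Lim_bounded)
  show "(\<lambda>n. norm (euler n t x - x)) \<longlonglongrightarrow> norm (flow t x - x)"
    by (intro tendsto_intros euler_tendsto assms)
  show "\<forall>n\<ge>0. norm (euler n t x - x) \<le> t * norm y"
  proof (intro allI impI)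
    fix n
    have "norm (euler n t x - x) \<le> real (steps n t) * (1/2) ^ n * norm y"
      unfolding euler_def by (rule J_pow_increment[OF half_pos assms(2)])
    also have "\<dots> \<le> t * norm y"
      by (rule mult_right_mono[OF steps_bounds(1)[OF assms(1)]]) simp
    finally show "norm (euler n t x - x) \<le> t * norm y" .
  qed
qed

lemma flow_increment_approx:
  assumes "0 \<le> t" "(y, z) \<in> G"
  shows "norm (flow t x - x) \<le> 2 * norm (x - y) + t * norm z"
proof -
  have "flow t x - x = (flow t x - flow t y) + (flow t y - y) - (x - y)"
    by simp
  then show ?thesis
    using flow_lipschitz[OF assms(1), of x y] flow_increment[OF assms]
      norm_triangle_ineq4[of "(flow t x - flow t y) + (flow t y - y)" "x - y"]
      norm_triangle_ineq[of "flow t x - flow t y" "flow t y - y"]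
    by simp
qed

text \<open>By the semigroup law and contractivity, the distance between times \<open>s\<close> and
  \<open>t\<close> is at most the increment from time zero over \<open>\<bar>t - s\<bar>\<close>, so
  continuity is even uniform in time.\<close>

lemma continuous_on_flow: "continuous_on {0..} (\<lambda>t. flow t x)"
proof -
  have mono: "dist (flow s x) (flow t x) \<le> norm (flow (t - s) x - x)" if "0 \<le> s" "s \<le> t" for s t
    using flow_lipschitz[OF that(1), of x "flow (t - s) x"]
      flow_compose[OF that(1), of "t - s" x] that
    by (simp add: dist_norm norm_minus_commute)
  have "\<exists>d>0. \<forall>s\<in>{0..}. \<forall>t\<in>{0..}. dist t s < d \<longrightarrow> dist (flow t x) (flow s x) < e"
    if e: "0 < e" for e
  proof -
    obtain y z w where y: "(y, z) \<in> G" "(z, w) \<in> G" "norm (x - y) < e / 4"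
      using dense_D2[of "e / 4" x] e by (metis divide_pos_pos zero_less_numeral)
    have small: "norm (flow r x - x) < e" if "0 \<le> r" "r < e / (2 * (norm z + 1))" for r
    proof -
      have "r * norm z \<le> r * (norm z + 1)"
        using that by (simp add: mult_left_mono)
      also have "\<dots> < e / 2"
        by (rule mult_less_half[OF _ that(2)]) (simp add: add_nonneg_pos)
      finally show ?thesis
        using flow_increment_approx[OF that(1) y(1), of x] y(3) by simp
    qed
    have "dist (flow t x) (flow s x) < e"
      if "0 \<le> s" "0 \<le> t" "dist t s < e / (2 * (norm z + 1))" for s t
      using that small[of "t - s"] small[of "s - t"] mono[of s t] mono[of t s]
      by (cases "s \<le> t") (auto simp: dist_real_def dist_commute)
    moreover have "0 < e / (2 * (norm z + 1))"
      using e by (simp add: add_nonneg_pos)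
    ultimately show ?thesis
      by (metis atLeast_iff)
  qed
  then show ?thesis
    by (intro uniformly_continuous_imp_continuous) (auto simp: uniformly_continuous_on_def)
qed

lemma contraction_semigroup: "contraction_semigroup flow"
  unfolding contraction_semigroup_def
  by (simp add: flow_add flow_scaleC norm_flow flow_0 flow_compose
      continuous_on_flow)

text \<open>Each increment is \<open>h\<close> times an iterate of \<open>y\<close>, which has to
  stay close to \<open>y\<close>. As \<open>y\<close> need not lie in the domain of
  \<open>G\<close>, this drift is controlled through a nearby \<open>y'\<close> that does.\<close>

lemma J_pow_taylor:
  assumes "0 < h" "(x, y) \<in> G" "(y', z') \<in> G"
  shows "norm ((J h ^^ k) x - x - (real k * h) *\<^sub>R y)
    \<le> real k * h * (2 * norm (y - y') + real k * h * norm z')"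
proof -
  have step: "norm ((J h ^^ j) y - y) \<le> 2 * norm (y - y') + real j * h * norm z'" for j
  proof -
    have "(J h ^^ j) y - y = ((J h ^^ j) y - (J h ^^ j) y') + ((J h ^^ j) y' - y') - (y - y')"
      by simp
    then show ?thesis
      using J_pow_lipschitz[OF assms(1), of j y y'] J_pow_increment[OF assms(1,3), of j]
        norm_triangle_ineq4[of "((J h ^^ j) y - (J h ^^ j) y') + ((J h ^^ j) y' - y')" "y - y'"]
        norm_triangle_ineq[of "(J h ^^ j) y - (J h ^^ j) y'" "(J h ^^ j) y' - y'"]
      by simp
  qed
  \<comment> \<open>The right-hand side keeps the final \<open>k\<close> for all
    \<open>j \<le> k\<close>, so that every step is charged the same drift.\<close>
  have "norm ((J h ^^ j) x - x - (real j * h) *\<^sub>R y)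
      \<le> real j * h * (2 * norm (y - y') + real k * h * norm z')" if "j \<le> k" for j
    using that
  proof (induction j)
    case (Suc j)
    have "(J h ^^ Suc j) x - (J h ^^ j) x = (J h ^^ j) (J h x - x)"
      using assms(1) by (simp only: J_pow_diff funpow_Suc_right comp_apply)
    also have "J h x - x = h *\<^sub>R J h y"
      by (rule J_step(1)[OF assms(1,2)])
    also have "(J h ^^ j) (h *\<^sub>R J h y) = h *\<^sub>R (J h ^^ Suc j) y"
      by (simp only: scaleR_scaleC J_pow_scaleC[OF assms(1)] funpow_Suc_right comp_apply)
    finally have inc: "(J h ^^ Suc j) x = (J h ^^ j) x + h *\<^sub>R (J h ^^ Suc j) y"
      by (simp add: algebra_simps)
    have "real (Suc j) * h * norm z' \<le> real k * h * norm z'"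
      using Suc.prems assms(1) by (intro mult_right_mono) auto
    then have "norm ((J h ^^ Suc j) y - y) \<le> 2 * norm (y - y') + real k * h * norm z'"
      using step[of "Suc j"] by linarith
    then have "norm (h *\<^sub>R ((J h ^^ Suc j) y - y)) \<le> h * (2 * norm (y - y') + real k * h * norm z')"
      using assms(1) by (simp add: mult_left_mono)
    moreover have "(J h ^^ Suc j) x - x - (real (Suc j) * h) *\<^sub>R y
        = ((J h ^^ j) x - x - (real j * h) *\<^sub>R y) + h *\<^sub>R ((J h ^^ Suc j) y - y)"
      unfolding inc by (simp add: algebra_simps del: funpow.simps)
    ultimately show ?case
      using Suc norm_triangle_ineq[of "(J h ^^ j) x - x - (real j * h) *\<^sub>R y" "h *\<^sub>R ((J h ^^ Suc j) y - y)"]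
      by (simp add: algebra_simps del: funpow.simps)
  qed simp
  then show ?thesis
    by simp
qed

lemma steps_tendsto:
  assumes "0 \<le> t"
  shows "(\<lambda>n. real (steps n t) * (1/2) ^ n) \<longlonglongrightarrow> t"
proof (rule tendsto_sandwich)
  show "\<forall>\<^sub>F n in sequentially. t - (1/2) ^ n \<le> real (steps n t) * (1/2) ^ n"
    using steps_bounds(2)[OF assms] by (intro always_eventually allI less_imp_le) (simp add: algebra_simps)
  show "\<forall>\<^sub>F n in sequentially. real (steps n t) * (1/2) ^ n \<le> t"
    using steps_bounds(1)[OF assms] by (intro always_eventually allI)
  show "(\<lambda>n. t - (1/2) ^ n) \<longlonglongrightarrow> t"
    using tendsto_diff[OF tendsto_const half_tendsto, of t] by simp
qed simp

lemma flow_taylor: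
  assumes "0 \<le> t" "(x, y) \<in> G" "(y', z') \<in> G"
  shows "norm (flow t x - x - t *\<^sub>R y) \<le> t * (2 * norm (y - y') + t * norm z')"
proof (rule LIMSEQ_le)
  let ?r = "\<lambda>n. real (steps n t) * (1/2) ^ n"
  show "(\<lambda>n. norm (euler n t x - x - ?r n *\<^sub>R y)) \<longlonglongrightarrow> norm (flow t x - x - t *\<^sub>R y)"
    by (intro tendsto_intros euler_tendsto steps_tendsto assms)
  show "(\<lambda>n. ?r n * (2 * norm (y - y') + ?r n * norm z')) \<longlonglongrightarrow> t * (2 * norm (y - y') + t * norm z')"
    by (intro tendsto_intros steps_tendsto assms)
  show "\<exists>N. \<forall>n\<ge>N. norm (euler n t x - x - ?r n *\<^sub>R y) \<le> ?r n * (2 * norm (y - y') + ?r n * norm z')"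
    unfolding euler_def using J_pow_taylor[OF half_pos assms(2,3)] by blast
qed

lemma subset_generator: "G \<subseteq> generator flow"
proof clarify
  fix x y assume xy: "(x, y) \<in> G"
  have "((\<lambda>t. (flow t x - x) /\<^sub>R t) \<longlongrightarrow> y) (at_right 0)"
    unfolding tendsto_iff
  proof (intro allI impI)
    fix e :: real assume "0 < e"
    then obtain y' z' w' where y': "(y', z') \<in> G" "(z', w') \<in> G" "norm (y - y') < e / 4"
      using dense_D2[of "e / 4" y] by (metis divide_pos_pos zero_less_numeral)
    have "dist ((flow t x - x) /\<^sub>R t) y < e" if t: "0 < t" "t < e / (2 * (norm z' + 1))" for t
    proof -
      have "norm (flow t x - x - t *\<^sub>R y) \<le> t * (2 * norm (y - y') + t * norm z')"
        using flow_taylor[OF _ xy y'(1)] t by simp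
      then have "norm (flow t x - x - t *\<^sub>R y) / t \<le> 2 * norm (y - y') + t * norm z'"
        using t by (simp add: pos_divide_le_eq mult.commute)
      moreover have "(flow t x - x) /\<^sub>R t - y = (flow t x - x - t *\<^sub>R y) /\<^sub>R t"
        using t by (simp add: scaleR_diff_right)
      then have "norm ((flow t x - x) /\<^sub>R t - y) = norm (flow t x - x - t *\<^sub>R y) / t"
        using t by (simp only: norm_scaleR) (simp add: divide_inverse mult.commute)
      ultimately have "norm ((flow t x - x) /\<^sub>R t - y) \<le> 2 * norm (y - y') + t * norm z'"
        by simp
      moreover have "t * norm z' \<le> t * (norm z' + 1)"
        using t by (simp add: mult_left_mono)
      moreover have "t * (norm z' + 1) < e / 2"
        by (rule mult_less_half[OF _ t(2)]) (simp add: add_nonneg_pos)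
      ultimately show ?thesis
        using y'(3) by (simp add: dist_norm)
    qed
    moreover have "0 < e / (2 * (norm z' + 1))"
      using \<open>0 < e\<close> by (simp add: add_nonneg_pos)
    ultimately show "\<forall>\<^sub>F t in at_right 0. dist ((flow t x - x) /\<^sub>R t) y < e"
      unfolding eventually_at_right_field by blast
  qed
  then show "(x, y) \<in> generator flow"
    by (simp add: generator_def)
qed

text \<open>The generator is dissipative, so \<open>1\<close> minus the generator is injective, while already \<open>1 - G\<close> is onto.\<close>

lemma generator_subset: "generator flow \<subseteq> G"
proof clarify
  fix x y assume xy: "(x, y) \<in> generator flow"
  obtain w v where wv: "(w, v) \<in> G" "w - v = x - y"
    using onto[of 1 "x - y"] by auto
  then have "(w, v) \<in> generator flow"
    using subset_generator by blast
  \<comment> \<open>The difference of the two pairs is \<open>(d, d)\<close>, so its difference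
    quotients paired with \<open>d\<close> tend to \<open>d \<bullet> d\<close>, whereas
    contractivity makes them nonpositive.\<close>
  define d where "d = x - w"
  have "y - v = d"
    using wv(2) by (simp add: d_def algebra_simps)
  have "((\<lambda>t. (flow t x - x) /\<^sub>R t - (flow t w - w) /\<^sub>R t) \<longlongrightarrow> y - v) (at_right 0)"
    using xy \<open>(w, v) \<in> generator flow\<close> by (intro tendsto_diff) (auto simp: generator_def)
  then have "((\<lambda>t. d \<bullet> ((flow t x - x) /\<^sub>R t - (flow t w - w) /\<^sub>R t)) \<longlongrightarrow> d \<bullet> d) (at_right 0)"
    unfolding \<open>y - v = d\<close> by (intro tendsto_intros)
  moreover have "\<forall>\<^sub>F t in at_right 0. d \<bullet> ((flow t x - x) /\<^sub>R t - (flow t w - w) /\<^sub>R t) \<le> 0"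
  proof (rule eventually_at_rightI[of 0 1])
    fix t :: real assume t: "t \<in> {0<..<1}"
    have eq: "(flow t x - x) /\<^sub>R t - (flow t w - w) /\<^sub>R t = (flow t d - d) /\<^sub>R t"
      using t by (simp add: d_def flow_diff algebra_simps)
    have "d \<bullet> flow t d \<le> norm d * norm (flow t d)"
      by (rule norm_cauchy_schwarz)
    also have "\<dots> \<le> norm d * norm d"
      using norm_flow[of t d] t by (simp add: mult_left_mono)
    also have "\<dots> = d \<bullet> d"
      by (metis power2_norm_eq_inner power2_eq_square)
    finally have "d \<bullet> (flow t d - d) \<le> 0"
      by (simp add: inner_diff_right)
    then show "d \<bullet> ((flow t x - x) /\<^sub>R t - (flow t w - w) /\<^sub>R t) \<le> 0"
      unfolding eq inner_scaleR_right using t by (intro mult_nonneg_nonpos) auto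
  qed simp
  ultimately have "d \<bullet> d \<le> 0"
    by (intro tendsto_upperbound) auto
  then have "d = 0"
    by (metis inner_ge_zero inner_eq_zero_iff order_antisym)
  with wv(1) \<open>y - v = d\<close> show "(x, y) \<in> G"
    by (simp add: d_def)
qed

lemma generates_contraction_semigroup: "generates_contraction_semigroup G"
  unfolding generates_contraction_semigroup_def
  using contraction_semigroup subset_generator generator_subset by blast

end


section \<open>Coercive forms and relative boundedness\<close>

text \<open>
  Stands in for the closed graph theorem. The sublevel sets of \<open>norm \<circ> F\<close> are intersections of closed
  sets, so Baire's theorem gives one of them an interior point.
\<close>

lemma bounded_linear_of_dense_weak_continuity:
  fixes F :: "'a::banach \<Rightarrow> 'b::real_inner"
  assumes lin: "linear F" and dense: "closure Y = UNIV"
    and cont: "\<And>y. y \<in> Y \<Longrightarrow> continuous_on UNIV (\<lambda>x. y \<bullet> F x)"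
  shows "bounded_linear F"
proof -
  define L where "L n = {x. norm (F x) \<le> real n}" for n :: nat
  \<comment> \<open>A bound on \<open>F x\<close> can be tested against \<open>Y\<close>, because
    \<open>F x\<close> itself is a limit of elements of \<open>Y\<close>; by hypothesis each test is
    a closed condition on \<open>x\<close>.\<close>
  have L_eq: "L n = (\<Inter>y\<in>Y. {x. \<bar>y \<bullet> F x\<bar> \<le> real n * norm y})" for n
  proof (intro equalityI subsetI)
    fix x assume "x \<in> L n"
    then have "\<bar>y \<bullet> F x\<bar> \<le> real n * norm y" for y
      using Cauchy_Schwarz_ineq2[of y "F x"] mult_left_mono[of "norm (F x)" "real n" "norm y"]
      by (simp add: L_def mult.commute)
    then show "x \<in> (\<Inter>y\<in>Y. {x. \<bar>y \<bullet> F x\<bar> \<le> real n * norm y})"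
      by simp
  next
    fix x assume x: "x \<in> (\<Inter>y\<in>Y. {x. \<bar>y \<bullet> F x\<bar> \<le> real n * norm y})"
    have "F x \<in> closure Y"
      using dense by simp
    then obtain f where f: "\<And>k::nat. f k \<in> Y" "f \<longlonglongrightarrow> F x"
      unfolding closure_sequential by metis
    have "F x \<bullet> F x \<le> real n * norm (F x)"
    proof (rule LIMSEQ_le)
      show "(\<lambda>k. f k \<bullet> F x) \<longlonglongrightarrow> F x \<bullet> F x" "(\<lambda>k. real n * norm (f k)) \<longlonglongrightarrow> real n * norm (F x)"
        by (intro tendsto_intros f)+
      show "\<exists>N. \<forall>k\<ge>N. f k \<bullet> F x \<le> real n * norm (f k)"
        using x f(1) by (meson INT_E abs_le_D1 mem_Collect_eq)
    qed
    then have "norm (F x) * norm (F x) \<le> real n * norm (F x)"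
      by (simp flip: power2_norm_eq_inner power2_eq_square)
    then show "x \<in> L n"
      by (cases "norm (F x) = 0") (auto simp: L_def)
  qed
  have closed_L: "closed (L n)" for n
    unfolding L_eq
  proof (intro closed_INT ballI)
    fix y assume "y \<in> Y"
    then show "closed {x. \<bar>y \<bullet> F x\<bar> \<le> real n * norm y}"
      by (intro closed_Collect_le continuous_intros cont)
  qed
  have "\<Union> (range L) = UNIV"
    unfolding L_def using real_arch_simple by auto
  have "\<exists>n. interior (L n) \<noteq> {}"
  proof (rule ccontr)
    assume "\<nexists>n. interior (L n) \<noteq> {}"
    then have "euclidean interior_of \<Union> (range L) = {}"
      using closed_L by (intro Baire_category_alt disjI1 completely_metrizable_space_euclidean) auto
    with \<open>\<Union> (range L) = UNIV\<close> show False
      by simp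
  qed
  then obtain n x0 where "x0 \<in> interior (L n)"
    by blast
  then obtain e where e: "0 < e" "cball x0 e \<subseteq> L n"
    by (meson interior_subset open_contains_cball open_interior order_trans)
  have "norm (F x) \<le> norm x * (2 * real n / e)" for x
  proof (cases "x = 0")
    case True
    then show ?thesis
      using linear_0[OF lin] by simp
  next
    case False
    define u where "u = (e / norm x) *\<^sub>R x"
    have "norm u = e"
      using False e by (simp add: u_def)
    then have "x0 + u \<in> L n" "x0 \<in> L n"
      using e by (auto intro!: subsetD[OF e(2)] simp: dist_norm)
    then have "norm (F (x0 + u)) \<le> real n" "norm (F x0) \<le> real n"
      by (simp_all add: L_def)
    then have "norm (F u) \<le> 2 * real n"
      using norm_triangle_ineq4[of "F (x0 + u)" "F x0"] linear_add[OF lin, of x0 u] by simp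
    moreover have "F u = (e / norm x) *\<^sub>R F x"
      by (simp add: u_def linear_scale[OF lin])
    ultimately show ?thesis
      using False e by (simp add: field_simps)
  qed
  with lin show ?thesis
    by (intro bounded_linear_intro[of F "2 * real n / e"]) (auto simp: linear_add linear_scale)
qed

text \<open>An operator that agrees with a bounded one on a dense domain closes to that bounded
  operator. This identifies the barred entries of the resolvent matrix.\<close>

lemma closure_graph_dense:
  fixes F :: "'a::real_normed_vector \<Rightarrow> 'b::real_normed_vector"
  assumes F: "bounded_linear F" and dense: "closure D = UNIV"
  shows "closure ((\<lambda>x. (x, F x)) ` D) = range (\<lambda>x. (x, F x))"
proof
  have "range (\<lambda>x. (x, F x)) = {p. F (fst p) = snd p}"
    by auto
  moreover have "closed {p. F (fst p) = snd p}"
    by (intro closed_Collect_eq continuous_intros bounded_linear.continuous_on[OF F])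
  ultimately show "closure ((\<lambda>x. (x, F x)) ` D) \<subseteq> range (\<lambda>x. (x, F x))"
    by (intro closure_minimal) auto
  have "continuous_on (closure D) (\<lambda>x. (x, F x))"
    by (intro continuous_intros bounded_linear.continuous_on[OF F])
  from continuous_image_closure_subset[OF this, of D] dense
  show "range (\<lambda>x. (x, F x)) \<subseteq> closure ((\<lambda>x. (x, F x)) ` D)"
    by simp
qed

text \<open>Bounded invertibility stated on the graph itself. For linear \<open>T\<close> the
  estimate at \<open>y = 0\<close> already contains injectivity.\<close>

definition boundedly_invertible :: "('c::complex_inner, 'd::complex_inner) graph \<Rightarrow> bool"
  where "boundedly_invertible T \<longleftrightarrow> (\<forall>y. \<exists>x. (x, y) \<in> T) \<and> (\<exists>K. \<forall>x y. (x, y) \<in> T \<longrightarrow> norm x \<le> K * norm y)"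

lemma converse_bounded_operators_iff:
  assumes lin: "linear_operator T"
  shows "T\<inverse> \<in> bounded_operators \<longleftrightarrow> boundedly_invertible T"
  unfolding boundedly_invertible_def
proof
  assume "T\<inverse> \<in> bounded_operators"
  then have "Domain (T\<inverse>) = UNIV" "\<exists>K. \<forall>(x, y)\<in>T\<inverse>. norm y \<le> K * norm x"
    by (auto simp: bounded_operators_def)
  then show "(\<forall>y. \<exists>x. (x, y) \<in> T) \<and> (\<exists>K. \<forall>x y. (x, y) \<in> T \<longrightarrow> norm x \<le> K * norm y)"
    by blast
next
  assume R: "(\<forall>y. \<exists>x. (x, y) \<in> T) \<and> (\<exists>K. \<forall>x y. (x, y) \<in> T \<longrightarrow> norm x \<le> K * norm y)"
  then obtain K where K: "\<And>x y. (x, y) \<in> T \<Longrightarrow> norm x \<le> K * norm y"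
    by blast
  have "linear_operator (T\<inverse>)"
  proof (rule linear_operatorI)
    fix x y y' assume "(x, y) \<in> T\<inverse>" "(x, y') \<in> T\<inverse>"
    then have "(y - y', 0) \<in> T"
      using linear_operator_diff[OF lin, of y x y' x] by simp
    from K[OF this] show "y = y'"
      by simp
  qed (auto intro: linear_operator_zero[OF lin] linear_operator_add[OF lin] linear_operator_scaleC[OF lin])
  with R show "T\<inverse> \<in> bounded_operators"
    unfolding bounded_operators_def by blast
qed

section \<open>Operators as functions on their domains\<close>

definition op_fun :: "('a, 'b) graph \<Rightarrow> 'a \<Rightarrow> 'b"
  where "op_fun T x = (THE y. (x, y) \<in> T)"

lemma op_fun_iff:
  assumes "linear_operator T"
  shows "(x, y) \<in> T \<longleftrightarrow> x \<in> Domain T \<and> y = op_fun T x"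
  unfolding op_fun_def using linear_operator_unique[OF assms]
  by (metis (mono_tags, lifting) Domain.simps the_equality)

lemma linear_operator_Domain:
  assumes "linear_operator T"
  shows "0 \<in> Domain T" "x \<in> Domain T \<Longrightarrow> y \<in> Domain T \<Longrightarrow> x + y \<in> Domain T"
    "x \<in> Domain T \<Longrightarrow> a *\<^sub>C x \<in> Domain T"
    "op_fun T 0 = 0"
    "x \<in> Domain T \<Longrightarrow> y \<in> Domain T \<Longrightarrow> op_fun T (x + y) = op_fun T x + op_fun T y"
    "x \<in> Domain T \<Longrightarrow> op_fun T (a *\<^sub>C x) = a *\<^sub>C op_fun T x"
  using linear_operator_zero[OF assms] linear_operator_add[OF assms] linear_operator_scaleC[OF assms]
  unfolding op_fun_iff[OF assms] by metis+

lemma op_fun_scaleR: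
  "linear_operator T \<Longrightarrow> x \<in> Domain T \<Longrightarrow> op_fun T (r *\<^sub>R x) = r *\<^sub>R op_fun T x"
  by (simp add: scaleR_scaleC linear_operator_Domain)

lemma inner_scaleC_self: "f \<bullet> (a *\<^sub>C f) = Re a * (norm (f::'a::complex_inner))\<^sup>2"
proof -
  have "cinner f f = complex_of_real ((norm f)\<^sup>2)"
    by (metis Re_complex_of_real Reals_cases Reals_cnj_iff cinner_commute inner_eq_Re_cinner power2_norm_eq_inner)
  then show ?thesis
    by (simp add: inner_eq_Re_cinner cinner_scaleC_right)
qed

locale nonnegative_selfadjoint =
  fixes B :: "('a::chilbert_space, 'a) graph"
  assumes selfadjoint: "selfadjoint B"
    and nonnegative: "nonnegative B"
begin

lemma lin_B: "linear_operator B" and closed_B: "closed B"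
  using selfadjoint_closed_operator[OF selfadjoint] by (auto simp: closed_operator_def)

definition D where "D = Domain B"

definition b where "b = op_fun B"

lemma B_iff: "(x, y) \<in> B \<longleftrightarrow> x \<in> D \<and> y = b x"
  unfolding D_def b_def by (rule op_fun_iff[OF lin_B])

lemma D_0: "0 \<in> D" and D_add: "x \<in> D \<Longrightarrow> y \<in> D \<Longrightarrow> x + y \<in> D"
  and D_scaleC: "x \<in> D \<Longrightarrow> a *\<^sub>C x \<in> D"
  and b_0: "b 0 = 0" and b_add: "x \<in> D \<Longrightarrow> y \<in> D \<Longrightarrow> b (x + y) = b x + b y"
  and b_scaleC: "x \<in> D \<Longrightarrow> b (a *\<^sub>C x) = a *\<^sub>C b x"
  unfolding D_def b_def by (rule linear_operator_Domain[OF lin_B]; assumption)+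

lemma D_scaleR: "x \<in> D \<Longrightarrow> c *\<^sub>R x \<in> D" and b_scaleR: "x \<in> D \<Longrightarrow> b (c *\<^sub>R x) = c *\<^sub>R b x"
  by (simp_all add: scaleR_scaleC D_scaleC b_scaleC)

lemma D_minus: "x \<in> D \<Longrightarrow> - x \<in> D" and b_minus: "x \<in> D \<Longrightarrow> b (- x) = - b x"
  using D_scaleC[of x "- 1"] b_scaleC[of x "- 1"] by simp_all

lemma D_diff: "x \<in> D \<Longrightarrow> y \<in> D \<Longrightarrow> x - y \<in> D"
  and b_diff: "x \<in> D \<Longrightarrow> y \<in> D \<Longrightarrow> b (x - y) = b x - b y"
  using D_add[of x "- y"] b_add[of x "- y"] D_minus[of y] b_minus[of y] by simp_all

lemma subspace_D: "subspace D"
  unfolding subspace_def using D_0 D_add D_scaleR by blast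

lemma dense_D: "closure D = UNIV"
  using selfadjoint unfolding selfadjoint_def densely_defined_def D_def by simp

lemma b_sym: "x \<in> D \<Longrightarrow> y \<in> D \<Longrightarrow> x \<bullet> b y = b x \<bullet> y"
  using selfadjoint inner_adj[of y "b y" B x "b x"] B_iff unfolding selfadjoint_def by blast

text \<open>This is \<open>adj B \<subseteq> B\<close>, the regularity step by which a weak identity
  places \<open>y\<close> in the domain.\<close>

lemma b_adjI:
  assumes "\<And>x. x \<in> D \<Longrightarrow> y \<bullet> b x = z \<bullet> x"
  shows "y \<in> D" "b y = z"
proof -
  have "(y, z) \<in> adj B"
    unfolding adj_iff_inner[OF lin_B] B_iff using assms by blast
  then have "(y, z) \<in> B"
    using selfadjoint by (simp add: selfadjoint_def)
  then show "y \<in> D" "b y = z"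
    by (simp_all add: B_iff)
qed

lemma b_closed:
  assumes "\<And>n::nat. x n \<in> D" "x \<longlonglongrightarrow> p" "(\<lambda>n. b (x n)) \<longlonglongrightarrow> q"
  shows "p \<in> D" "b p = q"
proof -
  have "(p, q) \<in> B"
  proof (rule closed_sequentially[OF closed_B])
    show "(x n, b (x n)) \<in> B" for n
      using assms(1) by (simp add: B_iff)
    show "(\<lambda>n. (x n, b (x n))) \<longlonglongrightarrow> (p, q)"
      by (rule tendsto_Pair[OF assms(2,3)])
  qed
  then show "p \<in> D" "b p = q"
    by (simp_all add: B_iff)
qed

lemma b_nonneg: "x \<in> D \<Longrightarrow> 0 \<le> x \<bullet> b x"
  using nonnegative B_iff[of x "b x"] unfolding nonnegative_def inner_eq_Re_cinner by auto

lemma norm_le_one_plus_b: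
  assumes "x \<in> D"
  shows "norm x \<le> norm (x + b x)"
proof -
  have "(norm x)\<^sup>2 \<le> (norm (x + b x))\<^sup>2"
    unfolding power2_norm_eq_inner using b_nonneg[OF assms] inner_ge_zero[of "b x"]
    by (simp add: inner_add_left inner_add_right inner_commute[of "b x" x])
  then show ?thesis
    by (rule power2_le_imp_le) simp
qed

text \<open>Nonnegativity supplies the lower bound. A vector orthogonal to the range lies in
  \<open>D\<close> with \<open>b y = - y\<close>, and nonnegativity forces it to vanish.\<close>

lemma one_plus_b_onto: "\<exists>x\<in>D. x + b x = y"
proof -
  have "(\<lambda>x. x + b x) ` D = UNIV"
  proof (rule closed_operator_onto[of _ _ 1])
    show "closed ((\<lambda>x. (x, x + b x)) ` D)"
      unfolding closed_sequential_limits
    proof (intro allI impI)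
      fix f l assume f: "(\<forall>n. f n \<in> (\<lambda>x. (x, x + b x)) ` D) \<and> f \<longlonglongrightarrow> l"
      then have "fst (f n) \<in> D" "snd (f n) = fst (f n) + b (fst (f n))" for n
        by (metis (no_types, lifting) fst_conv snd_conv imageE)+
      moreover have lim: "(\<lambda>n. fst (f n)) \<longlonglongrightarrow> fst l" "(\<lambda>n. snd (f n)) \<longlonglongrightarrow> snd l"
        using f by (auto intro: tendsto_fst tendsto_snd)
      moreover have "(\<lambda>n. snd (f n) - fst (f n)) \<longlonglongrightarrow> snd l - fst l"
        by (intro tendsto_diff lim)
      ultimately have "fst l \<in> D" "b (fst l) = snd l - fst l"
        using b_closed[of "\<lambda>n. fst (f n)" "fst l" "snd l - fst l"] by simp_all
      then show "l \<in> (\<lambda>x. (x, x + b x)) ` D"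
        by (intro image_eqI[of _ _ "fst l"]) (auto simp: prod_eq_iff)
    qed
  next
    fix y assume "\<And>x. x \<in> D \<Longrightarrow> y \<bullet> (x + b x) = 0"
    then have "y \<bullet> b x = (- y) \<bullet> x" if "x \<in> D" for x
      using that by (simp add: inner_add_right eq_neg_iff_add_eq_0 add.commute)
    from b_adjI[OF this] have "y \<in> D" "b y = - y"
      by blast+
    then have "0 \<le> - (y \<bullet> y)"
      using b_nonneg[of y] by simp
    then show "y = 0"
      by (metis inner_eq_zero_iff inner_ge_zero neg_0_le_iff_le order_antisym)
  qed (simp_all add: subspace_D b_add b_scaleR norm_le_one_plus_b algebra_simps)
  then show ?thesis
    by (metis UNIV_I imageE)
qed

text \<open>With \<open>P = (1 + B)^-1\<close>, the operator \<open>R P\<close> is everywhere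
  defined, and for \<open>y\<close> in the dense domain of \<open>adj R\<close> the pairing
  \<open>y \<bullet> R (P x) = adj R y \<bullet> P x\<close> is continuous in \<open>x\<close>.
  Hence \<open>R P\<close> is bounded, and \<open>x = P (x + b x)\<close> on
  \<open>D\<close>.\<close>

lemma relatively_bounded:
  fixes R :: "('a, 'c::complex_inner) graph"
  assumes lin_R: "linear_operator R" and "D \<subseteq> Domain R"
    and dense_adj: "closure (Domain (adj R)) = UNIV"
  obtains K where "0 \<le> K" "\<And>x. x \<in> D \<Longrightarrow> norm (op_fun R x) \<le> K * (norm x + norm (b x))"
proof -
  obtain P where P: "\<And>y. P y \<in> D" "\<And>y. P y + b (P y) = y"
    using one_plus_b_onto by metis
  have P_eqI: "P y = x" if "x \<in> D" "x + b x = y" for x y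
  proof -
    have "norm (P y - x) \<le> norm ((P y - x) + b (P y - x))"
      using P that by (intro norm_le_one_plus_b D_diff) auto
    also have "(P y - x) + b (P y - x) = (P y + b (P y)) - (x + b x)"
      using P(1) that(1) by (simp add: b_diff)
    finally show ?thesis
      unfolding P(2) using that(2) by simp
  qed
  have P_add: "P (x + y) = P x + P y" for x y
  proof (rule P_eqI)
    have "P x + P y + b (P x + P y) = (P x + b (P x)) + (P y + b (P y))"
      using P(1) by (simp add: b_add)
    then show "P x + P y + b (P x + P y) = x + y"
      by (simp only: P(2))
  qed (simp add: P D_add)
  have P_scale: "P (c *\<^sub>R x) = c *\<^sub>R P x" for c x
  proof (rule P_eqI)
    have "c *\<^sub>R P x + b (c *\<^sub>R P x) = c *\<^sub>R (P x + b (P x))"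
      using P(1) by (simp add: b_scaleR scaleR_add_right)
    then show "c *\<^sub>R P x + b (c *\<^sub>R P x) = c *\<^sub>R x"
      by (simp only: P(2))
  qed (simp add: P D_scaleR)
  have "norm (P x) \<le> norm x" for x
    using norm_le_one_plus_b[OF P(1)[of x]] P(2)[of x] by simp
  then have bl_P: "bounded_linear P"
    by (intro bounded_linear_intro[of _ 1]) (simp_all add: P_add P_scale)
  have PR: "P x \<in> Domain R" for x
    using P(1) assms(2) by blast
  have "bounded_linear (\<lambda>x. op_fun R (P x))"
  proof (rule bounded_linear_of_dense_weak_continuity[OF _ dense_adj])
    show "linear (\<lambda>x. op_fun R (P x))"
      by (rule linearI) (simp_all add: P_add P_scale linear_operator_Domain[OF lin_R] op_fun_scaleR[OF lin_R] PR)
    fix y assume "y \<in> Domain (adj R)"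
    then obtain z where z: "(y, z) \<in> adj R"
      by blast
    have "y \<bullet> op_fun R (P x) = z \<bullet> P x" for x
      using inner_adj[OF _ z] op_fun_iff[OF lin_R] PR by blast
    then show "continuous_on UNIV (\<lambda>x. y \<bullet> op_fun R (P x))"
      by (simp add: continuous_intros bounded_linear.continuous_on[OF bl_P])
  qed
  then obtain K where K: "0 \<le> K" "\<And>x. norm (op_fun R (P x)) \<le> norm x * K"
    using bounded_linear.nonneg_bounded by blast
  show thesis
  proof (rule that[OF K(1)])
    fix x assume "x \<in> D"
    then have "norm (op_fun R x) \<le> norm (x + b x) * K"
      using K(2)[of "x + b x"] P_eqI[of x "x + b x"] by simp
    also have "\<dots> \<le> K * (norm x + norm (b x))"
      unfolding mult.commute[of _ K] by (rule mult_left_mono[OF norm_triangle_ineq K(1)])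
    finally show "norm (op_fun R x) \<le> K * (norm x + norm (b x))" .
  qed
qed

text \<open>
  A Lax--Milgram statement for the form \<open>\<langle>B u, B f\<rangle> + \<langle>u, E f\<rangle>\<close> on the domain of \<open>B\<close>, written as a first
  order system so that the right-hand side \<open>B k + h\<close> makes sense for all \<open>k\<close>.
\<close>

lemma coercive_bound:
  assumes c: "0 < c"
    and coercive: "\<And>f. f \<in> D \<Longrightarrow> c * ((norm f)\<^sup>2 + (norm (b f))\<^sup>2) \<le> f \<bullet> E f + (norm (b f))\<^sup>2"
    and fg: "f \<in> D" "g \<in> D"
  shows "norm (f, b f) \<le> norm (b g + E f, b f - g) / c"
proof -
  have "c * (norm (f, b f))\<^sup>2 \<le> f \<bullet> E f + (norm (b f))\<^sup>2"
    using coercive[OF fg(1)] by (simp add: norm_Pair)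
  \<comment> \<open>Testing with \<open>(f, b f)\<close> cancels the terms in \<open>g\<close> by
    symmetry of \<open>b\<close>.\<close>
  also have "\<dots> = (f, b f) \<bullet> (b g + E f, b f - g)"
    using b_sym[OF fg] by (simp add: inner_add_right inner_diff_right power2_norm_eq_inner)
  also have "\<dots> \<le> norm (f, b f) * norm (b g + E f, b f - g)"
    by (rule norm_cauchy_schwarz)
  finally have "norm (f, b f) * (c * norm (f, b f)) \<le> norm (f, b f) * norm (b g + E f, b f - g)"
    by (simp add: power2_eq_square mult.left_commute)
  then have "c * norm (f, b f) \<le> norm (b g + E f, b f - g)"
    using norm_ge_zero[of "(f, b f)"] norm_ge_zero[of "(b g + E f, b f - g)"]
    by (metis less_eq_real_def mult_le_cancel_left_pos mult_zero_right)
  then show ?thesis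
    using c by (simp add: pos_le_divide_eq mult.commute)
qed

text \<open>Eliminating \<open>g = b f - k\<close> gives formally
  \<open>B^2 f + E f = h + B k\<close>, but the system asks nothing of \<open>k\<close>. Coercivity
  bounds \<open>f\<close> and \<open>b f\<close>, hence \<open>g\<close>; the relative bound on
  \<open>E\<close> makes the system closed.\<close>

lemma coercive_onto:
  assumes c: "0 < c"
    and coercive: "\<And>f. f \<in> D \<Longrightarrow> c * ((norm f)\<^sup>2 + (norm (b f))\<^sup>2) \<le> f \<bullet> E f + (norm (b f))\<^sup>2"
    and E_add: "\<And>x y. x \<in> D \<Longrightarrow> y \<in> D \<Longrightarrow> E (x + y) = E x + E y"
    and E_scale: "\<And>r x. x \<in> D \<Longrightarrow> E (r *\<^sub>R x) = r *\<^sub>R E x"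
    and E_bound: "\<And>x. x \<in> D \<Longrightarrow> norm (E x) \<le> K * (norm x + norm (b x))"
  obtains f g where "f \<in> D" "g \<in> D" "b g + E f = h" "b f - g = k"
proof -
  define N where "N p = (b (snd p) + E (fst p), b (fst p) - snd p)" for p
  have E_0: "E 0 = 0"
    using E_scale[OF D_0, of 0] by simp
  have E_diff: "E (x - y) = E x - E y" if "x \<in> D" "y \<in> D" for x y
    using E_add[of x "(- 1) *\<^sub>R y"] E_scale[of y "- 1"] that D_scaleR[of y "- 1"] by simp
  have "N ` (D \<times> D) = UNIV"
  proof (rule closed_operator_onto)
    show "subspace (D \<times> D)"
      by (intro subspace_Times subspace_D)
    show "N (x + y) = N x + N y" if "x \<in> D \<times> D" "y \<in> D \<times> D" for x y
      using that by (auto simp: N_def b_add E_add)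
    show "N (r *\<^sub>R x) = r *\<^sub>R N x" if "x \<in> D \<times> D" for r x
      using that by (auto simp: N_def b_scaleR E_scale scaleR_add_right scaleR_diff_right)
    \<comment> \<open>Each of \<open>f\<close> and \<open>b f\<close> costs
      \<open>norm (N p) / c\<close>, and \<open>g = b f - (b f - g)\<close> adds one more
      \<open>norm (N p)\<close>.\<close>
    show "norm p \<le> (2 / c + 1) * norm (N p)" if pD: "p \<in> D \<times> D" for p
    proof -
      obtain f g where p: "p = (f, g)" "f \<in> D" "g \<in> D"
        using pD by auto
      have "norm (f, b f) \<le> norm (N p) / c"
        using coercive_bound[OF c coercive p(2,3)] by (simp add: N_def p(1))
      moreover have "norm f \<le> norm (f, b f)" "norm (b f) \<le> norm (f, b f)"
        by (rule norm_fst_le norm_snd_le)+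
      moreover have "norm g \<le> norm (b f) + norm (b f - g)"
        using norm_triangle_ineq4[of "b f" "b f - g"] by simp
      moreover have "norm (b f - g) \<le> norm (N p)"
        using norm_snd_le[of "b f - g" "b g + E f"] by (simp add: N_def p(1))
      moreover have "norm p \<le> norm f + norm g"
        unfolding p(1) by (rule norm_Pair_le)
      ultimately have "norm p \<le> 2 * (norm (N p) / c) + norm (N p)"
        by linarith
      then show ?thesis
        by (simp add: algebra_simps)
    qed
    show "closed ((\<lambda>p. (p, N p)) ` (D \<times> D))"
      unfolding closed_sequential_limits
    proof (intro allI impI)
      fix q l assume q: "(\<forall>n. q n \<in> (\<lambda>p. (p, N p)) ` (D \<times> D)) \<and> q \<longlonglongrightarrow> l"
      define f g where "f n = fst (fst (q n))" and "g n = snd (fst (q n))" for n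
      have fgD: "f n \<in> D" "g n \<in> D" and sndq: "snd (q n) = N (f n, g n)" for n
        using q unfolding f_def g_def by (metis (no_types, lifting) fst_conv snd_conv imageE mem_Sigma_iff prod.collapse)+
      have lim: "f \<longlonglongrightarrow> fst (fst l)" "g \<longlonglongrightarrow> snd (fst l)"
        "(\<lambda>n. snd (q n)) \<longlonglongrightarrow> snd l"
        using q unfolding f_def g_def by (auto intro: tendsto_fst tendsto_snd)
      have limN: "(\<lambda>n. b (g n) + E (f n)) \<longlonglongrightarrow> fst (snd l)" "(\<lambda>n. b (f n) - g n) \<longlonglongrightarrow> snd (snd l)"
        using tendsto_fst[OF lim(3)] tendsto_snd[OF lim(3)] unfolding sndq N_def by simp_all
      have bf: "(\<lambda>n. b (f n)) \<longlonglongrightarrow> snd (snd l) + snd (fst l)"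
        using tendsto_add[OF limN(2) lim(2)] by simp
      have fl: "fst (fst l) \<in> D" "b (fst (fst l)) = snd (snd l) + snd (fst l)"
        using b_closed[OF fgD(1) lim(1) bf] by auto
      have "(\<lambda>n. E (f n) - E (fst (fst l))) \<longlonglongrightarrow> 0"
      proof (rule Lim_null_comparison)
        show "\<forall>\<^sub>F n in sequentially. norm (E (f n) - E (fst (fst l)))
            \<le> K * (norm (f n - fst (fst l)) + norm (b (f n) - b (fst (fst l))))"
          using E_bound[OF D_diff[OF fgD(1) fl(1)]] by (simp add: E_diff b_diff fgD fl(1))
        have "(\<lambda>n. K * (norm (f n - fst (fst l)) + norm (b (f n) - b (fst (fst l)))))
            \<longlonglongrightarrow> K * (norm (fst (fst l) - fst (fst l)) + norm (b (fst (fst l)) - b (fst (fst l))))"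
          using bf unfolding fl(2)[symmetric] by (intro tendsto_intros lim)
        then show "(\<lambda>n. K * (norm (f n - fst (fst l)) + norm (b (f n) - b (fst (fst l))))) \<longlonglongrightarrow> 0"
          by simp
      qed
      then have "(\<lambda>n. E (f n)) \<longlonglongrightarrow> E (fst (fst l))"
        by (rule LIM_zero_cancel)
      from tendsto_diff[OF limN(1) this]
      have "(\<lambda>n. b (g n)) \<longlonglongrightarrow> fst (snd l) - E (fst (fst l))"
        by simp
      from b_closed[OF fgD(2) lim(2) this]
      have "snd (fst l) \<in> D" "b (snd (fst l)) = fst (snd l) - E (fst (fst l))"
        by auto
      with fl show "l \<in> (\<lambda>p. (p, N p)) ` (D \<times> D)"
        by (intro image_eqI[of _ _ "fst l"]) (auto simp: N_def prod_eq_iff mem_Times_iff)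
    qed
  next
    fix y assume y: "\<And>p. p \<in> D \<times> D \<Longrightarrow> y \<bullet> N p = 0"
    \<comment> \<open>Testing with \<open>f = 0\<close> places \<open>fst y\<close> in
      \<open>D\<close> with \<open>b (fst y) = snd y\<close>; testing with \<open>g = 0\<close> then
      gives the form at \<open>fst y\<close>, where coercivity applies.\<close>
    have "fst y \<bullet> b g = snd y \<bullet> g" if "g \<in> D" for g
      using y[of "(0, g)"] that by (simp add: N_def D_0 b_0 E_0 inner_prod_def)
    from b_adjI[OF this] have u: "fst y \<in> D" "b (fst y) = snd y"
      by blast+
    have "fst y \<bullet> E (fst y) + (norm (b (fst y)))\<^sup>2 = 0"
      using y[of "(fst y, 0)"] u by (simp add: N_def D_0 b_0 inner_prod_def power2_norm_eq_inner)
    with coercive[OF u(1)] have "c * ((norm (fst y))\<^sup>2 + (norm (b (fst y)))\<^sup>2) \<le> 0"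
      by simp
    then have "(norm (fst y))\<^sup>2 + (norm (b (fst y)))\<^sup>2 \<le> 0"
      using c by (simp add: mult_le_0_iff)
    then have "fst y = 0"
      using zero_le_power2[of "norm (fst y)"] zero_le_power2[of "norm (b (fst y))"]
      by (metis add_nonneg_eq_0_iff norm_eq_zero order_antisym add_nonneg_nonneg zero_eq_power2)
    with u show "y = 0"
      by (simp add: prod_eq_iff b_0)
  qed
  then obtain p where "p \<in> D \<times> D" "N p = (h, k)"
    by (metis UNIV_I imageE)
  then show thesis
    by (intro that[of "fst p" "snd p"]) (auto simp: N_def)
qed

end


section \<open>The block operator and its pencil\<close>

lemma mem_diff_scale_Id_iff:
  fixes T :: "('a::complex_inner, 'a) graph"
  shows "(x, y) \<in> T -\<^sub>o z \<cdot>\<^sub>o Id \<longleftrightarrow> (x, y + z *\<^sub>C x) \<in> T"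
proof -
  have "(x, y) \<in> T -\<^sub>o z \<cdot>\<^sub>o Id \<longleftrightarrow> (\<exists>w. (x, w) \<in> T \<and> y = w - z *\<^sub>C x)"
    by (auto simp: diff_op_def scale_op_def)
  then show ?thesis
    by (metis add_diff_cancel_right' diff_add_cancel)
qed

lemma linear_operator_diff_scale_Id:
  assumes "linear_operator T"
  shows "linear_operator (T -\<^sub>o z \<cdot>\<^sub>o Id)"
proof (rule linear_operatorI)
  show "(0, 0) \<in> T -\<^sub>o z \<cdot>\<^sub>o Id"
    using linear_operator_zero[OF assms] by (simp add: mem_diff_scale_Id_iff)
  show "(x + x', y + y') \<in> T -\<^sub>o z \<cdot>\<^sub>o Id"
    if "(x, y) \<in> T -\<^sub>o z \<cdot>\<^sub>o Id" "(x', y') \<in> T -\<^sub>o z \<cdot>\<^sub>o Id" for x y x' y'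
    using linear_operator_add[OF assms that[unfolded mem_diff_scale_Id_iff]] by (simp add: mem_diff_scale_Id_iff scaleC_add_right ac_simps)
  show "(a *\<^sub>C x, a *\<^sub>C y) \<in> T -\<^sub>o z \<cdot>\<^sub>o Id" if "(x, y) \<in> T -\<^sub>o z \<cdot>\<^sub>o Id" for a x y
    using linear_operator_scaleC[OF assms that[unfolded mem_diff_scale_Id_iff], of a]
    by (simp add: mem_diff_scale_Id_iff scaleC_add_right scaleC_scaleC mult.commute)
  show "y = y'" if "(x, y) \<in> T -\<^sub>o z \<cdot>\<^sub>o Id" "(x, y') \<in> T -\<^sub>o z \<cdot>\<^sub>o Id" for x y y'
    using linear_operator_unique[OF assms that[unfolded mem_diff_scale_Id_iff]] by simp
qed

locale operator_pencil = nonnegative_selfadjoint B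
  for B :: "('a::chilbert_space, 'a) graph" +
  fixes R :: "('a, 'a) graph"
  assumes injective: "(x, 0) \<in> B \<Longrightarrow> x = 0"
    and lin_R: "linear_operator R"
    and Domain_R: "Domain B \<subseteq> Domain R"
    and Domain_adj_R: "Domain B \<subseteq> Domain (adj R)"
begin

definition r where "r = op_fun R"

lemma R_iff: "x \<in> D \<Longrightarrow> (x, y) \<in> R \<longleftrightarrow> y = r x"
  using op_fun_iff[OF lin_R] Domain_R unfolding r_def D_def by blast

lemma r_add: "x \<in> D \<Longrightarrow> y \<in> D \<Longrightarrow> r (x + y) = r x + r y"
  and r_scaleC: "x \<in> D \<Longrightarrow> r (a *\<^sub>C x) = a *\<^sub>C r x"
  using linear_operator_Domain(5,6)[OF lin_R] Domain_R unfolding r_def D_def by (meson subsetD)+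

lemma r_scaleR: "x \<in> D \<Longrightarrow> r (c *\<^sub>R x) = c *\<^sub>R r x"
  by (simp add: scaleR_scaleC r_scaleC)

lemma r_0: "r 0 = 0"
  using r_scaleC[OF D_0, of 0] by simp

text \<open>The hypothesis on \<open>adj R\<close> enters here: its domain contains the dense
  \<open>D\<close>, so it is densely defined.\<close>

lemma r_bound: obtains K where "0 \<le> K" "\<And>x. x \<in> D \<Longrightarrow> norm (r x) \<le> K * (norm x + norm (b x))"
proof (rule relatively_bounded[OF lin_R])
  show "D \<subseteq> Domain R"
    using Domain_R by (simp add: D_def)
  show "closure (Domain (adj R)) = UNIV"
    using dense_D closure_mono[OF Domain_adj_R] unfolding D_def by auto
qed (use that r_def in auto)

definition Q where "Q = block_op ((- \<i>) \<cdot>\<^sub>o R) B B zero_op"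

definition M where "M z = (B \<circ>\<^sub>o B) -\<^sub>o (\<i> * z) \<cdot>\<^sub>o R -\<^sub>o z\<^sup>2 \<cdot>\<^sub>o Id"

lemma Q_iff: "((f, g), (h, k)) \<in> Q \<longleftrightarrow> f \<in> D \<and> g \<in> D \<and> h = - (\<i> *\<^sub>C r f) + b g \<and> k = b f"
proof -
  have "((f, g), (h, k)) \<in> Q \<longleftrightarrow> (\<exists>u. (f, u) \<in> R \<and> f \<in> D \<and> g \<in> D \<and> h = - (\<i> *\<^sub>C u) + b g \<and> k = b f)"
    unfolding Q_def block_op_def scale_op_def zero_op_def B_iff by auto
  then show ?thesis
    using R_iff by auto
qed

lemma Q_shift_iff:
  "((f, g), (h, k)) \<in> Q -\<^sub>o z \<cdot>\<^sub>o Id \<longleftrightarrow>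
    f \<in> D \<and> g \<in> D \<and> h = - (\<i> *\<^sub>C r f) + b g - z *\<^sub>C f \<and> k = b f - z *\<^sub>C g"
  by (auto simp: diff_op_def scale_op_def scaleC_prod_def Q_iff)

lemma M_iff:
  "(f, h) \<in> M z \<longleftrightarrow> f \<in> D \<and> b f \<in> D \<and> h = b (b f) - (\<i> * z) *\<^sub>C r f - z\<^sup>2 *\<^sub>C f"
proof -
  have "(f, h) \<in> M z \<longleftrightarrow> (\<exists>u. (f, u) \<in> R \<and> f \<in> D \<and> b f \<in> D \<and> h = b (b f) - (\<i> * z) *\<^sub>C u - z\<^sup>2 *\<^sub>C f)"
    unfolding M_def diff_op_def scale_op_def comp_op_def relcomp_unfold B_iff by auto
  then show ?thesis
    using R_iff by auto
qed

lemma lin_Q: "linear_operator Q"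
proof (rule linear_operatorI)
  show "(0, 0) \<in> Q"
    by (simp add: zero_prod_def Q_iff D_0 r_0 b_0)
  show "(x + x', y + y') \<in> Q" if "(x, y) \<in> Q" "(x', y') \<in> Q" for x y x' y'
    using that by (cases x; cases y; cases x'; cases y')
      (auto simp: Q_iff D_add r_add b_add scaleC_add_right)
  show "(a *\<^sub>C x, a *\<^sub>C y) \<in> Q" if "(x, y) \<in> Q" for a x y
    using that by (cases x; cases y)
      (auto simp: Q_iff scaleC_prod_def D_scaleC r_scaleC b_scaleC scaleC_diff_right scaleC_add_right scaleC_scaleC mult.commute)
  show "y = y'" if "(x, y) \<in> Q" "(x, y') \<in> Q" for x y y'
    using that by (cases x; cases y; cases y') (auto simp: Q_iff)
qed

lemma lin_M: "linear_operator (M z)"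
proof (rule linear_operatorI)
  show "(0, 0) \<in> M z"
    by (simp add: M_iff D_0 r_0 b_0)
  show "(x + x', y + y') \<in> M z" if "(x, y) \<in> M z" "(x', y') \<in> M z" for x y x' y'
    using that by (auto simp: M_iff D_add r_add b_add scaleC_add_right)
  show "(a *\<^sub>C x, a *\<^sub>C y) \<in> M z" if "(x, y) \<in> M z" for a x y
    using that by (auto simp: M_iff D_scaleC r_scaleC b_scaleC scaleC_diff_right scaleC_scaleC mult.commute)
  show "y = y'" if "(x, y) \<in> M z" "(x, y') \<in> M z" for x y y'
    using that by (auto simp: M_iff)
qed

lemma b_inj: "x \<in> D \<Longrightarrow> b x = 0 \<Longrightarrow> x = 0"
  using injective B_iff by metis

lemma injective_Q: "injective_operator Q"
  unfolding injective_operator_def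
proof (intro allI impI)
  fix x x' y assume "(x, y) \<in> Q" "(x', y) \<in> Q"
  then have "(x - x', 0) \<in> Q"
    using linear_operator_diff[OF lin_Q, of x y x' y] by simp
  moreover obtain u v where uv: "x - x' = (u, v)"
    by (cases "x - x'")
  ultimately have Q: "((u, v), (0, 0)) \<in> Q"
    by (simp only: zero_prod_def)
  then have "u \<in> D" "b u = 0"
    by (simp_all only: Q_iff)
  then have "u = 0"
    by (rule b_inj)
  with Q have "v \<in> D" "b v = 0"
    by (simp_all add: Q_iff r_0)
  then have "v = 0"
    by (rule b_inj)
  with uv \<open>u = 0\<close> have "x - x' = 0"
    by (simp add: zero_prod_def)
  then show "x = x'"
    by simp
qed

text \<open>The second row controls \<open>b (f n)\<close>, so the relative bound makes
  \<open>r (f n)\<close> converge; the first row then controls \<open>b (g n)\<close>. Closedness of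
  \<open>B\<close> handles both components.\<close>

lemma closed_Q: "closed_operator Q"
proof -
  obtain K where K: "0 \<le> K" "\<And>x. x \<in> D \<Longrightarrow> norm (r x) \<le> K * (norm x + norm (b x))"
    using r_bound by blast
  have "closed Q"
    unfolding closed_sequential_limits
  proof (intro allI impI)
    fix q l assume q: "(\<forall>n. q n \<in> Q) \<and> q \<longlonglongrightarrow> l"
    define f g h k where "f n = fst (fst (q n))" and "g n = snd (fst (q n))"
      and "h n = fst (snd (q n))" and "k n = snd (snd (q n))" for n
    obtain f0 g0 h0 k0 where l: "l = ((f0, g0), (h0, k0))"
      by (metis prod.collapse)
    have "((f n, g n), (h n, k n)) \<in> Q" for n
      using q by (simp add: f_def g_def h_def k_def)
    then have Q: "f n \<in> D" "g n \<in> D" "h n = - (\<i> *\<^sub>C r (f n)) + b (g n)" "k n = b (f n)" for n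
      unfolding Q_iff by blast+
    have "q \<longlonglongrightarrow> l"
      using q by blast
    note lims = tendsto_fst[OF tendsto_fst[OF this]] tendsto_snd[OF tendsto_fst[OF this]]
      tendsto_fst[OF tendsto_snd[OF this]] tendsto_snd[OF tendsto_snd[OF this]]
    have lim: "f \<longlonglongrightarrow> f0" "g \<longlonglongrightarrow> g0" "h \<longlonglongrightarrow> h0" "k \<longlonglongrightarrow> k0"
      using lims unfolding l f_def g_def h_def k_def by simp_all
    have limb: "(\<lambda>n. b (f n)) \<longlonglongrightarrow> k0"
      using lim(4) unfolding tendsto_def Q(4) .
    have f0: "f0 \<in> D" "b f0 = k0"
      using b_closed[OF Q(1) lim(1) limb] by auto
    have "(\<lambda>n. r (f n) - r f0) \<longlonglongrightarrow> 0"
    proof (rule Lim_null_comparison)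
      have "r (f n) - r f0 = r (f n - f0)" for n
        using r_add[of "f n - f0" f0] D_diff[OF Q(1) f0(1)] f0(1) by simp
      then show "\<forall>\<^sub>F n in sequentially. norm (r (f n) - r f0) \<le> K * (norm (f n - f0) + norm (b (f n) - b f0))"
        using K(2)[OF D_diff[OF Q(1) f0(1)]] by (simp add: b_diff Q(1) f0(1))
      have "(\<lambda>n. K * (norm (f n - f0) + norm (b (f n) - b f0))) \<longlonglongrightarrow> K * (norm (f0 - f0) + norm (b f0 - b f0))"
        using limb unfolding f0(2)[symmetric] by (intro tendsto_intros lim)
      then show "(\<lambda>n. K * (norm (f n - f0) + norm (b (f n) - b f0))) \<longlonglongrightarrow> 0"
        by simp
    qed
    then have "(\<lambda>n. r (f n)) \<longlonglongrightarrow> r f0"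
      by (rule LIM_zero_cancel)
    then have "(\<lambda>n. h n + \<i> *\<^sub>C r (f n)) \<longlonglongrightarrow> h0 + \<i> *\<^sub>C r f0"
      by (intro tendsto_add lim bounded_linear.tendsto[OF bounded_linear_scaleC])
    then have "(\<lambda>n. b (g n)) \<longlonglongrightarrow> h0 + \<i> *\<^sub>C r f0"
      by (simp add: Q(3))
    from b_closed[OF Q(2) lim(2) this] f0 show "l \<in> Q"
      by (simp add: l Q_iff)
  qed
  then show ?thesis
    by (simp add: closed_operator_def lin_Q)
qed

section \<open>Invertibility of the block operator and of the pencil\<close>

lemma Q_inverse_bounded_iff: "(Q -\<^sub>o z \<cdot>\<^sub>o Id)\<inverse> \<in> bounded_operators \<longleftrightarrow> boundedly_invertible (Q -\<^sub>o z \<cdot>\<^sub>o Id)"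
  by (rule converse_bounded_operators_iff[OF linear_operator_diff_scale_Id[OF lin_Q]])

lemma M_inverse_bounded_iff: "(M z)\<inverse> \<in> bounded_operators \<longleftrightarrow> boundedly_invertible (M z)"
  by (rule converse_bounded_operators_iff[OF lin_M])

text \<open>For right-hand sides \<open>(h, 0)\<close> the elimination is exact: the second row is
  \<open>b f = z g\<close>, which puts \<open>b f\<close> into \<open>D\<close>.\<close>

lemma M_of_Q:
  assumes z: "z \<noteq> 0" and Q: "((f, g), (h, 0)) \<in> Q -\<^sub>o z \<cdot>\<^sub>o Id"
  shows "(f, z *\<^sub>C h) \<in> M z" "b f = z *\<^sub>C g"
proof -
  have fg: "f \<in> D" "g \<in> D" "h = - (\<i> *\<^sub>C r f) + b g - z *\<^sub>C f" "b f = z *\<^sub>C g"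
    using Q unfolding Q_shift_iff by auto
  then show "(f, z *\<^sub>C h) \<in> M z" "b f = z *\<^sub>C g"
    by (auto simp: M_iff D_scaleC b_scaleC scaleC_diff_right scaleC_add_right scaleC_scaleC
        power2_eq_square mult.commute)
qed

lemma Q_of_M:
  assumes z: "z \<noteq> 0" and M: "(f, h) \<in> M z"
  shows "((f, inverse z *\<^sub>C b f), (inverse z *\<^sub>C h, 0)) \<in> Q -\<^sub>o z \<cdot>\<^sub>o Id"
proof -
  have inv: "inverse z * (a * z) = a" for a
    using z by simp
  with M z show ?thesis
    by (auto simp: inv Q_shift_iff M_iff D_scaleC b_scaleC scaleC_diff_right scaleC_add_right scaleC_scaleC
        power2_eq_square)
qed

lemma boundedly_invertible_M_of_Q:
  assumes z: "z \<noteq> 0" and bdd: "boundedly_invertible (Q -\<^sub>o z \<cdot>\<^sub>o Id)"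
  shows "boundedly_invertible (M z)"
  unfolding boundedly_invertible_def
proof
  show "\<forall>y. \<exists>x. (x, y) \<in> M z"
  proof
    fix y
    obtain p where "(p, (inverse z *\<^sub>C y, 0)) \<in> Q -\<^sub>o z \<cdot>\<^sub>o Id"
      using bdd unfolding boundedly_invertible_def by blast
    then have "(fst p, z *\<^sub>C inverse z *\<^sub>C y) \<in> M z"
      using M_of_Q(1)[OF z, of "fst p" "snd p"] by simp
    then show "\<exists>x. (x, y) \<in> M z"
      using z by (auto simp: scaleC_scaleC)
  qed
  obtain K where K: "\<And>x y. (x, y) \<in> Q -\<^sub>o z \<cdot>\<^sub>o Id \<Longrightarrow> norm x \<le> K * norm y"
    using bdd unfolding boundedly_invertible_def by blast
  have "norm f \<le> (K * cmod (inverse z)) * norm h" if "(f, h) \<in> M z" for f h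
  proof -
    have "norm f \<le> norm (f, inverse z *\<^sub>C b f)"
      by (rule norm_fst_le)
    also have "\<dots> \<le> K * norm (inverse z *\<^sub>C h, 0::'a)"
      by (rule K[OF Q_of_M[OF z that]])
    finally show ?thesis
      by (simp add: norm_Pair norm_scaleC mult.assoc)
  qed
  then show "\<exists>K. \<forall>x y. (x, y) \<in> M z \<longrightarrow> norm x \<le> K * norm y"
    by blast
qed

text \<open>
  Shift the pencil by a large \<open>t\<close> to make its form coercive, so that the shifted system can be solved
  for all right-hand sides; the shift is then undone by \<open>M(z)\<^sup>-\<^sup>1\<close>.
\<close>

lemma boundedly_invertible_Q_of_M:
  assumes z: "z \<noteq> 0" and bdd: "boundedly_invertible (M z)"
  shows "boundedly_invertible (Q -\<^sub>o z \<cdot>\<^sub>o Id)"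
proof -
  obtain K where K: "0 \<le> K" "\<And>x. x \<in> D \<Longrightarrow> norm (r x) \<le> K * (norm x + norm (b x))"
    using r_bound by blast
  obtain L where L: "\<And>x y. (x, y) \<in> M z \<Longrightarrow> norm x \<le> L * norm y"
    using bdd unfolding boundedly_invertible_def by blast
  define a where "a = cmod z * K"
  have a: "0 \<le> a"
    using K(1) by (simp add: a_def)
  \<comment> \<open>The summands absorb, in order, the part \<open>a (norm f)^2\<close> of the
    \<open>R\<close> term, its mixed part after Young's inequality, and the \<open>z^2\<close> term;
    the last \<open>1 / 2\<close> is the coercivity that remains, matched by half of
    \<open>(norm (b f))^2\<close>.\<close>
  define t where "t = a + a\<^sup>2 / 2 + (cmod z)\<^sup>2 + 1 / 2"
  have t: "0 \<le> t"
    using a by (simp add: t_def)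
  define E where "E f = - ((\<i> * z) *\<^sub>C r f) + t *\<^sub>R f - z\<^sup>2 *\<^sub>C f" for f
  have E_add: "E (x + y) = E x + E y" if "x \<in> D" "y \<in> D" for x y
    using that by (simp add: E_def r_add scaleC_add_right scaleR_add_right)
  have E_scale: "E (c *\<^sub>R x) = c *\<^sub>R E x" if "x \<in> D" for c x
    using that by (simp add: E_def r_scaleR scaleC_scaleR_commute scaleR_add_right scaleR_diff_right)
  have norm_r: "norm ((\<i> * z) *\<^sub>C r f) \<le> a * (norm f + norm (b f))" if "f \<in> D" for f
    using mult_left_mono[OF K(2)[OF that], of "cmod z"]
    by (simp add: norm_scaleC norm_mult a_def mult.assoc)
  have E_bound: "norm (E f) \<le> (a + t + (cmod z)\<^sup>2) * (norm f + norm (b f))" if "f \<in> D" for f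
  proof -
    have "norm (E f) \<le> norm ((\<i> * z) *\<^sub>C r f) + norm (t *\<^sub>R f) + norm (z\<^sup>2 *\<^sub>C f)"
      using norm_triangle_ineq4[of "- ((\<i> * z) *\<^sub>C r f) + t *\<^sub>R f" "z\<^sup>2 *\<^sub>C f"]
        norm_triangle_ineq[of "- ((\<i> * z) *\<^sub>C r f)" "t *\<^sub>R f"]
      unfolding E_def norm_minus_cancel by linarith
    also have "\<dots> \<le> a * (norm f + norm (b f)) + t * norm f + (cmod z)\<^sup>2 * norm f"
      using norm_r[OF that] t by (simp add: norm_scaleC norm_power)
    also have "\<dots> \<le> (a + t + (cmod z)\<^sup>2) * (norm f + norm (b f))"
      using t by (simp add: algebra_simps)
    finally show ?thesis .
  qed
  have coercive: "1 / 2 * ((norm f)\<^sup>2 + (norm (b f))\<^sup>2) \<le> f \<bullet> E f + (norm (b f))\<^sup>2" if "f \<in> D" for f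
  proof -
    have "f \<bullet> ((\<i> * z) *\<^sub>C r f) \<le> norm f * norm ((\<i> * z) *\<^sub>C r f)"
      by (rule norm_cauchy_schwarz)
    also have "\<dots> \<le> norm f * (a * (norm f + norm (b f)))"
      by (rule mult_left_mono[OF norm_r[OF that]]) simp
    finally have "f \<bullet> ((\<i> * z) *\<^sub>C r f) \<le> a * (norm f)\<^sup>2 + (a * norm f) * norm (b f)"
      by (simp add: algebra_simps power2_eq_square)
    moreover have "(a * norm f) * norm (b f) \<le> a\<^sup>2 / 2 * (norm f)\<^sup>2 + 1 / 2 * (norm (b f))\<^sup>2"
      using zero_le_power2[of "a * norm f - norm (b f)"] by (simp add: power2_eq_square algebra_simps)
    moreover have "f \<bullet> (z\<^sup>2 *\<^sub>C f) \<le> (cmod z)\<^sup>2 * (norm f)\<^sup>2"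
      unfolding inner_scaleC_self using complex_Re_le_cmod[of "z\<^sup>2"]
      by (intro mult_right_mono) (simp_all add: norm_power)
    moreover have "f \<bullet> E f = t * (norm f)\<^sup>2 - f \<bullet> ((\<i> * z) *\<^sub>C r f) - f \<bullet> (z\<^sup>2 *\<^sub>C f)"
      by (simp add: E_def inner_add_right inner_diff_right power2_norm_eq_inner)
    moreover have "t * (norm f)\<^sup>2 = a * (norm f)\<^sup>2 + a\<^sup>2 / 2 * (norm f)\<^sup>2 + (cmod z)\<^sup>2 * (norm f)\<^sup>2 + 1 / 2 * (norm f)\<^sup>2"
      by (simp add: t_def algebra_simps)
    ultimately show ?thesis
      by (simp only: distrib_left)
  qed
  have half: "0 < (1 / 2 :: real)"
    by simp
  have M_E: "(f, b (b f) + E f - t *\<^sub>R f) \<in> M z" if "f \<in> D" "b f \<in> D" for f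
    using that by (simp add: M_iff E_def)
  have E_diff: "E (x - y) = E x - E y" if "x \<in> D" "y \<in> D" for x y
    using E_add[of x "(- 1) *\<^sub>R y"] E_scale[of y "- 1"] that D_scaleR[of y "- 1"] by simp
  have solve: "\<exists>f g. ((f, g), (h, k)) \<in> Q -\<^sub>o z \<cdot>\<^sub>o Id" for h k
  proof -
    obtain f0 g0 where fg0: "f0 \<in> D" "g0 \<in> D" "b g0 + E f0 = z *\<^sub>C h" "b f0 - g0 = k"
      by (rule coercive_onto[OF half coercive E_add E_scale E_bound])
    \<comment> \<open>Formally \<open>M z f0 = z h + B k - t f0\<close>; adding \<open>f1\<close>
      with \<open>M z f1 = t f0\<close> supplies what is missing.\<close>
    obtain f1 where f1: "(f1, t *\<^sub>R f0) \<in> M z"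
      using bdd unfolding boundedly_invertible_def by blast
    then have f1D: "f1 \<in> D" "b f1 \<in> D"
      by (simp_all add: M_iff)
    have f1_eq: "b (b f1) + E f1 - t *\<^sub>R f1 = t *\<^sub>R f0"
      using linear_operator_unique[OF lin_M M_E[OF f1D] f1] .
    let ?g = "inverse z *\<^sub>C (g0 + b f1)"
    have "b (f0 + f1) - z *\<^sub>C ?g = k"
      using z fg0 f1D by (simp add: scaleC_scaleC b_add scaleC_add_right algebra_simps)
    moreover have "- (\<i> *\<^sub>C r (f0 + f1)) + b ?g - z *\<^sub>C (f0 + f1) = h"
    proof -
      have E': "E (f0 + f1) - t *\<^sub>R (f0 + f1) = z *\<^sub>C (- (\<i> *\<^sub>C r (f0 + f1)) - z *\<^sub>C (f0 + f1))"
        by (simp add: E_def scaleC_diff_right scaleC_scaleC power2_eq_square mult.commute)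
      have "z *\<^sub>C (- (\<i> *\<^sub>C r (f0 + f1)) + b ?g - z *\<^sub>C (f0 + f1))
          = z *\<^sub>C (- (\<i> *\<^sub>C r (f0 + f1)) - z *\<^sub>C (f0 + f1)) + z *\<^sub>C b ?g"
        by (simp add: scaleC_diff_right scaleC_add_right)
      also have "z *\<^sub>C b ?g = b g0 + b (b f1)"
        using z fg0 f1D by (simp add: b_scaleC D_add b_add scaleC_scaleC)
      also have "z *\<^sub>C (- (\<i> *\<^sub>C r (f0 + f1)) - z *\<^sub>C (f0 + f1)) + (b g0 + b (b f1))
          = (b g0 + E f0) + (b (b f1) + E f1 - t *\<^sub>R f1) - t *\<^sub>R f0"
        unfolding E'[symmetric] E_add[OF fg0(1) f1D(1)] by (simp add: algebra_simps)
      also have "\<dots> = z *\<^sub>C h"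
        unfolding f1_eq fg0(3) by simp
      finally have "inverse z *\<^sub>C z *\<^sub>C (- (\<i> *\<^sub>C r (f0 + f1)) + b ?g - z *\<^sub>C (f0 + f1)) = inverse z *\<^sub>C z *\<^sub>C h"
        by simp
      then show ?thesis
        by (simp only: scaleC_scaleC left_inverse[OF z] scaleC_one)
    qed
    ultimately have "((f0 + f1, ?g), (h, k)) \<in> Q -\<^sub>o z \<cdot>\<^sub>o Id"
      unfolding Q_shift_iff using fg0 f1D by (simp add: D_add D_scaleC)
    then show ?thesis
      by blast
  qed
  \<comment> \<open>The 2 inverts the coercivity constant, and \<open>cmod z + 1\<close> bounds
    \<open>norm (z h, k)\<close> by \<open>norm (h, k)\<close>. The constants \<open>C1\<close> and
    \<open>C2\<close> are for \<open>f\<close> and \<open>b f\<close>; then \<open>g\<close> is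
    recovered from \<open>b f = z g + k\<close>.\<close>
  define c where "c = 2 * (cmod z + 1)"
  define C1 where "C1 = (1 + \<bar>L\<bar> * t) * c"
  define C2 where "C2 = c + 2 * t * C1"
  have "norm (f, g) \<le> (C1 + (C2 + 1) / cmod z) * norm (h, k)" if "((f, g), (h, k)) \<in> Q -\<^sub>o z \<cdot>\<^sub>o Id" for f g h k
  proof -
    have fg: "f \<in> D" "g \<in> D" and h: "h = - (\<i> *\<^sub>C r f) + b g - z *\<^sub>C f" and bf: "b f = z *\<^sub>C g + k"
      using that unfolding Q_shift_iff by (auto simp: algebra_simps)
    obtain f0 g0 where fg0: "f0 \<in> D" "g0 \<in> D" "b g0 + E f0 = z *\<^sub>C h" "b f0 - g0 = k"
      by (rule coercive_onto[OF half coercive E_add E_scale E_bound])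
    have "norm (f0, b f0) \<le> 2 * norm (z *\<^sub>C h, k)"
      using coercive_bound[of "1 / 2" E f0 g0, OF half coercive fg0(1,2)] unfolding fg0(3,4) by simp
    also have "norm (z *\<^sub>C h, k) \<le> norm (z *\<^sub>C h) + norm k"
      by (rule norm_Pair_le)
    also have "\<dots> \<le> cmod z * norm (h, k) + norm (h, k)"
      unfolding norm_scaleC by (intro add_mono mult_left_mono norm_fst_le norm_snd_le) simp
    finally have n0: "norm (f0, b f0) \<le> c * norm (h, k)"
      by (simp add: c_def algebra_simps)
    define f1 where "f1 = f - f0"
    have f1D: "f1 \<in> D"
      using fg fg0 by (simp add: f1_def D_diff)
    have bf1: "b f1 = z *\<^sub>C g - g0"
      using fg fg0 bf by (simp add: f1_def b_diff algebra_simps)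
    then have bf1D: "b f1 \<in> D"
      using fg fg0 by (simp add: D_diff D_scaleC)
    \<comment> \<open>The remainder \<open>f1\<close> satisfies two equations:
      \<open>(M z + t) f1 = t f\<close> estimates \<open>b f1\<close> by coercivity, and
      \<open>M z f1 = t f0\<close> estimates \<open>f1\<close> through the inverse of
      \<open>M z\<close>.\<close>
    have "b (b f1) + E f1 = t *\<^sub>R f"
    proof -
      have "b (b f1) + E f1 = (z *\<^sub>C b g + E f) - (b g0 + E f0)"
        using fg fg0(1,2) unfolding bf1 by (simp add: f1_def E_diff b_diff b_scaleC D_scaleC)
      also have "z *\<^sub>C b g + E f = z *\<^sub>C h + t *\<^sub>R f"
        by (simp add: h E_def scaleC_diff_right scaleC_add_right scaleC_scaleC power2_eq_square mult.commute)
      finally show ?thesis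
        using fg0(3) by simp
    qed
    then have "norm (f1, b f1) \<le> 2 * norm (t *\<^sub>R f, 0::'a)" and "(f1, t *\<^sub>R f0) \<in> M z"
      using coercive_bound[of "1 / 2" E f1 "b f1", OF half coercive f1D bf1D] M_E[OF f1D bf1D]
      by (simp_all add: f1_def scaleR_diff_right)
    with L[of f1 "t *\<^sub>R f0"] have f1: "norm f1 \<le> L * (t * norm f0)" "norm (f1, b f1) \<le> 2 * (t * norm f)"
      using t by (simp_all add: norm_Pair)
    have "L * (t * norm f0) \<le> \<bar>L\<bar> * t * norm f0"
      using t by (simp add: mult.assoc mult_right_mono)
    then have "norm f \<le> (1 + \<bar>L\<bar> * t) * norm f0"
      using f1(1) norm_triangle_ineq[of f0 f1] by (simp add: f1_def algebra_simps)
    also have "\<dots> \<le> (1 + \<bar>L\<bar> * t) * (c * norm (h, k))"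
      using norm_fst_le[of f0 "b f0"] n0 t by (intro mult_left_mono) auto
    finally have nf: "norm f \<le> C1 * norm (h, k)"
      by (simp add: C1_def mult.assoc)
    have "norm (b f) \<le> norm (b f0) + norm (b f1)"
      using norm_triangle_ineq[of "b f0" "b f1"] fg fg0(1,2) by (simp add: f1_def b_diff)
    also have "\<dots> \<le> c * norm (h, k) + 2 * (t * norm f)"
      using norm_snd_le[of "b f0" f0] norm_snd_le[of "b f1" f1] n0 f1(2) by linarith
    also have "t * norm f \<le> t * (C1 * norm (h, k))"
      using nf t by (rule mult_left_mono)
    finally have "norm (b f) \<le> C2 * norm (h, k)"
      by (simp add: C2_def algebra_simps)
    then have "norm (z *\<^sub>C g) \<le> (C2 + 1) * norm (h, k)"
      using norm_triangle_ineq4[of "b f" k] norm_snd_le[of k h] by (simp add: bf algebra_simps)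
    then have "norm g \<le> (C2 + 1) / cmod z * norm (h, k)"
      using z by (simp add: norm_scaleC pos_le_divide_eq mult.commute)
    with nf show ?thesis
      using norm_Pair_le[of f g] by (simp add: distrib_right)
  qed
  then show ?thesis
    unfolding boundedly_invertible_def using solve by (metis prod.collapse)
qed

text \<open>The resolvent is a bounded function \<open>F\<close> whose matrix entries are the
  components of \<open>F (h, 0)\<close> and \<open>F (0, k)\<close>. The second column is computed
  for \<open>k\<close> in \<open>D\<close>, where \<open>B k\<close> makes sense, and extended by
  density.\<close>

lemma resolvent_formula:
  assumes z: "z \<noteq> 0" and bdd: "boundedly_invertible (Q -\<^sub>o z \<cdot>\<^sub>o Id)"
  shows "(Q -\<^sub>o z \<cdot>\<^sub>o Id)\<inverse> =
    block_op (z \<cdot>\<^sub>o (M z)\<inverse>) (closure ((M z)\<inverse> \<circ>\<^sub>o B)) (B \<circ>\<^sub>o (M z)\<inverse>)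
      (inverse z \<cdot>\<^sub>o closure (B \<circ>\<^sub>o (M z)\<inverse> \<circ>\<^sub>o B) -\<^sub>o inverse z \<cdot>\<^sub>o Id)"
proof -
  let ?Q = "Q -\<^sub>o z \<cdot>\<^sub>o Id"
  have lin: "linear_operator ?Q"
    by (rule linear_operator_diff_scale_Id[OF lin_Q])
  obtain K where K: "\<And>x y. (x, y) \<in> ?Q \<Longrightarrow> norm x \<le> K * norm y"
    using bdd unfolding boundedly_invertible_def by blast
  obtain F where F: "\<And>y. (F y, y) \<in> ?Q"
    using bdd unfolding boundedly_invertible_def by metis
  have Q_iff_F: "(x, y) \<in> ?Q \<longleftrightarrow> x = F y" for x y
  proof
    assume "(x, y) \<in> ?Q"
    from K[OF linear_operator_diff[OF lin this F[of y]]] show "x = F y"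
      by simp
  qed (simp add: F)
  have F_add: "F (x + y) = F x + F y" for x y
    using linear_operator_add[OF lin F F, of x y] by (simp add: Q_iff_F)
  have F_scale: "F (c *\<^sub>R x) = c *\<^sub>R F x" for c x
    using linear_operator_scaleC[OF lin F, of "complex_of_real c" x] by (simp add: Q_iff_F scaleR_scaleC)
  have F_norm: "norm (F x) \<le> norm x * K" for x
    using K[OF F, of x] by (simp add: mult.commute)
  have bl_F: "bounded_linear F"
    by (rule bounded_linear_intro[of F K]) (simp_all add: F_add F_scale F_norm)
  obtain L where L: "\<And>x y. (x, y) \<in> M z \<Longrightarrow> norm x \<le> L * norm y"
    using boundedly_invertible_M_of_Q[OF z bdd] unfolding boundedly_invertible_def by blast
  have M_inj: "f = f'" if "(f, y) \<in> M z" "(f', y) \<in> M z" for f f' y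
    using L[OF linear_operator_diff[OF lin_M that]] by simp
  have fst_F: "(f, h) \<in> M z \<longleftrightarrow> f = inverse z *\<^sub>C fst (F (h, 0))" for f h
  proof -
    have "((fst (F (inverse z *\<^sub>C h, 0)), snd (F (inverse z *\<^sub>C h, 0))), (inverse z *\<^sub>C h, 0)) \<in> ?Q"
      by (simp add: F)
    from M_of_Q(1)[OF z this] have "(fst (F (inverse z *\<^sub>C h, 0)), h) \<in> M z"
      using z by (simp add: scaleC_scaleC)
    moreover have "(inverse z *\<^sub>C F (h, 0), inverse z *\<^sub>C (h, 0)) \<in> ?Q"
      by (rule linear_operator_scaleC[OF lin F])
    then have "fst (F (inverse z *\<^sub>C h, 0)) = inverse z *\<^sub>C fst (F (h, 0))"
      by (simp add: Q_iff_F scaleC_prod_def) (metis fst_conv)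
    ultimately show ?thesis
      using M_inj by metis
  qed
  have zM: "z \<cdot>\<^sub>o (M z)\<inverse> = {(h, fst (F (h, 0))) |h. True}"
    using z by (auto simp: scale_op_def fst_F scaleC_scaleC)
  have BM: "B \<circ>\<^sub>o (M z)\<inverse> = {(h, snd (F (h, 0))) |h. True}"
  proof -
    have "b (inverse z *\<^sub>C fst (F (h, 0))) = snd (F (h, 0)) \<and> inverse z *\<^sub>C fst (F (h, 0)) \<in> D" for h
    proof -
      have *: "((fst (F (h, 0)), snd (F (h, 0))), (h, 0)) \<in> ?Q"
        by (simp add: F)
      from * have "fst (F (h, 0)) \<in> D"
        unfolding Q_shift_iff by blast
      with M_of_Q(2)[OF z *] show ?thesis
        using z by (simp add: b_scaleC D_scaleC scaleC_scaleC)
    qed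
    then show ?thesis
      by (auto simp: comp_op_def relcomp_unfold fst_F B_iff)
  qed
  \<comment> \<open>For \<open>k\<close> in \<open>D\<close> the second row shows that
    \<open>b f = z g + k\<close> is in \<open>D\<close>, so \<open>B\<close> may be applied again.
    Solved for \<open>g\<close>, it is the source of the identity term in the lower right
    entry.\<close>
  have k: "(fst (F (0, k)), b k) \<in> M z" "b (fst (F (0, k))) = z *\<^sub>C snd (F (0, k)) + k" "fst (F (0, k)) \<in> D"
    if "k \<in> D" for k
  proof -
    define f g where "f = fst (F (0, k))" and "g = snd (F (0, k))"
    have "((f, g), (0, k)) \<in> ?Q"
      by (simp add: F f_def g_def)
    then have fg: "f \<in> D" "g \<in> D" "b g = \<i> *\<^sub>C r f + z *\<^sub>C f" "b f = z *\<^sub>C g + k"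
      unfolding Q_shift_iff by (auto simp: algebra_simps)
    then show "b f = z *\<^sub>C g + k" "f \<in> D"
      by blast+
    have "b f \<in> D" "b (b f) = z *\<^sub>C b g + b k"
      using fg(2) that unfolding fg(4) by (simp_all add: D_add D_scaleC b_add b_scaleC)
    then show "(f, b k) \<in> M z"
      using fg(1) by (simp add: M_iff fg(3) scaleC_add_right scaleC_scaleC power2_eq_square mult.commute)
  qed
  have MB: "(M z)\<inverse> \<circ>\<^sub>o B = (\<lambda>k. (k, fst (F (0, k)))) ` D"
    using k(1) M_inj by (auto simp: comp_op_def relcomp_unfold B_iff image_iff)
  have "B \<circ>\<^sub>o (M z)\<inverse> \<circ>\<^sub>o B = (\<lambda>k. (k, b (fst (F (0, k))))) ` D"
    unfolding MB using k(3) by (auto simp: comp_op_def relcomp_unfold B_iff image_iff)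
  also have "\<dots> = (\<lambda>k. (k, z *\<^sub>C snd (F (0, k)) + k)) ` D"
    by (rule image_cong[OF refl]) (simp add: k(2))
  finally have BMB: "B \<circ>\<^sub>o (M z)\<inverse> \<circ>\<^sub>o B = (\<lambda>k. (k, z *\<^sub>C snd (F (0, k)) + k)) ` D" .
  have bl_0: "bounded_linear (\<lambda>k. (0::'a, k::'a))"
    by (intro bounded_linear_Pair bounded_linear_zero bounded_linear_ident)
  have bl: "bounded_linear (\<lambda>k. fst (F (0, k)))" "bounded_linear (\<lambda>k. z *\<^sub>C snd (F (0, k)) + k)"
    by (intro bounded_linear_add bounded_linear_ident bounded_linear_compose[OF bounded_linear_scaleC]
        bounded_linear_fst_comp bounded_linear_snd_comp bounded_linear_compose[OF bl_F bl_0])+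
  have clMB: "closure ((M z)\<inverse> \<circ>\<^sub>o B) = range (\<lambda>k. (k, fst (F (0, k))))"
    unfolding MB by (rule closure_graph_dense[OF bl(1) dense_D])
  have clBMB: "closure (B \<circ>\<^sub>o (M z)\<inverse> \<circ>\<^sub>o B) = range (\<lambda>k. (k, z *\<^sub>C snd (F (0, k)) + k))"
    unfolding BMB by (rule closure_graph_dense[OF bl(2) dense_D])
  have "(k, y) \<in> inverse z \<cdot>\<^sub>o closure (B \<circ>\<^sub>o (M z)\<inverse> \<circ>\<^sub>o B) \<longleftrightarrow> y = snd (F (0, k)) + inverse z *\<^sub>C k"
    "(k, y) \<in> inverse z \<cdot>\<^sub>o Id \<longleftrightarrow> y = inverse z *\<^sub>C k" for k y
    unfolding clBMB using z
    by (auto simp: scale_op_def scaleC_add_right scaleC_scaleC intro!: exI[of _ "z *\<^sub>C snd (F (0, k)) + k"])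
  then have "inverse z \<cdot>\<^sub>o closure (B \<circ>\<^sub>o (M z)\<inverse> \<circ>\<^sub>o B) -\<^sub>o inverse z \<cdot>\<^sub>o Id = {(k, snd (F (0, k))) |k. True}"
    unfolding diff_op_def by simp
  note entries = zM clMB BM this
  define P where "P h k = (fst (F (h, 0)) + fst (F (0, k)), snd (F (h, 0)) + snd (F (0, k)))" for h k
  have F_eq: "F (h, k) = P h k" for h k
    using F_add[of "(h, 0)" "(0, k)"] by (simp add: P_def prod_eq_iff)
  have "?Q\<inverse> = {((h, k), P h k) |h k. True}"
    by (auto simp: Q_iff_F F_eq)
  also have "\<dots> = block_op (z \<cdot>\<^sub>o (M z)\<inverse>) (closure ((M z)\<inverse> \<circ>\<^sub>o B)) (B \<circ>\<^sub>o (M z)\<inverse>)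
      (inverse z \<cdot>\<^sub>o closure (B \<circ>\<^sub>o (M z)\<inverse> \<circ>\<^sub>o B) -\<^sub>o inverse z \<cdot>\<^sub>o Id)"
    unfolding entries block_op_def P_def by auto
  finally show ?thesis .
qed

text \<open>If \<open>B\<^sup>2\<close> had a bounded inverse, it would be bounded below by a positive constant.\<close>

lemma not_boundedly_invertible_M_0:
  assumes bottom: "\<And>d. 0 < d \<Longrightarrow> \<exists>\<mu>. Re \<mu> < d \<and> \<mu> \<notin> resolvent_set (B \<circ>\<^sub>o B)"
  shows "\<not> boundedly_invertible (M 0)"
proof
  assume bdd: "boundedly_invertible (M 0)"
  then obtain K0 where K0: "\<And>x y. (x, y) \<in> M 0 \<Longrightarrow> norm x \<le> K0 * norm y"
    unfolding boundedly_invertible_def by blast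
  define K where "K = \<bar>K0\<bar> + 1"
  have K_pos: "0 < K"
    by (simp add: K_def add_nonneg_pos)
  have M0: "(x, y) \<in> M 0 \<longleftrightarrow> x \<in> D \<and> b x \<in> D \<and> y = b (b x)" for x y
    by (simp add: M_iff)
  have below: "(norm f)\<^sup>2 \<le> K * (norm (b f))\<^sup>2" if "f \<in> D" for f
  proof -
    \<comment> \<open>With \<open>f = B^2 w\<close> one has
      \<open>(norm f)^2 = b f \<bullet> b w\<close> and
      \<open>(norm (b w))^2 = w \<bullet> f \<le> K (norm f)^2\<close>; squaring the first estimate
      lets a factor \<open>(norm f)^2\<close> cancel.\<close>
    obtain w where w: "w \<in> D" "b w \<in> D" "f = b (b w)"
      using bdd unfolding boundedly_invertible_def M0 by metis
    have "norm w \<le> K0 * norm f"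
      using K0[of w f] w by (simp add: M0)
    also have "\<dots> \<le> K * norm f"
      by (rule mult_right_mono) (simp_all add: K_def)
    finally have nw: "norm w \<le> K * norm f" .
    have "(norm (b w))\<^sup>2 = w \<bullet> f"
      using b_sym[OF w(1,2)] w(3) by (simp add: power2_norm_eq_inner)
    also have "\<dots> \<le> norm w * norm f"
      by (rule norm_cauchy_schwarz)
    also have "\<dots> \<le> K * norm f * norm f"
      by (rule mult_right_mono[OF nw]) simp
    finally have nbw: "(norm (b w))\<^sup>2 \<le> K * (norm f)\<^sup>2"
      by (simp add: power2_eq_square mult.assoc)
    have "(norm f)\<^sup>2 = b f \<bullet> b w"
      using b_sym[OF that w(2)] w(3) by (simp add: power2_norm_eq_inner)
    also have "\<dots> \<le> norm (b f) * norm (b w)"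
      by (rule norm_cauchy_schwarz)
    finally have "((norm f)\<^sup>2)\<^sup>2 \<le> (norm (b f))\<^sup>2 * (norm (b w))\<^sup>2"
      using power_mono[of "(norm f)\<^sup>2" "norm (b f) * norm (b w)" 2] by (simp add: power_mult_distrib)
    also have "\<dots> \<le> (norm (b f))\<^sup>2 * (K * (norm f)\<^sup>2)"
      by (rule mult_left_mono[OF nbw]) simp
    finally have "(norm f)\<^sup>2 * (norm f)\<^sup>2 \<le> (K * (norm (b f))\<^sup>2) * (norm f)\<^sup>2"
      by (simp add: power2_eq_square ac_simps)
    note prod = this
    show ?thesis
    proof (cases "f = 0")
      case False
      then have "0 < (norm f)\<^sup>2"
        by simp
      with prod show ?thesis
        by (rule mult_right_le_imp_le)
    qed (use K_pos in simp)
  qed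
  obtain \<mu> where \<mu>: "Re \<mu> < 1 / (2 * K)" "\<mu> \<notin> resolvent_set (B \<circ>\<^sub>o B)"
    using bottom[of "1 / (2 * K)"] K_pos by auto
  define E where "E f = - (\<mu> *\<^sub>C f)" for f :: 'a
  \<comment> \<open>One half of \<open>(norm (b f))^2\<close> is kept; the other is at least
    \<open>(norm f)^2 / (2 K)\<close> and beats \<open>Re \<mu>\<close>. So
    \<open>B^2 - \<mu>\<close> is coercive although \<open>\<mu>\<close> is spectral.\<close>
  define c where "c = min (1 / 2) (1 / (2 * K) - Re \<mu>)"
  have c: "0 < c"
    using \<mu>(1) by (simp add: c_def)
  have coercive: "c * ((norm f)\<^sup>2 + (norm (b f))\<^sup>2) \<le> f \<bullet> E f + (norm (b f))\<^sup>2" if "f \<in> D" for f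
  proof -
    have "c \<le> 1 / (2 * K) - Re \<mu>" "c \<le> 1 / 2"
      unfolding c_def by (rule min.cobounded2, rule min.cobounded1)
    then have "c * (norm f)\<^sup>2 \<le> (1 / (2 * K) - Re \<mu>) * (norm f)\<^sup>2" "c * (norm (b f))\<^sup>2 \<le> 1 / 2 * (norm (b f))\<^sup>2"
      using mult_right_mono[OF _ zero_le_power2] by blast+
    moreover have "1 / (2 * K) * (norm f)\<^sup>2 \<le> 1 / 2 * (norm (b f))\<^sup>2"
      using below[OF that] K_pos by (simp add: field_simps)
    moreover have "f \<bullet> E f = - (Re \<mu> * (norm f)\<^sup>2)"
      by (simp add: E_def inner_scaleC_self)
    ultimately show ?thesis
      unfolding distrib_left left_diff_distrib by linarith
  qed
  have E_add: "E (x + y) = E x + E y" and E_scale: "E (s *\<^sub>R x) = s *\<^sub>R E x" for x y s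
    by (simp_all add: E_def scaleC_add_right scaleC_scaleR_commute)
  have E_bound: "norm (E x) \<le> cmod \<mu> * (norm x + norm (b x))" for x
    by (simp add: E_def norm_scaleC distrib_left)
  have iff: "(f, h) \<in> (B \<circ>\<^sub>o B) -\<^sub>o \<mu> \<cdot>\<^sub>o Id \<longleftrightarrow> f \<in> D \<and> b f \<in> D \<and> h = b (b f) + E f" for f h
    by (auto simp: diff_op_def scale_op_def comp_op_def relcomp_unfold B_iff E_def)
  have "((B \<circ>\<^sub>o B) -\<^sub>o \<mu> \<cdot>\<^sub>o Id)\<inverse> \<in> bounded_operators"
  proof (subst converse_bounded_operators_iff)
    have "B \<circ>\<^sub>o B = M 0"
      by (auto simp: M0 comp_op_def relcomp_unfold B_iff)
    then show "linear_operator ((B \<circ>\<^sub>o B) -\<^sub>o \<mu> \<cdot>\<^sub>o Id)"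
      using linear_operator_diff_scale_Id[OF lin_M] by simp
    have "\<exists>f. (f, h) \<in> (B \<circ>\<^sub>o B) -\<^sub>o \<mu> \<cdot>\<^sub>o Id" for h
    proof -
      obtain f g where "f \<in> D" "g \<in> D" "b g + E f = h" "b f - g = 0"
        by (rule coercive_onto[OF c coercive E_add E_scale E_bound])
      then show ?thesis
        by (auto simp: iff)
    qed
    moreover have "norm f \<le> (1 / c) * norm h" if "(f, h) \<in> (B \<circ>\<^sub>o B) -\<^sub>o \<mu> \<cdot>\<^sub>o Id" for f h
    proof -
      have "norm f \<le> norm (f, b f)"
        by (rule norm_fst_le)
      also have "\<dots> \<le> norm (h, 0::'a) / c"
        using coercive_bound[OF c coercive, of f "b f"] that by (simp add: iff)
      finally show ?thesis
        by (simp add: norm_Pair)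
    qed
    ultimately show "boundedly_invertible ((B \<circ>\<^sub>o B) -\<^sub>o \<mu> \<cdot>\<^sub>o Id)"
      unfolding boundedly_invertible_def by blast
  qed
  with \<mu>(2) show False
    by (simp add: resolvent_set_def)
qed

text \<open>The point 0 is removed on the left and excluded on the right by the hypothesis on
  \<open>M 0\<close>; elsewhere the two invertibility lemmas match.\<close>

lemma resolvent_set_Q_eq:
  assumes "\<not> boundedly_invertible (M 0)"
  shows "resolvent_set Q - {0} = {\<zeta>. (M \<zeta>)\<inverse> \<in> bounded_operators}"
proof -
  have "\<zeta> \<noteq> 0 \<and> boundedly_invertible (Q -\<^sub>o \<zeta> \<cdot>\<^sub>o Id) \<longleftrightarrow> boundedly_invertible (M \<zeta>)" for \<zeta>
    using assms boundedly_invertible_M_of_Q[of \<zeta>] boundedly_invertible_Q_of_M[of \<zeta>] by (cases "\<zeta> = 0") auto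
  then show ?thesis
    unfolding resolvent_set_def M_inverse_bounded_iff Q_inverse_bounded_iff by auto
qed

lemma bounded_operators_eq_pencil_resolvent_set:
  "{\<zeta>. (M \<zeta>)\<inverse> \<in> bounded_operators} = pencil_resolvent_set M"
proof -
  have "M \<zeta> -\<^sub>o 0 \<cdot>\<^sub>o Id = M \<zeta>" for \<zeta>
    by (force simp: diff_op_def scale_op_def)
  then show ?thesis
    by (simp add: pencil_resolvent_set_def resolvent_set_def)
qed

section \<open>The accretive case\<close>

lemma accretive_r:
  assumes "accretive R" "x \<in> D"
  shows "0 \<le> x \<bullet> r x"
proof -
  have "(x, r x) \<in> R"
    using R_iff[OF assms(2)] by blast
  with assms(1) show ?thesis
    unfolding accretive_def inner_eq_Re_cinner by blast
qed

text \<open>At \<open>z = \<i> l\<close> the pencil is \<open>B^2 + l R + l^2\<close>. Accretivity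
  makes the middle term of the form nonnegative, so the smaller of 1 and \<open>l^2\<close> is a
  coercivity constant.\<close>

lemma boundedly_invertible_M_imaginary:
  assumes acc: "accretive R" and l: "0 < l"
  shows "boundedly_invertible (M (\<i> * complex_of_real l))"
proof -
  obtain K where K: "0 \<le> K" "\<And>x. x \<in> D \<Longrightarrow> norm (r x) \<le> K * (norm x + norm (b x))"
    using r_bound by blast
  define E where "E f = l *\<^sub>R r f + (l * l) *\<^sub>R f" for f
  define c where "c = min 1 (l * l)"
  have c: "0 < c"
    using l by (simp add: c_def)
  have coercive: "c * ((norm f)\<^sup>2 + (norm (b f))\<^sup>2) \<le> f \<bullet> E f + (norm (b f))\<^sup>2" if "f \<in> D" for f
  proof -
    have "c * (norm f)\<^sup>2 \<le> l * l * (norm f)\<^sup>2" "c * (norm (b f))\<^sup>2 \<le> 1 * (norm (b f))\<^sup>2"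
      by (intro mult_right_mono; simp add: c_def)+
    moreover have "f \<bullet> E f = l * (f \<bullet> r f) + l * l * (norm f)\<^sup>2"
      by (simp add: E_def inner_add_right power2_norm_eq_inner)
    moreover have "0 \<le> l * (f \<bullet> r f)"
      using l accretive_r[OF acc that] by simp
    ultimately show ?thesis
      unfolding distrib_left by linarith
  qed
  have E_add: "E (x + y) = E x + E y" if "x \<in> D" "y \<in> D" for x y
    using that by (simp add: E_def r_add scaleR_add_right)
  have E_scale: "E (s *\<^sub>R x) = s *\<^sub>R E x" if "x \<in> D" for x s
    using that by (simp add: E_def r_scaleR scaleR_add_right mult.commute mult.left_commute)
  have E_bound: "norm (E x) \<le> (l * K + l * l) * (norm x + norm (b x))" if "x \<in> D" for x
  proof -
    have "norm (E x) \<le> l * norm (r x) + l * l * norm x"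
      unfolding E_def using norm_triangle_ineq[of "l *\<^sub>R r x" "(l * l) *\<^sub>R x"] l by simp
    also have "l * norm (r x) \<le> l * (K * (norm x + norm (b x)))"
      using K(2)[OF that] l by (simp add: mult_left_mono)
    also have "l * l * norm x \<le> l * l * (norm x + norm (b x))"
      using l by (simp add: mult_left_mono)
    finally show ?thesis
      by (simp add: algebra_simps)
  qed
  have iff: "(f, h) \<in> M (\<i> * complex_of_real l) \<longleftrightarrow> f \<in> D \<and> b f \<in> D \<and> h = b (b f) + E f" for f h
  proof -
    have "\<i> * (\<i> * complex_of_real l) = - complex_of_real l"
      "(\<i> * complex_of_real l)\<^sup>2 = - complex_of_real (l * l)"
      by (simp_all add: complex_eq_iff power2_eq_square)
    then have "b (b f) - (\<i> * (\<i> * complex_of_real l)) *\<^sub>C r f - (\<i> * complex_of_real l)\<^sup>2 *\<^sub>C f = b (b f) + E f"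
      by (simp add: E_def scaleR_scaleC add.assoc del: of_real_mult)
    then show ?thesis
      by (simp only: M_iff)
  qed
  have "\<exists>f. (f, h) \<in> M (\<i> * complex_of_real l)" for h
  proof -
    obtain f g where "f \<in> D" "g \<in> D" "b g + E f = h" "b f - g = 0"
      by (rule coercive_onto[OF c coercive E_add E_scale E_bound])
    then show ?thesis
      by (auto simp: iff)
  qed
  moreover have "norm f \<le> (1 / c) * norm h" if "(f, h) \<in> M (\<i> * complex_of_real l)" for f h
  proof -
    have "norm f \<le> norm (f, b f)"
      by (rule norm_fst_le)
    also have "\<dots> \<le> norm (h, 0::'a) / c"
      using coercive_bound[OF c coercive, of f "b f"] that by (simp add: iff)
    finally show ?thesis
      by (simp add: norm_Pair)
  qed
  ultimately show ?thesis
    unfolding boundedly_invertible_def by blast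
qed

text \<open>The off-diagonal entries contribute a purely imaginary amount by symmetry of
  \<open>b\<close>, and on the diagonal \<open>- \<i>\<close> times \<open>- \<i> R\<close> is
  \<open>- R\<close>.\<close>

lemma inner_minus_i_Q:
  assumes acc: "accretive R" and "(x, y) \<in> Q"
  shows "x \<bullet> ((- \<i>) *\<^sub>C y) \<le> 0"
proof -
  obtain f g where x: "x = (f, g)"
    by (cases x)
  have fg: "f \<in> D" "g \<in> D" and y: "y = (- (\<i> *\<^sub>C r f) + b g, b f)"
    using assms(2) unfolding x by (cases y; simp add: Q_iff)+
  have "f \<bullet> (\<i> *\<^sub>C b g) = (- \<i> *\<^sub>C f) \<bullet> b g"
    by (simp add: inner_scaleC_left del: scaleC_minus_left)
  also have "\<dots> = b (- \<i> *\<^sub>C f) \<bullet> g"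
    using fg by (intro b_sym D_scaleC)
  also have "\<dots> = - (g \<bullet> (\<i> *\<^sub>C b f))"
    using fg by (simp add: b_minus D_scaleC b_scaleC inner_commute)
  finally have "f \<bullet> (\<i> *\<^sub>C b g) + g \<bullet> (\<i> *\<^sub>C b f) = 0"
    by simp
  moreover have "x \<bullet> ((- \<i>) *\<^sub>C y) = - (f \<bullet> r f) - (f \<bullet> (\<i> *\<^sub>C b g) + g \<bullet> (\<i> *\<^sub>C b f))"
    by (simp add: x y scaleC_prod_def inner_prod_def scaleC_diff_right scaleC_add_right scaleC_scaleC inner_add_right inner_diff_right)
  ultimately show ?thesis
    using accretive_r[OF acc fg(1)] by simp
qed

lemma accretive_i_Q:
  assumes "accretive R"
  shows "accretive (\<i> \<cdot>\<^sub>o Q)"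
  unfolding accretive_def
proof (rule ballI, rule case_prodI2, simp only:)
  fix x w assume "(x, w) \<in> \<i> \<cdot>\<^sub>o Q"
  then obtain u where "w = \<i> *\<^sub>C u" "(x, u) \<in> Q"
    unfolding scale_op_def by blast
  with inner_minus_i_Q[OF assms, of x u] show "0 \<le> Re (cinner x w)"
    by (simp add: inner_eq_Re_cinner[symmetric])
qed

lemma maximal_dissipative_minus_i_Q:
  assumes acc: "accretive R"
  shows "maximal_dissipative ((- \<i>) \<cdot>\<^sub>o Q)"
proof
  have iff: "(x, y) \<in> (- \<i>) \<cdot>\<^sub>o Q \<longleftrightarrow> (x, \<i> *\<^sub>C y) \<in> Q" for x y
  proof -
    have "(- \<i>) *\<^sub>C \<i> *\<^sub>C u = u" "\<i> *\<^sub>C (- \<i>) *\<^sub>C u = u" for u :: "'a \<times> 'a"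
      by (simp_all add: scaleC_scaleC)
    moreover have "(x, y) \<in> (- \<i>) \<cdot>\<^sub>o Q \<longleftrightarrow> (\<exists>u. y = (- \<i>) *\<^sub>C u \<and> (x, u) \<in> Q)"
      unfolding scale_op_def by blast
    ultimately show ?thesis
      by metis
  qed
  show "linear_operator ((- \<i>) \<cdot>\<^sub>o Q)"
  proof (rule linear_operatorI)
    show "(0, 0) \<in> (- \<i>) \<cdot>\<^sub>o Q"
      using linear_operator_zero[OF lin_Q] by (simp add: iff)
    show "(x + x', y + y') \<in> (- \<i>) \<cdot>\<^sub>o Q" if "(x, y) \<in> (- \<i>) \<cdot>\<^sub>o Q" "(x', y') \<in> (- \<i>) \<cdot>\<^sub>o Q" for x y x' y'
      using linear_operator_add[OF lin_Q that[unfolded iff]] by (simp add: iff scaleC_add_right)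
    show "(a *\<^sub>C x, a *\<^sub>C y) \<in> (- \<i>) \<cdot>\<^sub>o Q" if "(x, y) \<in> (- \<i>) \<cdot>\<^sub>o Q" for a x y
      using linear_operator_scaleC[OF lin_Q that[unfolded iff], of a] by (simp add: iff scaleC_scaleC mult.commute)
    show "y = y'" if "(x, y) \<in> (- \<i>) \<cdot>\<^sub>o Q" "(x, y') \<in> (- \<i>) \<cdot>\<^sub>o Q" for x y y'
    proof -
      have "\<i> *\<^sub>C y = \<i> *\<^sub>C y'"
        using linear_operator_unique[OF lin_Q that[unfolded iff]] .
      then have "(- \<i>) *\<^sub>C \<i> *\<^sub>C y = (- \<i>) *\<^sub>C \<i> *\<^sub>C y'"
        by simp
      then show ?thesis
        by (simp only: scaleC_scaleC) simp
    qed
  qed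
  have "Domain ((- \<i>) \<cdot>\<^sub>o Q) = D \<times> D"
  proof (intro equalityI subsetI)
    fix x assume "x \<in> Domain ((- \<i>) \<cdot>\<^sub>o Q)"
    then obtain y where "((fst x, snd x), (fst y, snd y)) \<in> Q"
      by (auto simp: scale_op_def)
    then show "x \<in> D \<times> D"
      unfolding Q_iff by (simp add: mem_Times_iff)
  next
    fix x assume "x \<in> D \<times> D"
    then have "((fst x, snd x), (- (\<i> *\<^sub>C r (fst x)) + b (snd x), b (fst x))) \<in> Q"
      unfolding Q_iff by (simp add: mem_Times_iff)
    then show "x \<in> Domain ((- \<i>) \<cdot>\<^sub>o Q)"
      unfolding scale_op_def prod.collapse by blast
  qed
  then show "densely_defined ((- \<i>) \<cdot>\<^sub>o Q)"
    by (simp add: densely_defined_def closure_Times dense_D)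
  show "x \<bullet> y \<le> 0" if "(x, y) \<in> (- \<i>) \<cdot>\<^sub>o Q" for x y
    using that inner_minus_i_Q[OF acc] by (auto simp: scale_op_def)
  show "\<exists>w y. (w, y) \<in> (- \<i>) \<cdot>\<^sub>o Q \<and> w - h *\<^sub>R y = x" if h: "0 < h" for h :: real and x
  proof -
    \<comment> \<open>The equation \<open>w + \<i> h Q w = x\<close>, multiplied by
      \<open>- \<i> / h\<close>, is the resolvent equation of \<open>Q\<close> at
      \<open>\<i> / h\<close>.\<close>
    let ?z = "\<i> * complex_of_real (1 / h)"
    have "boundedly_invertible (Q -\<^sub>o ?z \<cdot>\<^sub>o Id)"
      using h by (intro boundedly_invertible_Q_of_M boundedly_invertible_M_imaginary acc) simp_all
    then obtain w where "(w, (- \<i> * complex_of_real (1 / h)) *\<^sub>C x) \<in> Q -\<^sub>o ?z \<cdot>\<^sub>o Id"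
      unfolding boundedly_invertible_def by blast
    then obtain u where u: "(w, u) \<in> Q" "u - ?z *\<^sub>C w = (- \<i> * complex_of_real (1 / h)) *\<^sub>C x"
      unfolding mem_diff_scale_Id_iff by (metis add_diff_cancel_right')
    have "(w, (- \<i>) *\<^sub>C u) \<in> (- \<i>) \<cdot>\<^sub>o Q"
      using u(1) unfolding scale_op_def by blast
    moreover have "w - h *\<^sub>R (- \<i>) *\<^sub>C u = x"
    proof -
      have "(\<i> * complex_of_real h) *\<^sub>C (u - ?z *\<^sub>C w)
          = (\<i> * complex_of_real h) *\<^sub>C (- \<i> * complex_of_real (1 / h)) *\<^sub>C x"
        by (simp only: u(2))
      moreover have "\<i> * complex_of_real h * ?z = - 1" "\<i> * complex_of_real h * (- \<i> * complex_of_real (1 / h)) = 1"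
        using h by simp_all
      ultimately have "(\<i> * complex_of_real h) *\<^sub>C u + w = x"
        by (simp only: scaleC_diff_right scaleC_scaleC) simp
      then show ?thesis
        by (simp add: scaleR_scaleC scaleC_scaleC mult.commute add.commute)
    qed
    ultimately show ?thesis
      by blast
  qed
qed

end

theorem theorem5p3:
  fixes A :: "('a::chilbert_space, 'b::chilbert_space) graph"
    and R :: "('a, 'a) graph"
  assumes "separable_space (euclidean :: 'a topology)"
    and "separable_space (euclidean :: 'b topology)"
    and "densely_defined A"
    and "closed_operator A"
    and "ker_op A = {0}"
    and "(INF \<mu>\<in>spectrum (adj A \<circ>\<^sub>o A). ereal (Re \<mu>)) = 0"
    and "densely_defined R"
    and "closable_operator R"
    and "Domain A \<subseteq> Domain R \<inter> Domain (adj R)"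
  shows "injective_operator (Q_op A R) \<and>
    closed_operator (Q_op A R) \<and>
    (\<forall>z \<in> resolvent_set (Q_op A R) - {0}.
      (Q_op A R -\<^sub>o z \<cdot>\<^sub>o Id)\<inverse> =
      block_op
        (z \<cdot>\<^sub>o (pencil A R z)\<inverse>)
        (closure ((pencil A R z)\<inverse> \<circ>\<^sub>o abs_op A))
        (abs_op A \<circ>\<^sub>o (pencil A R z)\<inverse>)
        (inverse z \<cdot>\<^sub>o closure (abs_op A \<circ>\<^sub>o (pencil A R z)\<inverse> \<circ>\<^sub>o abs_op A) -\<^sub>o inverse z \<cdot>\<^sub>o Id)) \<and>
    resolvent_set (Q_op A R) - {0} = {\<zeta>. (pencil A R \<zeta>)\<inverse> \<in> bounded_operators} \<and>
    {\<zeta>. (pencil A R \<zeta>)\<inverse> \<in> bounded_operators} = pencil_resolvent_set (pencil A R) \<and>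
    spectrum (Q_op A R) \<union> {0} = pencil_spectrum (pencil A R) \<and>
    (accretive R \<longrightarrow>
      (\<forall>l::real. 0 < l \<longrightarrow> \<i> * complex_of_real l \<in> pencil_resolvent_set (pencil A R)) \<and>
      accretive (\<i> \<cdot>\<^sub>o Q_op A R) \<and>
      generates_contraction_semigroup ((- \<i>) \<cdot>\<^sub>o Q_op A R))"
proof -
  note B = abs_op_props[OF assms(4,3)]
  have lin_A: "linear_operator A"
    using assms(4) by (simp add: closed_operator_def)
  interpret operator_pencil "abs_op A" R
  proof
    show "selfadjoint (abs_op A)" "nonnegative (abs_op A)"
      by (rule B)+
    show "linear_operator R"
      using assms(8) by (simp add: closable_operator_def)
    show "Domain (abs_op A) \<subseteq> Domain R" "Domain (abs_op A) \<subseteq> Domain (adj R)"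
      using assms(9) Domain_abs_op[OF assms(4,3)] by auto
    fix x assume "(x, 0) \<in> abs_op A"
    moreover have "(0, 0) \<in> abs_op A"
      using selfadjoint_closed_operator[OF B(1)] by (simp add: closed_operator_def linear_operator_zero)
    \<comment> \<open>A kernel vector of \<open>|A|\<close> is one of \<open>adj A A\<close>, and
      there \<open>y = A x\<close> pairs with itself to zero, so \<open>x\<close> is in the kernel
      of \<open>A\<close>.\<close>
    ultimately have "(x, 0) \<in> abs_op A \<circ>\<^sub>o abs_op A"
      unfolding comp_op_def by blast
    then obtain y where y: "(x, y) \<in> A" "(y, 0) \<in> adj A"
      unfolding B(3) by (auto simp: comp_op_def)
    then have "y = 0"
      using inner_adj[OF y] by simp
    with y(1) assms(5) show "x = 0"
      by (auto simp: ker_op_def)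
  qed
  have Q_eq: "Q_op A R = Q" and M_eq: "pencil A R = M"
    by (simp_all add: Q_op_def Q_def pencil_def M_def fun_eq_iff)
  have "\<not> boundedly_invertible (M 0)"
  proof (rule not_boundedly_invertible_M_0)
    fix d :: real assume "0 < d"
    \<comment> \<open>An infimum equal to 0 puts spectrum of \<open>adj A A\<close> into every half
      plane \<open>Re \<mu> < d\<close>.\<close>
    then have "(INF \<mu>\<in>spectrum (adj A \<circ>\<^sub>o A). ereal (Re \<mu>)) < ereal d"
      using assms(6) by simp
    then show "\<exists>\<mu>. Re \<mu> < d \<and> \<mu> \<notin> resolvent_set (abs_op A \<circ>\<^sub>o abs_op A)"
      unfolding INF_less_iff B(3) spectrum_def by auto
  qed
  note res = resolvent_set_Q_eq[OF this]
  have spec: "spectrum Q \<union> {0} = pencil_spectrum M"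
    using res bounded_operators_eq_pencil_resolvent_set
    unfolding spectrum_def pencil_spectrum_def pencil_resolvent_set_def by blast
  have formula: "(Q -\<^sub>o z \<cdot>\<^sub>o Id)\<inverse> =
      block_op (z \<cdot>\<^sub>o (M z)\<inverse>) (closure ((M z)\<inverse> \<circ>\<^sub>o abs_op A)) (abs_op A \<circ>\<^sub>o (M z)\<inverse>)
        (inverse z \<cdot>\<^sub>o closure (abs_op A \<circ>\<^sub>o (M z)\<inverse> \<circ>\<^sub>o abs_op A) -\<^sub>o inverse z \<cdot>\<^sub>o Id)"
    if "z \<in> resolvent_set Q - {0}" for z
    using that by (intro resolvent_formula) (simp_all add: resolvent_set_def Q_inverse_bounded_iff)
  have imaginary: "\<i> * complex_of_real l \<in> pencil_resolvent_set M" if "accretive R" "0 < l" for l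
    using boundedly_invertible_M_imaginary[OF that]
    unfolding bounded_operators_eq_pencil_resolvent_set[symmetric] mem_Collect_eq M_inverse_bounded_iff .
  have generates: "generates_contraction_semigroup ((- \<i>) \<cdot>\<^sub>o Q)" if "accretive R"
    using maximal_dissipative.generates_contraction_semigroup[OF maximal_dissipative_minus_i_Q[OF that]] .
  show ?thesis
    unfolding Q_eq M_eq
    using injective_Q closed_Q formula res bounded_operators_eq_pencil_resolvent_set spec
      imaginary accretive_i_Q generates by blast
qed

end
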